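(* The natural transformation $\beta: TC\to CT$ with components $\beta_A:\mathrm{Sha}(A^{\mathbb N})\to(\mathrm{Sha}(A))^{\mathbb N}$, $A\in\mathbf{ALG}$, is a mixed distributive law of the monad $\mathbf T=\langle T,\eta,\mu\rangle$ over the comonad $\mathbf C=\langle C,\varepsilon,\delta\rangle$ on $\mathbf{ALG}$.
   Context: Fix a commutative ring $\mathbf k$ with identity and $\lambda\in\mathbf k$. All algebras are commutative $\mathbf k$-algebras with identity, algebra homomorphisms preserve the identity, and tensor products are over $\mathbf k$. $\mathbf{ALG}$ is the category of such algebras; $\mathbb N=\{0,1,2,\dots\}$. A Rota-Baxter operator (of weight $\lambda$) on an algebra $R$ is a $\mathbf k$-linear $P:R\to R$ with $P(x)P(y)=P(xP(y))+P(yP(x))+\lambda P(xy)$ for all $x,y\in R$; $(R,P)$ is then a Rota-Baxter algebra. A Rota-Baxter algebra homomorphism $(R,P)\to(S,Q)$ is an algebra homomorphism $f$ with $f\circ P=Q\circ f$. For an algebra $A$, $\mathrm{Sha}(A)=\bigoplus_{i\ge1}A^{\otimes i}$ as a module, with product $\diamond$ defined for $\mathfrak a=a_0\otimes\cdots\otimes a_m$, $\mathfrak b=b_0\otimes\cdots\otimes b_n$ by: $\mathfrak a\diamond\mathfrak b=a_0b_0\otimes b_1\otimes\cdots\otimes b_n$ if $m=0$; $\mathfrak a\diamond\mathfrak b=a_0b_0\otimes a_1\otimes\cdots\otimes a_m$ if $n=0$; and, if $m,n>0$, recursively, $\mathfrak a\diamond\mathfrak b=(a_0b_0)\otimes\big((a_1\otimes\cdots\otimes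 a_m)\diamond(\mathbf 1_A\otimes b_1\otimes\cdots\otimes b_n)+(\mathbf 1_A\otimes a_1\otimes\cdots\otimes a_m)\diamond(b_1\otimes\cdots\otimes b_n)+\lambda(a_1\otimes\cdots\otimes a_m)\diamond(b_1\otimes\cdots\otimes b_n)\big)$. $P_A(x_0\otimes\cdots\otimes x_n)=\mathbf 1_A\otimes x_0\otimes\cdots\otimes x_n$. It is known that $(\mathrm{Sha}(A),P_A)$ with the inclusion $\eta_A:A\to\mathrm{Sha}(A)$ is the free Rota-Baxter algebra on the algebra $A$. Monad $\mathbf T=\langle T,\eta,\mu\rangle$ on $\mathbf{ALG}$: $T(A)=\mathrm{Sha}(A)$, $T(\varphi)=\mathrm{Sha}(\varphi)$ applies $\varphi$ to each tensor factor, $\eta_A$ is the inclusion, and $\mu_A:\mathrm{Sha}(\mathrm{Sha}(A))\to\mathrm{Sha}(A)$ is $\mu_A(w_0\otimes\cdots\otimes w_k)=w_0P_A(w_1P_A(\cdots P_A(w_k)\cdots))$ for $w_i\in\mathrm{Sha}(A)$. For an algebra $A$, $A^{\mathbb N}$ is the algebra of all functions $\mathbb N\to A$ with the $\lambda$-Hurwitz product $(fg)(n)=\sum_{k=0}^n\sum_{j=0}^{n-k}\binom nk\binom{n-k}j\lambda^kf(n-j)g(k+j)$. For an algebra homomorphism $h:A\to B$, $h^{\mathbb N}(f)(n)=h(f(n))$. Comonad $\mathbf C=\langle C,\varepsilon,\delta\rangle$ on $\mathbf{ALG}$: $C(A)=A^{\mathbb N}$, $C(h)=h^{\mathbb N}$,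 $\varepsilon_A(f)=f(0)$, and $\delta_A:A^{\mathbb N}\to(A^{\mathbb N})^{\mathbb N}$, $(\delta_A(f)(m))(n)=f(m+n)$. If $P$ is a Rota-Baxter operator on $A$, then $\widetilde P:A^{\mathbb N}\to A^{\mathbb N}$, $\widetilde P(f)(0)=P(f(0))$, $\widetilde P(f)(n)=f(n-1)$ for $n\ge1$, is a Rota-Baxter operator on $A^{\mathbb N}$. The map $\beta_A:(\mathrm{Sha}(A^{\mathbb N}),P_{A^{\mathbb N}})\to((\mathrm{Sha}(A))^{\mathbb N},\widetilde{P_A})$ is the unique Rota-Baxter algebra homomorphism with $\beta_A\circ\eta_{A^{\mathbb N}}=(\eta_A)^{\mathbb N}$; these are the components of a natural transformation $\beta:TC\to CT$. A mixed distributive law of a monad $\langle T,\eta,\mu\rangle$ over a comonad $\langle C,\varepsilon,\delta\rangle$ on the same category is a natural transformation $\beta:TC\to CT$ such that: (1) $\beta\circ\eta C=C\eta$; (2) $\varepsilon T\circ\beta=T\varepsilon$; (3) $\delta T\circ\beta=C\beta\circ\beta C\circ T\delta$; (4) $\beta\circ\mu C=C\mu\circ\beta T\circ T\beta$. *)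

theory Defs
  imports "HOL-Algebra.QuotRing" "HOL-Algebra.Module" "HOL-Library.FuncSet"
begin

text \<open>The objects of the category are the pairs \<open>A\<close> with \<open>algebra K A\<close>; this locale already demands
  that \<open>K\<close> and \<open>A\<close> are commutative rings with identity. A morphism carries the information that
  its source and its target are objects. Only the values of a map on the carrier matter.\<close>

definition alg_hom :: "'k ring \<Rightarrow> ('k, 'a) module \<Rightarrow> ('k, 'b) module \<Rightarrow> ('a \<Rightarrow> 'b) set" where
  "alg_hom K A B = {h. algebra K A \<and> algebra K B \<and> h \<in> ring_hom A B \<and>
     (\<forall>c\<in>carrier K. \<forall>x\<in>carrier A. h (c \<odot>\<^bsub>A\<^esub> x) = c \<odot>\<^bsub>B\<^esub> h x)}"

definition rota_baxter :: "'k ring \<Rightarrow> 'k \<Rightarrow> ('k, 'a) module \<Rightarrow> ('a \<Rightarrow> 'a) \<Rightarrow> bool" where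
  "rota_baxter K l R P \<longleftrightarrow> algebra K R \<and> P \<in> carrier R \<rightarrow> carrier R \<and>
     (\<forall>x\<in>carrier R. \<forall>y\<in>carrier R. P (x \<oplus>\<^bsub>R\<^esub> y) = P x \<oplus>\<^bsub>R\<^esub> P y) \<and>
     (\<forall>c\<in>carrier K. \<forall>x\<in>carrier R. P (c \<odot>\<^bsub>R\<^esub> x) = c \<odot>\<^bsub>R\<^esub> P x) \<and>
     (\<forall>x\<in>carrier R. \<forall>y\<in>carrier R.
        P x \<otimes>\<^bsub>R\<^esub> P y =
          P (x \<otimes>\<^bsub>R\<^esub> P y) \<oplus>\<^bsub>R\<^esub> P (y \<otimes>\<^bsub>R\<^esub> P x) \<oplus>\<^bsub>R\<^esub> l \<odot>\<^bsub>R\<^esub> P (x \<otimes>\<^bsub>R\<^esub> y))"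

definition rb_hom ::
  "'k ring \<Rightarrow> 'k \<Rightarrow> ('k, 'a) module \<Rightarrow> ('a \<Rightarrow> 'a) \<Rightarrow> ('k, 'b) module \<Rightarrow> ('b \<Rightarrow> 'b) \<Rightarrow> ('a \<Rightarrow> 'b) set" where
  "rb_hom K l R P S Q = {f. rota_baxter K l R P \<and> rota_baxter K l S Q \<and>
     f \<in> alg_hom K R S \<and> (\<forall>x\<in>carrier R. f (P x) = Q (f x))}"

text \<open>A nonempty word \<open>[a\<^sub>0, \<dots>, a\<^sub>n]\<close> over the carrier of \<open>A\<close> is a generator standing for the pure
  tensor \<open>a\<^sub>0 \<otimes> \<dots> \<otimes> a\<^sub>n\<close>. The module \<open>\<Oplus>\<^sub>i A\<^sup>\<otimes>\<^sup>i\<close>, \<open>i \<ge> 1\<close>, is the free module on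
  these words (finitely supported functions from words to \<open>K\<close>) modulo the submodule generated by
  the relations expressing multilinearity. Each relation only involves words of one length, so
  this quotient is the direct sum, over \<open>i \<ge> 1\<close>, of the usual presentations of the \<open>A\<^sup>\<otimes>\<^sup>i\<close>.\<close>

definition word :: "'k ring \<Rightarrow> 'a list \<Rightarrow> ('a list \<Rightarrow> 'k)" where
  "word K w = (\<lambda>v. if v = w then \<one>\<^bsub>K\<^esub> else \<zero>\<^bsub>K\<^esub>)"

definition words :: "('k, 'a) module \<Rightarrow> 'a list set" where
  "words A = {w. w \<noteq> [] \<and> set w \<subseteq> carrier A}"

definition supp :: "'k ring \<Rightarrow> ('a list \<Rightarrow> 'k) \<Rightarrow> 'a list set" where
  "supp K u = {w. u w \<noteq> \<zero>\<^bsub>K\<^esub>}"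

text \<open>The linear extension of \<open>v \<mapsto> a \<otimes> v\<close> (prefixing a letter).\<close>

definition prefix_letter :: "'k ring \<Rightarrow> 'a \<Rightarrow> ('a list \<Rightarrow> 'k) \<Rightarrow> ('a list \<Rightarrow> 'k)" where
  "prefix_letter K a u = (\<lambda>w. if w \<noteq> [] \<and> hd w = a then u (tl w) else \<zero>\<^bsub>K\<^esub>)"

text \<open>The product \<open>\<diamond>\<close> of two pure tensors, as a linear combination of pure tensors. The value on
  an empty word is irrelevant.\<close>

fun diamond :: "'k ring \<Rightarrow> 'k \<Rightarrow> ('k, 'a) module \<Rightarrow> 'a list \<Rightarrow> 'a list \<Rightarrow> ('a list \<Rightarrow> 'k)" where
  "diamond K l A [a0] (b0 # bs) = word K ((a0 \<otimes>\<^bsub>A\<^esub> b0) # bs)"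
| "diamond K l A (a0 # a1 # as) [b0] = word K ((a0 \<otimes>\<^bsub>A\<^esub> b0) # a1 # as)"
| "diamond K l A (a0 # a1 # as) (b0 # b1 # bs) =
     prefix_letter K (a0 \<otimes>\<^bsub>A\<^esub> b0)
       (\<lambda>w. diamond K l A (a1 # as) (\<one>\<^bsub>A\<^esub> # b1 # bs) w
          \<oplus>\<^bsub>K\<^esub> diamond K l A (\<one>\<^bsub>A\<^esub> # a1 # as) (b1 # bs) w
          \<oplus>\<^bsub>K\<^esub> l \<otimes>\<^bsub>K\<^esub> diamond K l A (a1 # as) (b1 # bs) w)"
| "diamond K l A _ _ = (\<lambda>_. \<zero>\<^bsub>K\<^esub>)"

text \<open>The free module on the words, with \<open>\<diamond>\<close> extended bilinearly.\<close>

definition free_words :: "'k ring \<Rightarrow> 'k \<Rightarrow> ('k, 'a) module \<Rightarrow> ('k, 'a list \<Rightarrow> 'k) module" where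
  "free_words K l A =
    \<lparr>carrier = {u. (\<forall>w. u w \<in> carrier K) \<and> finite (supp K u) \<and> supp K u \<subseteq> words A},
     mult = (\<lambda>u v w. \<Oplus>\<^bsub>K\<^esub>x\<in>supp K u. \<Oplus>\<^bsub>K\<^esub>y\<in>supp K v.
       u x \<otimes>\<^bsub>K\<^esub> v y \<otimes>\<^bsub>K\<^esub> diamond K l A x y w),
     one = word K [\<one>\<^bsub>A\<^esub>],
     zero = (\<lambda>w. \<zero>\<^bsub>K\<^esub>),
     add = (\<lambda>u v w. u w \<oplus>\<^bsub>K\<^esub> v w),
     smult = (\<lambda>c u w. c \<otimes>\<^bsub>K\<^esub> u w)\<rparr>"

definition multilinear_rels :: "'k ring \<Rightarrow> 'k \<Rightarrow> ('k, 'a) module \<Rightarrow> ('a list \<Rightarrow> 'k) set" where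
  "multilinear_rels K l A =
     {word K (us @ [a \<oplus>\<^bsub>A\<^esub> b] @ vs)
        \<ominus>\<^bsub>free_words K l A\<^esub> (word K (us @ [a] @ vs) \<oplus>\<^bsub>free_words K l A\<^esub> word K (us @ [b] @ vs))
      | us vs a b. set us \<subseteq> carrier A \<and> set vs \<subseteq> carrier A \<and> a \<in> carrier A \<and> b \<in> carrier A} \<union>
     {word K (us @ [c \<odot>\<^bsub>A\<^esub> a] @ vs)
        \<ominus>\<^bsub>free_words K l A\<^esub> (c \<odot>\<^bsub>free_words K l A\<^esub> word K (us @ [a] @ vs))
      | us vs c a. set us \<subseteq> carrier A \<and> set vs \<subseteq> carrier A \<and> c \<in> carrier K \<and> a \<in> carrier A}"

definition tensor_null :: "'k ring \<Rightarrow> 'k \<Rightarrow> ('k, 'a) module \<Rightarrow> ('a list \<Rightarrow> 'k) set" where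
  "tensor_null K l A =
     \<Inter>{N. submodule N K (free_words K l A) \<and> multilinear_rels K l A \<subseteq> N}"

definition Sha :: "'k ring \<Rightarrow> 'k \<Rightarrow> ('k, 'a) module \<Rightarrow> ('k, ('a list \<Rightarrow> 'k) set) module" where
  "Sha K l A =
    (let F = free_words K l A; N = tensor_null K l A in
    \<lparr>carrier = carrier (F Quot N), mult = mult (F Quot N), one = one (F Quot N),
     zero = zero (F Quot N), add = add (F Quot N),
     smult = (\<lambda>c X. \<Union>u\<in>X. N +>\<^bsub>F\<^esub> (c \<odot>\<^bsub>F\<^esub> u))\<rparr>)"

definition tensor :: "'k ring \<Rightarrow> 'k \<Rightarrow> ('k, 'a) module \<Rightarrow> 'a list \<Rightarrow> ('a list \<Rightarrow> 'k) set" where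
  "tensor K l A w = tensor_null K l A +>\<^bsub>free_words K l A\<^esub> word K w"

text \<open>For a map \<open>g\<close> on words that is multilinear on the words of each length, \<open>tensor_lift K M g\<close> is
  the induced linear map with \<open>a\<^sub>0 \<otimes> \<dots> \<otimes> a\<^sub>n \<mapsto> g [a\<^sub>0, \<dots>, a\<^sub>n]\<close>: the linear extension of
  \<open>g\<close> is constant on each coset, and \<^const>\<open>the_elem\<close> picks that value.\<close>

definition tensor_lift ::
  "'k ring \<Rightarrow> ('k, 'm) module \<Rightarrow> ('a list \<Rightarrow> 'm) \<Rightarrow> ('a list \<Rightarrow> 'k) set \<Rightarrow> 'm" where
  "tensor_lift K M g X = the_elem ((\<lambda>u. \<Oplus>\<^bsub>M\<^esub>w\<in>supp K u. u w \<odot>\<^bsub>M\<^esub> g w) ` X)"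

definition Sha_P :: "'k ring \<Rightarrow> 'k \<Rightarrow> ('k, 'a) module \<Rightarrow>
    ('a list \<Rightarrow> 'k) set \<Rightarrow> ('a list \<Rightarrow> 'k) set" where
  "Sha_P K l A = tensor_lift K (Sha K l A) (\<lambda>w. tensor K l A (\<one>\<^bsub>A\<^esub> # w))"

definition Sha_map :: "'k ring \<Rightarrow> 'k \<Rightarrow> ('k, 'b) module \<Rightarrow> ('a \<Rightarrow> 'b) \<Rightarrow>
    ('a list \<Rightarrow> 'k) set \<Rightarrow> ('b list \<Rightarrow> 'k) set" where
  "Sha_map K l B h = tensor_lift K (Sha K l B) (\<lambda>w. tensor K l B (map h w))"

definition Sha_eta :: "'k ring \<Rightarrow> 'k \<Rightarrow> ('k, 'a) module \<Rightarrow> 'a \<Rightarrow> ('a list \<Rightarrow> 'k) set" where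
  "Sha_eta K l A a = tensor K l A [a]"

text \<open>\<open>mu_word [w\<^sub>0, \<dots>, w\<^sub>k] = w\<^sub>0 P(w\<^sub>1 P(\<dots> P(w\<^sub>k) \<dots>))\<close>; the value on \<open>[]\<close> is irrelevant.\<close>

fun mu_word :: "'k ring \<Rightarrow> 'k \<Rightarrow> ('k, 'a) module \<Rightarrow>
    ('a list \<Rightarrow> 'k) set list \<Rightarrow> ('a list \<Rightarrow> 'k) set" where
  "mu_word K l A [] = \<zero>\<^bsub>Sha K l A\<^esub>"
| "mu_word K l A [w] = w"
| "mu_word K l A (w # w' # ws) = w \<otimes>\<^bsub>Sha K l A\<^esub> Sha_P K l A (mu_word K l A (w' # ws))"

definition Sha_mu :: "'k ring \<Rightarrow> 'k \<Rightarrow> ('k, 'a) module \<Rightarrow>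
    (('a list \<Rightarrow> 'k) set list \<Rightarrow> 'k) set \<Rightarrow> ('a list \<Rightarrow> 'k) set" where
  "Sha_mu K l A = tensor_lift K (Sha K l A) (mu_word K l A)"

text \<open>The algebra of sequences in \<open>A\<close> with the \<open>l\<close>-Hurwitz product.\<close>

definition Hur :: "'k ring \<Rightarrow> 'k \<Rightarrow> ('k, 'a) module \<Rightarrow> ('k, nat \<Rightarrow> 'a) module" where
  "Hur K l A =
    \<lparr>carrier = UNIV \<rightarrow> carrier A,
     mult = (\<lambda>f g n. \<Oplus>\<^bsub>A\<^esub>k\<in>{0..n}. \<Oplus>\<^bsub>A\<^esub>j\<in>{0..n - k}.
       [((n choose k) * ((n - k) choose j))] \<cdot>\<^bsub>A\<^esub>
         ((l [^]\<^bsub>K\<^esub> k) \<odot>\<^bsub>A\<^esub> (f (n - j) \<otimes>\<^bsub>A\<^esub> g (k + j)))),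
     one = (\<lambda>n. if n = 0 then \<one>\<^bsub>A\<^esub> else \<zero>\<^bsub>A\<^esub>),
     zero = (\<lambda>n. \<zero>\<^bsub>A\<^esub>),
     add = (\<lambda>f g n. f n \<oplus>\<^bsub>A\<^esub> g n),
     smult = (\<lambda>c f n. c \<odot>\<^bsub>A\<^esub> f n)\<rparr>"

definition Hur_map :: "('a \<Rightarrow> 'b) \<Rightarrow> (nat \<Rightarrow> 'a) \<Rightarrow> (nat \<Rightarrow> 'b)" where
  "Hur_map h f = (\<lambda>n. h (f n))"

definition Hur_eps :: "(nat \<Rightarrow> 'a) \<Rightarrow> 'a" where
  "Hur_eps f = f 0"

definition Hur_delta :: "(nat \<Rightarrow> 'a) \<Rightarrow> (nat \<Rightarrow> nat \<Rightarrow> 'a)" where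
  "Hur_delta f = (\<lambda>m n. f (m + n))"

definition tilde :: "('a \<Rightarrow> 'a) \<Rightarrow> (nat \<Rightarrow> 'a) \<Rightarrow> (nat \<Rightarrow> 'a)" where
  "tilde P f = (\<lambda>n. if n = 0 then P (f 0) else f (n - 1))"

text \<open>The unique Rota-Baxter homomorphism extending \<open>Hur_map (Sha_eta K l A)\<close>. Uniqueness as a
  total function needs a fixed value outside the carrier, hence \<^const>\<open>extensional\<close>.\<close>

definition beta :: "'k ring \<Rightarrow> 'k \<Rightarrow> ('k, 'a) module \<Rightarrow>
    ((nat \<Rightarrow> 'a) list \<Rightarrow> 'k) set \<Rightarrow> (nat \<Rightarrow> ('a list \<Rightarrow> 'k) set)" where
  "beta K l A = (THE b.
     b \<in> rb_hom K l (Sha K l (Hur K l A)) (Sha_P K l (Hur K l A))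
                    (Hur K l (Sha K l A)) (tilde (Sha_P K l A)) \<and>
     b \<in> extensional (carrier (Sha K l (Hur K l A))) \<and>
     (\<forall>f\<in>carrier (Hur K l A). b (Sha_eta K l (Hur K l A) f) = Hur_map (Sha_eta K l A) f))"

end

theory Submission
  imports Defs
begin

text \<open>
  The unit law is the defining property of \<open>\<beta>\<close>. Every other law is an equation between two maps out
  of a free Rota-Baxter algebra \<open>Sha(B)\<close>, and both maps are composites of Rota-Baxter homomorphisms.
  Two such homomorphisms are equal as soon as they agree on the generators \<open>\<eta>(b)\<close>, \<open>b \<in> B\<close>, and on
  generators each law is an evaluation of the definitions. The required homomorphism properties are
  that \<open>Sha(h)\<close> and \<open>\<mu>\<close> respect the canonical operators, that \<open>\<epsilon> \<circ> tilde P = P \<circ> \<epsilon>\<close> and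
  \<open>\<delta> \<circ> tilde P = tilde (tilde P) \<circ> \<delta>\<close>, and that applying a Rota-Baxter homomorphism to each term
  of a sequence is again one.

  What carries the proof is therefore the universal property (\<open>rb_lift_hom\<close>, \<open>rb_lift_eta\<close>,
  \<open>rb_hom_Sha_eqI\<close>), which first requires \<open>Sha(A)\<close> to be an algebra at all. Its product is studied
  before tensors are formed. Of the structure of \<open>A\<close>, the rule defining \<open>\<diamond>\<close> uses only the
  multiplicative monoid, so the free module \<open>F\<close> on words is itself a commutative associative algebra, namely
  the shuffle algebra of the monoid algebra of \<open>A\<close>. Writing a word of length at least two as
  \<open>a P(u)\<close>, where \<open>P\<close> prefixes the letter \<open>1\<close>, the recursion reads
  \<open>a P(u) \<diamond> b P(v) = ab P(u P(v) + P(u) v + l u v)\<close>; associativity follows by induction on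
  the total length, because both ways of bracketing three words unfold to the same seven shorter
  triple products. The product is multilinear modulo the tensor relations, so the
  submodule they generate is an ideal and \<open>Sha(A)\<close> is a quotient algebra of \<open>F\<close> (\<open>tensor_null_ideal\<close>, \<open>algebra_Sha\<close>). The
  homomorphism induced by \<open>f\<close> sends \<open>a\<^sub>0 \<otimes> \<dots> \<otimes> a\<^sub>n\<close> to \<open>f(a\<^sub>0) P(f(a\<^sub>1) P(\<dots> f(a\<^sub>n)))\<close>.

  The Hurwitz product is treated dually. With \<open>d\<close> the shift of sequences, it is determined by
  \<open>(f g)(0) = f(0) g(0)\<close> and \<open>d(f g) = d(f) g + f d(g) + l d(f) d(g)\<close> (\<open>Hur_mult_Suc\<close>). All
  algebra laws for sequences, the Rota-Baxter identity for \<open>tilde P\<close>, and the multiplicativity of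
  \<open>\<delta>\<close> and of sequencewise maps follow from these two equations by comparing values at \<open>0\<close>
  and shifts, mostly by induction on the index; the binomial formula is used only to establish them.
\<close>

section \<open>Linear maps and the free module on words\<close>

definition linear_map :: "'k ring \<Rightarrow> ('k, 'a) module \<Rightarrow> ('k, 'b) module \<Rightarrow> ('a \<Rightarrow> 'b) \<Rightarrow> bool" where
  "linear_map K M N f \<longleftrightarrow> f \<in> carrier M \<rightarrow> carrier N \<and>
     (\<forall>x\<in>carrier M. \<forall>y\<in>carrier M. f (x \<oplus>\<^bsub>M\<^esub> y) = f x \<oplus>\<^bsub>N\<^esub> f y) \<and>
     (\<forall>c\<in>carrier K. \<forall>x\<in>carrier M. f (c \<odot>\<^bsub>M\<^esub> x) = c \<odot>\<^bsub>N\<^esub> f x)"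

lemma linear_mapI:
  assumes "\<And>x. x \<in> carrier M \<Longrightarrow> f x \<in> carrier N"
    and "\<And>x y. x \<in> carrier M \<Longrightarrow> y \<in> carrier M \<Longrightarrow> f (x \<oplus>\<^bsub>M\<^esub> y) = f x \<oplus>\<^bsub>N\<^esub> f y"
    and "\<And>c x. c \<in> carrier K \<Longrightarrow> x \<in> carrier M \<Longrightarrow> f (c \<odot>\<^bsub>M\<^esub> x) = c \<odot>\<^bsub>N\<^esub> f x"
  shows "linear_map K M N f"
  using assms by (auto simp: linear_map_def)

lemma linear_mapD:
  assumes "linear_map K M N f"
  shows "x \<in> carrier M \<Longrightarrow> f x \<in> carrier N"
    and "x \<in> carrier M \<Longrightarrow> y \<in> carrier M \<Longrightarrow> f (x \<oplus>\<^bsub>M\<^esub> y) = f x \<oplus>\<^bsub>N\<^esub> f y"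
    and "c \<in> carrier K \<Longrightarrow> x \<in> carrier M \<Longrightarrow> f (c \<odot>\<^bsub>M\<^esub> x) = c \<odot>\<^bsub>N\<^esub> f x"
  using assms by (auto simp: linear_map_def)

lemma linear_map_comp:
  assumes "linear_map K M N f" "linear_map K N Q g"
  shows "linear_map K M Q (\<lambda>x. g (f x))"
  using assms by (auto simp: linear_map_def Pi_iff)

lemma linear_map_add:
  assumes "module K N" "linear_map K M N f" "linear_map K M N g"
  shows "linear_map K M N (\<lambda>x. f x \<oplus>\<^bsub>N\<^esub> g x)"
proof -
  interpret N: module K N by fact
  show ?thesis
    using assms(2,3) by (auto simp: linear_map_def Pi_iff N.M.a_ac N.smult_r_distr)
qed

lemma linear_map_smult:
  assumes "module K N" "linear_map K M N f" "c \<in> carrier K"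
  shows "linear_map K M N (\<lambda>x. c \<odot>\<^bsub>N\<^esub> f x)"
proof -
  interpret N: module K N by fact
  show ?thesis
    using assms(2,3)
    by (auto simp: linear_map_def Pi_iff N.smult_r_distr N.smult_assoc1[symmetric] N.R.m_comm)
qed

lemma linear_map_id: "linear_map K M M (\<lambda>x. x)"
  by (auto simp: linear_map_def)

lemma linear_map_mult_left:
  assumes "algebra K R" "a \<in> carrier R" "linear_map K M R f"
  shows "linear_map K M R (\<lambda>x. a \<otimes>\<^bsub>R\<^esub> f x)"
proof -
  interpret R: algebra K R by fact
  show ?thesis
  proof (rule linear_mapI)
    fix c x assume h: "c \<in> carrier K" "x \<in> carrier M"
    have fx: "f x \<in> carrier R" using linear_mapD(1)[OF assms(3) h(2)] .
    have "a \<otimes>\<^bsub>R\<^esub> (c \<odot>\<^bsub>R\<^esub> f x) = (c \<odot>\<^bsub>R\<^esub> f x) \<otimes>\<^bsub>R\<^esub> a"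
      using h fx assms(2) by (intro R.m_comm) auto
    also have "\<dots> = c \<odot>\<^bsub>R\<^esub> (f x \<otimes>\<^bsub>R\<^esub> a)" using h fx assms(2) by (intro R.smult_assoc2) auto
    also have "\<dots> = c \<odot>\<^bsub>R\<^esub> (a \<otimes>\<^bsub>R\<^esub> f x)" using R.m_comm[OF fx assms(2)] by simp
    finally show "a \<otimes>\<^bsub>R\<^esub> f (c \<odot>\<^bsub>M\<^esub> x) = c \<odot>\<^bsub>R\<^esub> (a \<otimes>\<^bsub>R\<^esub> f x)"
      using linear_mapD(3)[OF assms(3) h] by simp
  qed (use assms(2) linear_mapD[OF assms(3)] in \<open>auto simp: R.r_distr\<close>)
qed

lemma linear_map_zero:
  assumes "module K M" "module K N" "linear_map K M N f"
  shows "f \<zero>\<^bsub>M\<^esub> = \<zero>\<^bsub>N\<^esub>"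
proof -
  interpret M: module K M by fact
  interpret N: module K N by fact
  have "f (\<zero>\<^bsub>K\<^esub> \<odot>\<^bsub>M\<^esub> \<zero>\<^bsub>M\<^esub>) = \<zero>\<^bsub>K\<^esub> \<odot>\<^bsub>N\<^esub> f \<zero>\<^bsub>M\<^esub>"
    by (rule linear_mapD(3)[OF assms(3)]) auto
  then show ?thesis using linear_mapD(1)[OF assms(3), of "\<zero>\<^bsub>M\<^esub>"] by simp
qed

lemma linear_map_a_inv:
  assumes "module K M" "module K N" "linear_map K M N f" "x \<in> carrier M"
  shows "f (\<ominus>\<^bsub>M\<^esub> x) = \<ominus>\<^bsub>N\<^esub> f x"
proof -
  interpret M: module K M by fact
  interpret N: module K N by fact
  have "f ((\<ominus>\<^bsub>K\<^esub> \<one>\<^bsub>K\<^esub>) \<odot>\<^bsub>M\<^esub> x) = (\<ominus>\<^bsub>K\<^esub> \<one>\<^bsub>K\<^esub>) \<odot>\<^bsub>N\<^esub> f x"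
    by (rule linear_mapD(3)[OF assms(3)]) (use assms(4) in auto)
  then show ?thesis
    using linear_mapD(1)[OF assms(3,4)] assms(4)
    by (simp add: M.smult_l_minus N.smult_l_minus)
qed

lemma linear_map_minus:
  assumes "module K M" "module K N" "linear_map K M N f" "x \<in> carrier M" "y \<in> carrier M"
  shows "f (x \<ominus>\<^bsub>M\<^esub> y) = f x \<ominus>\<^bsub>N\<^esub> f y"
proof -
  interpret M: module K M by fact
  interpret N: module K N by fact
  show ?thesis
    using linear_map_a_inv[OF assms(1-3,5)] linear_mapD[OF assms(3)] assms(4,5)
    by (simp add: a_minus_def)
qed

lemma linear_map_finsum:
  assumes "module K M" "module K N" "linear_map K M N f" "finite S" "h \<in> S \<rightarrow> carrier M"
  shows "f (\<Oplus>\<^bsub>M\<^esub>x\<in>S. h x) = (\<Oplus>\<^bsub>N\<^esub>x\<in>S. f (h x))"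
proof -
  interpret M: module K M by fact
  interpret N: module K N by fact
  note f = linear_mapD[OF assms(3)]
  show ?thesis
    using assms(4,5)
  proof (induction S)
    case empty
    then show ?case by (simp add: linear_map_zero[OF assms(1-3)])
  next
    case (insert x S)
    then have "h x \<in> carrier M" "h \<in> S \<rightarrow> carrier M" by auto
    moreover from this have "(\<lambda>x. f (h x)) \<in> S \<rightarrow> carrier N" using f(1) by auto
    ultimately show ?case using insert f by simp
  qed
qed

lemma linear_map_preimage_submodule:
  assumes "module K M" "module K N" "linear_map K M N f" "submodule S K N"
  shows "submodule {x \<in> carrier M. f x \<in> S} K M"
proof -
  interpret M: module K M by fact
  interpret N: module K N by fact
  note S = N.submoduleE[OF assms(4)]
  have "\<zero>\<^bsub>N\<^esub> \<in> S"
    using S(1-3,5)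
    by (metis N.M.r_neg ex_in_conv subsetD)
  then show ?thesis
    by (intro M.submoduleI)
       (auto simp: linear_map_zero[OF assms(1-3)] linear_map_a_inv[OF assms(1-3)]
          linear_mapD[OF assms(3)] S)
qed

text \<open>The map on the free module of words with prescribed values on words. It is the inner function of
  \<^const>\<open>tensor_lift\<close>, so that maps out of \<open>Sha\<close> can be computed on representatives.\<close>

definition linear_extension ::
  "'k ring \<Rightarrow> ('k, 'm) module \<Rightarrow> ('a list \<Rightarrow> 'm) \<Rightarrow> ('a list \<Rightarrow> 'k) \<Rightarrow> 'm" where
  "linear_extension K M g u = (\<Oplus>\<^bsub>M\<^esub>w\<in>supp K u. u w \<odot>\<^bsub>M\<^esub> g w)"

locale weighted_algebra =
  fixes K :: "'k ring" and A :: "('k, 'a) module" and l :: 'k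
  assumes algebra_A: "algebra K A" and weight_closed: "l \<in> carrier K"
begin

sublocale A: algebra K A by (rule algebra_A)

abbreviation F where "F \<equiv> free_words K l A"

lemma F_carrier_iff:
  "u \<in> carrier F \<longleftrightarrow> (\<forall>w. u w \<in> carrier K) \<and> finite (supp K u) \<and> supp K u \<subseteq> words A"
  by (simp add: free_words_def)

lemma F_value [simp, intro]: "u \<in> carrier F \<Longrightarrow> u w \<in> carrier K"
  by (simp add: F_carrier_iff)

lemma F_supp: "u \<in> carrier F \<Longrightarrow> finite (supp K u)" "u \<in> carrier F \<Longrightarrow> supp K u \<subseteq> words A"
  by (simp_all add: F_carrier_iff)

lemma F_carrierI:
  assumes "\<And>w. u w \<in> carrier K" "finite S" "S \<subseteq> words A" "\<And>w. w \<notin> S \<Longrightarrow> u w = \<zero>\<^bsub>K\<^esub>"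
  shows "u \<in> carrier F"
proof -
  have "supp K u \<subseteq> S" using assms(4) by (auto simp: supp_def)
  then show ?thesis using assms(1-3) by (auto simp: F_carrier_iff intro: finite_subset)
qed

lemma F_eq_zero: "u \<in> carrier F \<Longrightarrow> w \<notin> supp K u \<Longrightarrow> u w = \<zero>\<^bsub>K\<^esub>"
  by (simp add: supp_def)

lemma F_record_simps:
  "\<zero>\<^bsub>F\<^esub> = (\<lambda>w. \<zero>\<^bsub>K\<^esub>)" "\<one>\<^bsub>F\<^esub> = word K [\<one>\<^bsub>A\<^esub>]"
  "u \<oplus>\<^bsub>F\<^esub> v = (\<lambda>w. u w \<oplus>\<^bsub>K\<^esub> v w)" "c \<odot>\<^bsub>F\<^esub> u = (\<lambda>w. c \<otimes>\<^bsub>K\<^esub> u w)"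
  by (simp_all only: free_words_def ring_record_simps module.simps)

lemma F_zero_closed: "\<zero>\<^bsub>F\<^esub> \<in> carrier F"
  by (auto simp: F_record_simps F_carrier_iff supp_def)

lemma F_add_closed: "u \<in> carrier F \<Longrightarrow> v \<in> carrier F \<Longrightarrow> u \<oplus>\<^bsub>F\<^esub> v \<in> carrier F"
  by (rule F_carrierI[of _ "supp K u \<union> supp K v"]) (auto simp: F_record_simps F_supp F_eq_zero
     dest: subsetD[OF F_supp(2)])

lemma F_smult_closed: "c \<in> carrier K \<Longrightarrow> u \<in> carrier F \<Longrightarrow> c \<odot>\<^bsub>F\<^esub> u \<in> carrier F"
  by (rule F_carrierI[of _ "supp K u"]) (auto simp: F_record_simps F_supp F_eq_zero
     dest: subsetD[OF F_supp(2)])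

lemma module_F: "module K F"
proof (rule moduleI)
  show "cring K" by (rule A.R_cring)
  show "abelian_group F"
  proof (rule abelian_groupI)
    fix u assume u: "u \<in> carrier F"
    show "\<exists>v\<in>carrier F. v \<oplus>\<^bsub>F\<^esub> u = \<zero>\<^bsub>F\<^esub>"
    proof (rule bexI)
      show "((\<ominus>\<^bsub>K\<^esub> \<one>\<^bsub>K\<^esub>) \<odot>\<^bsub>F\<^esub> u) \<oplus>\<^bsub>F\<^esub> u = \<zero>\<^bsub>F\<^esub>"
        using u by (auto simp: F_record_simps fun_eq_iff A.R.l_minus A.R.l_neg)
      show "(\<ominus>\<^bsub>K\<^esub> \<one>\<^bsub>K\<^esub>) \<odot>\<^bsub>F\<^esub> u \<in> carrier F" using u by (simp add: F_smult_closed)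
    qed
  qed (auto simp: F_zero_closed F_add_closed, auto simp: F_record_simps fun_eq_iff A.R.a_ac)
qed (auto simp: F_smult_closed, auto simp: F_record_simps fun_eq_iff A.R.l_distr A.R.r_distr A.R.m_assoc)

sublocale F: module K F by (rule module_F)

lemma words_Cons: "a # w \<in> words A \<longleftrightarrow> a \<in> carrier A \<and> (w = [] \<or> w \<in> words A)"
  by (auto simp: words_def)

lemma word_closed: "w \<in> words A \<Longrightarrow> word K w \<in> carrier F"
  by (rule F_carrierI[of _ "{w}"]) (auto simp: word_def)

lemma finsum_F_apply:
  assumes "finite S" "h \<in> S \<rightarrow> carrier F"
  shows "(\<Oplus>\<^bsub>F\<^esub>x\<in>S. h x) w = (\<Oplus>\<^bsub>K\<^esub>x\<in>S. h x w)"
  using assms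
proof (induction S)
  case empty
  then show ?case by (simp add: F_record_simps)
next
  case (insert x S)
  then have h: "h x \<in> carrier F" "h \<in> S \<rightarrow> carrier F" by auto
  then have "(\<lambda>x. h x w) \<in> S \<rightarrow> carrier K" by auto
  then show ?case using insert h by (simp add: F_record_simps)
qed

text \<open>Sums of functions have different supports; comparing linear extensions needs a common finite
  index set.\<close>

lemma linear_extension_superset:
  assumes "module K M" "u \<in> carrier F" "g \<in> words A \<rightarrow> carrier M"
    "finite S" "supp K u \<subseteq> S" "S \<subseteq> words A"
  shows "linear_extension K M g u = (\<Oplus>\<^bsub>M\<^esub>w\<in>S. u w \<odot>\<^bsub>M\<^esub> g w)"
proof -
  interpret M: module K M by fact
  show ?thesis
    unfolding linear_extension_def
  proof (rule M.M.add.finprod_mono_neutral_cong_left)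
    show "finite S" "supp K u \<subseteq> S" by fact+
    show "\<And>w. w \<in> S - supp K u \<Longrightarrow> u w \<odot>\<^bsub>M\<^esub> g w = \<zero>\<^bsub>M\<^esub>"
      using assms(2,3,6) by (metis DiffE F_eq_zero M.smult_l_null Pi_mem subsetD)
    show "(\<lambda>w. u w \<odot>\<^bsub>M\<^esub> g w) \<in> S \<rightarrow> carrier M" using assms(2,3,6) by auto
  qed simp
qed

lemma linear_extension_linear:
  assumes "module K M" "g \<in> words A \<rightarrow> carrier M"
  shows "linear_map K F M (linear_extension K M g)"
proof -
  interpret M: module K M by fact
  show ?thesis
  proof (rule linear_mapI)
    fix u assume u: "u \<in> carrier F"
    show "linear_extension K M g u \<in> carrier M"
      unfolding linear_extension_def using u assms(2) F_supp(2)[OF u]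
      by (intro M.M.finsum_closed) auto
    fix v assume v: "v \<in> carrier F"
    let ?S = "supp K u \<union> supp K v"
    have S: "finite ?S" "?S \<subseteq> words A" using F_supp u v by auto
    have g: "g w \<in> carrier M" if "w \<in> ?S" for w using that assms(2) S(2) by auto
    have "supp K (u \<oplus>\<^bsub>F\<^esub> v) \<subseteq> ?S" by (auto simp: supp_def F_record_simps)
    then have "linear_extension K M g (u \<oplus>\<^bsub>F\<^esub> v) = (\<Oplus>\<^bsub>M\<^esub>w\<in>?S. (u \<oplus>\<^bsub>F\<^esub> v) w \<odot>\<^bsub>M\<^esub> g w)"
      using S u v assms by (intro linear_extension_superset) auto
    also have "\<dots> = (\<Oplus>\<^bsub>M\<^esub>w\<in>?S. u w \<odot>\<^bsub>M\<^esub> g w \<oplus>\<^bsub>M\<^esub> v w \<odot>\<^bsub>M\<^esub> g w)"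
      by (rule M.M.finsum_cong') (use g u v in \<open>auto simp: F_record_simps M.smult_l_distr\<close>)
    also have "\<dots> = (\<Oplus>\<^bsub>M\<^esub>w\<in>?S. u w \<odot>\<^bsub>M\<^esub> g w) \<oplus>\<^bsub>M\<^esub> (\<Oplus>\<^bsub>M\<^esub>w\<in>?S. v w \<odot>\<^bsub>M\<^esub> g w)"
      by (rule M.M.finsum_addf) (use S g u v in auto)
    also have "\<dots> = linear_extension K M g u \<oplus>\<^bsub>M\<^esub> linear_extension K M g v"
      using S u v assms by (simp add: linear_extension_superset[where S = ?S])
    finally show "linear_extension K M g (u \<oplus>\<^bsub>F\<^esub> v)
      = linear_extension K M g u \<oplus>\<^bsub>M\<^esub> linear_extension K M g v" .
  next
    fix c u assume c: "c \<in> carrier K" and u: "u \<in> carrier F"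
    have g: "g w \<in> carrier M" if "w \<in> supp K u" for w using that assms(2) F_supp(2)[OF u] by auto
    have "supp K (c \<odot>\<^bsub>F\<^esub> u) \<subseteq> supp K u" using c by (auto simp: supp_def F_record_simps)
    then have "linear_extension K M g (c \<odot>\<^bsub>F\<^esub> u) = (\<Oplus>\<^bsub>M\<^esub>w\<in>supp K u. (c \<odot>\<^bsub>F\<^esub> u) w \<odot>\<^bsub>M\<^esub> g w)"
      using F_supp u c assms by (intro linear_extension_superset) auto
    also have "\<dots> = (\<Oplus>\<^bsub>M\<^esub>w\<in>supp K u. c \<odot>\<^bsub>M\<^esub> (u w \<odot>\<^bsub>M\<^esub> g w))"
      by (rule M.M.finsum_cong') (use g u c in \<open>auto simp: F_record_simps M.smult_assoc1\<close>)
    also have "\<dots> = c \<odot>\<^bsub>M\<^esub> linear_extension K M g u"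
      unfolding linear_extension_def
      by (rule M.finsum_smult_ldistr[symmetric]) (use g u c F_supp in auto)
    finally show "linear_extension K M g (c \<odot>\<^bsub>F\<^esub> u) = c \<odot>\<^bsub>M\<^esub> linear_extension K M g u" .
  qed
qed

lemma linear_extension_word:
  assumes "module K M" "g \<in> words A \<rightarrow> carrier M" "w \<in> words A"
  shows "linear_extension K M g (word K w) = g w"
proof -
  interpret M: module K M by fact
  have "supp K (word K w) \<subseteq> {w}" by (auto simp: supp_def word_def)
  then have "linear_extension K M g (word K w) = (\<Oplus>\<^bsub>M\<^esub>v\<in>{w}. word K w v \<odot>\<^bsub>M\<^esub> g v)"
    using assms by (intro linear_extension_superset word_closed) auto
  also have "\<dots> = g w" using assms(2,3) by (simp add: word_def Pi_iff)
  finally show ?thesis .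
qed

lemma F_expansion:
  assumes "u \<in> carrier F"
  shows "linear_extension K F (word K) u = u"
proof
  fix v
  have "linear_extension K F (word K) u v = (\<Oplus>\<^bsub>K\<^esub>w\<in>supp K u. (u w \<odot>\<^bsub>F\<^esub> word K w) v)"
    unfolding linear_extension_def
    by (rule finsum_F_apply) (use assms F_supp[OF assms] in \<open>auto intro!: F_smult_closed word_closed\<close>)
  also have "\<dots> = (\<Oplus>\<^bsub>K\<^esub>w\<in>supp K u. if v = w then u w else \<zero>\<^bsub>K\<^esub>)"
    by (rule A.R.finsum_cong') (use assms in \<open>auto simp: F_record_simps word_def\<close>)
  also have "\<dots> = u v"
  proof (cases "v \<in> supp K u")
    case True
    then show ?thesis using F_supp(1)[OF assms] assms by (intro A.R.finsum_singleton) auto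
  next
    case False
    then have "(\<Oplus>\<^bsub>K\<^esub>w\<in>supp K u. if v = w then u w else \<zero>\<^bsub>K\<^esub>) = (\<Oplus>\<^bsub>K\<^esub>w\<in>supp K u. \<zero>\<^bsub>K\<^esub>)"
      by (intro A.R.finsum_cong') auto
    then show ?thesis using False assms by (simp add: F_eq_zero)
  qed
  finally show "linear_extension K F (word K) u v = u v" .
qed

lemma linear_map_F_apply:
  assumes "module K M" "linear_map K F M f" "u \<in> carrier F"
  shows "f u = linear_extension K M (\<lambda>w. f (word K w)) u"
proof -
  interpret M: module K M by fact
  have c: "word K w \<in> carrier F" if "w \<in> supp K u" for w
    using that F_supp(2)[OF assms(3)] by (auto intro: word_closed)
  have "f u = f (\<Oplus>\<^bsub>F\<^esub>w\<in>supp K u. u w \<odot>\<^bsub>F\<^esub> word K w)"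
    using F_expansion[OF assms(3)] by (simp add: linear_extension_def)
  also have "\<dots> = (\<Oplus>\<^bsub>M\<^esub>w\<in>supp K u. f (u w \<odot>\<^bsub>F\<^esub> word K w))"
    by (rule linear_map_finsum[OF module_F assms(1,2)])
       (use c assms F_supp in \<open>auto intro!: F_smult_closed\<close>)
  also have "\<dots> = (\<Oplus>\<^bsub>M\<^esub>w\<in>supp K u. u w \<odot>\<^bsub>M\<^esub> f (word K w))"
    by (rule M.M.finsum_cong') (use c assms in \<open>auto simp: linear_mapD[OF assms(2)]\<close>)
  finally show ?thesis by (simp add: linear_extension_def)
qed

lemma linear_extension_cong:
  assumes "module K M" "u \<in> carrier F" "h \<in> words A \<rightarrow> carrier M" "\<And>w. w \<in> words A \<Longrightarrow> g w = h w"
  shows "linear_extension K M g u = linear_extension K M h u"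
proof -
  interpret M: module K M by fact
  show ?thesis unfolding linear_extension_def
    by (rule M.M.finsum_cong') (use assms F_supp(2)[OF assms(2)] in auto)
qed

text \<open>The principle behind all later identities in \<open>F\<close>: it suffices to check them on words.\<close>

lemma linear_map_F_eqI:
  assumes "module K M" "linear_map K F M f" "linear_map K F M g"
    "\<And>w. w \<in> words A \<Longrightarrow> f (word K w) = g (word K w)" "u \<in> carrier F"
  shows "f u = g u"
proof -
  have "(\<lambda>w. g (word K w)) \<in> words A \<rightarrow> carrier M"
    using linear_mapD(1)[OF assms(3)] word_closed by auto
  then show ?thesis
    using linear_map_F_apply[OF assms(1,2,5)] linear_map_F_apply[OF assms(1,3,5)]
      linear_extension_cong[OF assms(1,5) _ assms(4)] by simp
qed

end

section \<open>The product of words is commutative and associative\<close>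

context weighted_algebra
begin

lemma prefix_letter_closed:
  assumes "a \<in> carrier A" "u \<in> carrier F"
  shows "prefix_letter K a u \<in> carrier F"
proof (rule F_carrierI[of _ "(#) a ` supp K u"])
  show "finite ((#) a ` supp K u)" using F_supp(1)[OF assms(2)] by simp
  show "(#) a ` supp K u \<subseteq> words A" using F_supp(2)[OF assms(2)] assms(1) by (auto simp: words_Cons)
  fix w
  show "prefix_letter K a u w \<in> carrier K" using assms by (simp add: prefix_letter_def)
  assume "w \<notin> (#) a ` supp K u"
  then show "prefix_letter K a u w = \<zero>\<^bsub>K\<^esub>"
    by (cases w) (auto simp: prefix_letter_def supp_def image_def)
qed

lemma prefix_letter_linear:
  assumes "a \<in> carrier A"
  shows "linear_map K F F (prefix_letter K a)"
proof (rule linear_mapI)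
  fix u assume u: "u \<in> carrier F"
  show "prefix_letter K a u \<in> carrier F" using assms u by (rule prefix_letter_closed)
  show "prefix_letter K a (u \<oplus>\<^bsub>F\<^esub> v) = prefix_letter K a u \<oplus>\<^bsub>F\<^esub> prefix_letter K a v" for v
    by (auto simp: F_record_simps prefix_letter_def fun_eq_iff)
  show "prefix_letter K a (c \<odot>\<^bsub>F\<^esub> u) = c \<odot>\<^bsub>F\<^esub> prefix_letter K a u" if "c \<in> carrier K" for c
    using that by (auto simp: F_record_simps prefix_letter_def fun_eq_iff)
qed

lemma prefix_letter_word: "prefix_letter K a (word K w) = word K (a # w)"
  by (auto simp: fun_eq_iff prefix_letter_def word_def)

lemma words_cases:
  assumes "w \<in> words A"
  obtains a where "w = [a]" "a \<in> carrier A"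
  | a v where "w = a # v" "a \<in> carrier A" "v \<in> words A"
  using assms by (cases w) (auto simp: words_def)

text \<open>The defining recursion, freed from the requirement that the tails be given with an explicit
  first letter.\<close>

lemma diamond_Cons_Cons:
  assumes "x \<in> words A" "y \<in> words A"
  shows "diamond K l A (a # x) (b # y) = prefix_letter K (a \<otimes>\<^bsub>A\<^esub> b)
     (diamond K l A x (\<one>\<^bsub>A\<^esub> # y) \<oplus>\<^bsub>F\<^esub> diamond K l A (\<one>\<^bsub>A\<^esub> # x) y \<oplus>\<^bsub>F\<^esub> l \<odot>\<^bsub>F\<^esub> diamond K l A x y)"
  using assms by (cases x; cases y) (auto simp: words_def F_record_simps)

lemma diamond_closed:
  "x \<in> words A \<Longrightarrow> y \<in> words A \<Longrightarrow> diamond K l A x y \<in> carrier F"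
proof (induction "length x + length y" arbitrary: x y rule: less_induct)
  case less
  from less.prems(1) show ?case
  proof (cases rule: words_cases)
    case (1 a)
    then show ?thesis using less.prems(2) by (cases y) (auto simp: words_def intro!: word_closed)
  next
    case x: (2 a x')
    from less.prems(2) show ?thesis
    proof (cases rule: words_cases)
      case (1 b)
      then show ?thesis using x by (cases x') (auto simp: words_def intro!: word_closed)
    next
      case y: (2 b y')
      have 1: "\<one>\<^bsub>A\<^esub> # x' \<in> words A" "\<one>\<^bsub>A\<^esub> # y' \<in> words A" using x y by (auto simp: words_Cons)
      have "diamond K l A x' (\<one>\<^bsub>A\<^esub> # y') \<in> carrier F"
        "diamond K l A (\<one>\<^bsub>A\<^esub> # x') y' \<in> carrier F" "diamond K l A x' y' \<in> carrier F"
        by (rule less.hyps; use x y 1 in simp)+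
      then show ?thesis
        unfolding x(1) y(1) diamond_Cons_Cons[OF x(3) y(3)]
        using x y weight_closed by (intro prefix_letter_closed) auto
    qed
  qed
qed

text \<open>The product of \<open>F\<close> is defined by a double sum; as an iterated linear extension it is visibly
  bilinear.\<close>

lemma F_mult_eq:
  assumes "u \<in> carrier F" "v \<in> carrier F"
  shows "u \<otimes>\<^bsub>F\<^esub> v = linear_extension K F (\<lambda>x. linear_extension K F (diamond K l A x) v) u"
proof
  fix w
  have d: "diamond K l A x y \<in> carrier F" if "x \<in> supp K u" "y \<in> supp K v" for x y
    using that F_supp assms by (intro diamond_closed) auto
  have e: "linear_extension K F (diamond K l A x) v \<in> carrier F" if "x \<in> supp K u" for x
    by (rule linear_mapD(1)[OF linear_extension_linear])
       (use that assms F_supp in \<open>auto intro!: module_F diamond_closed\<close>)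
  have "linear_extension K F (diamond K l A x) v w
     = (\<Oplus>\<^bsub>K\<^esub>y\<in>supp K v. v y \<otimes>\<^bsub>K\<^esub> diamond K l A x y w)" if "x \<in> supp K u" for x
  proof -
    have "linear_extension K F (diamond K l A x) v w
      = (\<Oplus>\<^bsub>K\<^esub>y\<in>supp K v. (v y \<odot>\<^bsub>F\<^esub> diamond K l A x y) w)"
      unfolding linear_extension_def
      by (rule finsum_F_apply) (use assms d that F_supp in \<open>auto intro!: F_smult_closed\<close>)
    then show ?thesis by (simp only: F_record_simps)
  qed note inner = this
  have "linear_extension K F (\<lambda>x. linear_extension K F (diamond K l A x) v) u w
    = (\<Oplus>\<^bsub>K\<^esub>x\<in>supp K u. (u x \<odot>\<^bsub>F\<^esub> linear_extension K F (diamond K l A x) v) w)"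
    unfolding linear_extension_def[of K F _ u]
    by (rule finsum_F_apply) (use assms e F_supp in \<open>auto intro!: F_smult_closed\<close>)
  also have "\<dots> = (\<Oplus>\<^bsub>K\<^esub>x\<in>supp K u. \<Oplus>\<^bsub>K\<^esub>y\<in>supp K v. u x \<otimes>\<^bsub>K\<^esub> v y \<otimes>\<^bsub>K\<^esub> diamond K l A x y w)"
  proof (rule A.R.finsum_cong'[OF refl])
    fix x assume x: "x \<in> supp K u"
    have "(u x \<odot>\<^bsub>F\<^esub> linear_extension K F (diamond K l A x) v) w
      = u x \<otimes>\<^bsub>K\<^esub> (\<Oplus>\<^bsub>K\<^esub>y\<in>supp K v. v y \<otimes>\<^bsub>K\<^esub> diamond K l A x y w)"
      using inner[OF x] by (simp only: F_record_simps)
    also have "\<dots> = (\<Oplus>\<^bsub>K\<^esub>y\<in>supp K v. u x \<otimes>\<^bsub>K\<^esub> (v y \<otimes>\<^bsub>K\<^esub> diamond K l A x y w))"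
      by (rule A.R.finsum_rdistr) (use assms x d F_supp in auto)
    also have "\<dots> = (\<Oplus>\<^bsub>K\<^esub>y\<in>supp K v. u x \<otimes>\<^bsub>K\<^esub> v y \<otimes>\<^bsub>K\<^esub> diamond K l A x y w)"
      by (rule A.R.finsum_cong') (use assms x d in \<open>auto simp: A.R.m_assoc\<close>)
    finally show "(u x \<odot>\<^bsub>F\<^esub> linear_extension K F (diamond K l A x) v) w
      = (\<Oplus>\<^bsub>K\<^esub>y\<in>supp K v. u x \<otimes>\<^bsub>K\<^esub> v y \<otimes>\<^bsub>K\<^esub> diamond K l A x y w)" .
  qed (use assms d in \<open>auto intro!: A.R.finsum_closed\<close>)
  finally show "(u \<otimes>\<^bsub>F\<^esub> v) w
     = linear_extension K F (\<lambda>x. linear_extension K F (diamond K l A x) v) u w"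
    by (simp only: free_words_def ring_record_simps)
qed

lemma F_mult_linear_left:
  assumes "v \<in> carrier F"
  shows "linear_map K F F (\<lambda>u. u \<otimes>\<^bsub>F\<^esub> v)"
proof -
  have "linear_map K F F (linear_extension K F (\<lambda>x. linear_extension K F (diamond K l A x) v))"
    using assms by (auto intro!: linear_extension_linear module_F linear_mapD(1)[OF linear_extension_linear] diamond_closed)
  then show ?thesis
    using assms by (simp add: linear_map_def F_mult_eq Pi_iff)
qed

lemma F_mult_closed: "u \<in> carrier F \<Longrightarrow> v \<in> carrier F \<Longrightarrow> u \<otimes>\<^bsub>F\<^esub> v \<in> carrier F"
  using linear_mapD(1)[OF F_mult_linear_left] .

lemma F_mult_word_left:
  assumes "x \<in> words A" "v \<in> carrier F"
  shows "word K x \<otimes>\<^bsub>F\<^esub> v = linear_extension K F (diamond K l A x) v"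
proof -
  have "(\<lambda>x. linear_extension K F (diamond K l A x) v) \<in> words A \<rightarrow> carrier F"
    using assms by (auto intro!: module_F linear_mapD(1)[OF linear_extension_linear] diamond_closed)
  then show ?thesis
    using assms by (simp add: F_mult_eq word_closed linear_extension_word[OF module_F])
qed

lemma F_mult_word:
  assumes "x \<in> words A" "y \<in> words A"
  shows "word K x \<otimes>\<^bsub>F\<^esub> word K y = diamond K l A x y"
  using assms
  by (simp add: F_mult_word_left word_closed linear_extension_word[OF module_F] diamond_closed)

text \<open>For words \<open>u\<close> the left multiplication is a linear extension, hence linear. Since \<open>u \<diamond> v\<close> is
  linear in \<open>u\<close>, each identity expressing linearity in \<open>v\<close> spreads from words to all \<open>u\<close>.\<close>

lemma F_mult_linear_right:
  assumes "u \<in> carrier F"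
  shows "linear_map K F F (\<lambda>v. u \<otimes>\<^bsub>F\<^esub> v)"
proof (rule linear_mapI)
  have ext: "linear_map K F F (linear_extension K F (diamond K l A x))" if "x \<in> words A" for x
    using that by (auto intro!: linear_extension_linear module_F diamond_closed)
  fix v assume v: "v \<in> carrier F"
  show "u \<otimes>\<^bsub>F\<^esub> v \<in> carrier F" using assms v by (rule F_mult_closed)
  {
    fix w assume w: "w \<in> carrier F"
    show "u \<otimes>\<^bsub>F\<^esub> (v \<oplus>\<^bsub>F\<^esub> w) = (u \<otimes>\<^bsub>F\<^esub> v) \<oplus>\<^bsub>F\<^esub> (u \<otimes>\<^bsub>F\<^esub> w)"
      by (rule linear_map_F_eqI[OF module_F F_mult_linear_left linear_map_add[OF module_F F_mult_linear_left F_mult_linear_left] _ assms])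
         (use v w in \<open>simp_all add: F_mult_word_left linear_mapD[OF ext]\<close>)
  next
    fix c assume c: "c \<in> carrier K"
    show "u \<otimes>\<^bsub>F\<^esub> (c \<odot>\<^bsub>F\<^esub> v) = c \<odot>\<^bsub>F\<^esub> (u \<otimes>\<^bsub>F\<^esub> v)"
      by (rule linear_map_F_eqI[OF module_F F_mult_linear_left linear_map_smult[OF module_F F_mult_linear_left] _ assms])
         (use v c in \<open>simp_all add: F_mult_word_left linear_mapD[OF ext]\<close>)
  }
qed

text \<open>Exchanging the two factors in the recursion exchanges its first two summands, which gives
  commutativity of words by induction on the sum of the lengths.\<close>

lemma F_mult_comm:
  assumes "u \<in> carrier F" "v \<in> carrier F"
  shows "u \<otimes>\<^bsub>F\<^esub> v = v \<otimes>\<^bsub>F\<^esub> u"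
proof -
  have d: "diamond K l A x y = diamond K l A y x" if "x \<in> words A" "y \<in> words A" for x y
    using that
  proof (induction "length x + length y" arbitrary: x y rule: less_induct)
    case less
    from less.prems(1) show ?case
    proof (cases rule: words_cases)
      case x: (1 a)
      from less.prems(2) show ?thesis
      proof (cases rule: words_cases)
        case (1 b)
        then show ?thesis using x A.m_comm[of a b] by simp
      next
        case (2 b y')
        then show ?thesis using x A.m_comm[of a b] by (cases y') (auto simp: words_def)
      qed
    next
      case x: (2 a x')
      from less.prems(2) show ?thesis
      proof (cases rule: words_cases)
        case (1 b)
        then show ?thesis using x A.m_comm[of a b] by (cases x') (auto simp: words_def)
      next
        case y: (2 b y')
        have 1: "\<one>\<^bsub>A\<^esub> # x' \<in> words A" "\<one>\<^bsub>A\<^esub> # y' \<in> words A" using x y by (auto simp: words_Cons)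
        have "diamond K l A x' (\<one>\<^bsub>A\<^esub> # y') = diamond K l A (\<one>\<^bsub>A\<^esub> # y') x'"
          "diamond K l A (\<one>\<^bsub>A\<^esub> # x') y' = diamond K l A y' (\<one>\<^bsub>A\<^esub> # x')"
          "diamond K l A x' y' = diamond K l A y' x'"
          by (rule less.hyps; use x y 1 in simp)+
        then show ?thesis
          unfolding x(1) y(1) diamond_Cons_Cons[OF x(3) y(3)] diamond_Cons_Cons[OF y(3) x(3)]
          using x y 1 A.m_comm[of a b] diamond_closed[of y' "\<one>\<^bsub>A\<^esub> # x'"] diamond_closed[of "\<one>\<^bsub>A\<^esub> # y'" x']
          by (simp add: F.M.a_comm)
      qed
    qed
  qed
  have word_right: "w \<otimes>\<^bsub>F\<^esub> word K y = word K y \<otimes>\<^bsub>F\<^esub> w"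
    if y: "y \<in> words A" and w: "w \<in> carrier F" for y w
    by (rule linear_map_F_eqI[OF module_F F_mult_linear_left F_mult_linear_right _ w])
       (use y d in \<open>simp_all add: F_mult_word word_closed\<close>)
  have "linear_map K F F (\<lambda>v. u \<otimes>\<^bsub>F\<^esub> v)" by (rule F_mult_linear_right[OF assms(1)])
  then show ?thesis
    by (intro linear_map_F_eqI[OF module_F _ F_mult_linear_left _ assms(2)])
       (use assms word_right in auto)
qed

lemma F_bilinear_eqI:
  assumes "module K M"
    and "\<And>v. v \<in> carrier F \<Longrightarrow> linear_map K F M (\<lambda>u. f u v)"
    and "\<And>u. u \<in> carrier F \<Longrightarrow> linear_map K F M (\<lambda>v. f u v)"
    and "\<And>v. v \<in> carrier F \<Longrightarrow> linear_map K F M (\<lambda>u. g u v)"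
    and "\<And>u. u \<in> carrier F \<Longrightarrow> linear_map K F M (\<lambda>v. g u v)"
    and "\<And>x y. x \<in> words A \<Longrightarrow> y \<in> words A \<Longrightarrow> f (word K x) (word K y) = g (word K x) (word K y)"
    and "u \<in> carrier F" "v \<in> carrier F"
  shows "f u v = g u v"
proof (rule linear_map_F_eqI[OF assms(1) assms(2)[OF assms(8)] assms(4)[OF assms(8)] _ assms(7)])
  fix x assume "x \<in> words A"
  then show "f (word K x) v = g (word K x) v"
    by (intro linear_map_F_eqI[OF assms(1) assms(3) assms(5) _ assms(8)])
       (auto simp: word_closed assms(6))
qed

text \<open>The operator that becomes the Rota-Baxter operator of \<open>Sha\<close> on the quotient. Every word is a
  single letter or the product of its first letter with a value of this operator.\<close>

definition prefix_one where "prefix_one = prefix_letter K \<one>\<^bsub>A\<^esub>"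

lemma prefix_one_linear: "linear_map K F F prefix_one"
  unfolding prefix_one_def by (rule prefix_letter_linear) simp

lemma prefix_one_closed [simp]: "u \<in> carrier F \<Longrightarrow> prefix_one u \<in> carrier F"
  by (rule linear_mapD(1)[OF prefix_one_linear])

lemma prefix_one_word: "prefix_one (word K w) = word K (\<one>\<^bsub>A\<^esub> # w)"
  by (simp add: prefix_one_def prefix_letter_word)

lemma F_mult_singleton_word:
  assumes "a \<in> carrier A" "b # w \<in> words A"
  shows "word K [a] \<otimes>\<^bsub>F\<^esub> word K (b # w) = word K ((a \<otimes>\<^bsub>A\<^esub> b) # w)"
  using assms by (simp add: F_mult_word words_Cons)

lemma F_mult_singleton_prefix:
  assumes "a \<in> carrier A" "b \<in> carrier A" "u \<in> carrier F"
  shows "word K [a] \<otimes>\<^bsub>F\<^esub> prefix_letter K b u = prefix_letter K (a \<otimes>\<^bsub>A\<^esub> b) u"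
proof (rule linear_map_F_eqI[OF module_F _ _ _ assms(3)])
  have a: "[a] \<in> words A" using assms(1) by (simp add: words_def)
  show "linear_map K F F (\<lambda>u. word K [a] \<otimes>\<^bsub>F\<^esub> prefix_letter K b u)"
    by (rule linear_map_comp[OF prefix_letter_linear[OF assms(2)] F_mult_linear_right[OF word_closed[OF a]]])
  show "linear_map K F F (prefix_letter K (a \<otimes>\<^bsub>A\<^esub> b))"
    using assms by (intro prefix_letter_linear) simp
  fix w assume "w \<in> words A"
  then show "word K [a] \<otimes>\<^bsub>F\<^esub> prefix_letter K b (word K w) = prefix_letter K (a \<otimes>\<^bsub>A\<^esub> b) (word K w)"
    using assms a by (simp add: prefix_letter_word F_mult_singleton_word words_Cons)
qed

lemma F_mult_prefix_prefix:
  assumes "a \<in> carrier A" "b \<in> carrier A" "u \<in> carrier F" "v \<in> carrier F"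
  shows "prefix_letter K a u \<otimes>\<^bsub>F\<^esub> prefix_letter K b v = prefix_letter K (a \<otimes>\<^bsub>A\<^esub> b)
    ((u \<otimes>\<^bsub>F\<^esub> prefix_one v) \<oplus>\<^bsub>F\<^esub> (prefix_one u \<otimes>\<^bsub>F\<^esub> v) \<oplus>\<^bsub>F\<^esub> l \<odot>\<^bsub>F\<^esub> (u \<otimes>\<^bsub>F\<^esub> v))"
proof (rule F_bilinear_eqI[OF module_F _ _ _ _ _ assms(3,4)])
  note lins = prefix_letter_linear linear_map_add[OF module_F] linear_map_smult[OF module_F]
    linear_map_comp[OF prefix_one_linear F_mult_linear_left] linear_map_comp[OF prefix_one_linear F_mult_linear_right]
    linear_map_comp[OF prefix_letter_linear F_mult_linear_left]
    linear_map_comp[OF prefix_letter_linear F_mult_linear_right]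
    F_mult_linear_left F_mult_linear_right prefix_letter_closed prefix_one_closed weight_closed
    assms(1,2) A.m_closed
  show "linear_map K F F (\<lambda>u. prefix_letter K a u \<otimes>\<^bsub>F\<^esub> prefix_letter K b v)" if "v \<in> carrier F" for v
    by (intro lins that)
  show "linear_map K F F (\<lambda>v. prefix_letter K a u \<otimes>\<^bsub>F\<^esub> prefix_letter K b v)" if "u \<in> carrier F" for u
    by (intro lins that)
  show "linear_map K F F (\<lambda>u. prefix_letter K (a \<otimes>\<^bsub>A\<^esub> b)
    ((u \<otimes>\<^bsub>F\<^esub> prefix_one v) \<oplus>\<^bsub>F\<^esub> (prefix_one u \<otimes>\<^bsub>F\<^esub> v) \<oplus>\<^bsub>F\<^esub> l \<odot>\<^bsub>F\<^esub> (u \<otimes>\<^bsub>F\<^esub> v)))" if "v \<in> carrier F" for v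
    by (rule linear_map_comp[OF _ prefix_letter_linear]; intro lins that)
  show "linear_map K F F (\<lambda>v. prefix_letter K (a \<otimes>\<^bsub>A\<^esub> b)
    ((u \<otimes>\<^bsub>F\<^esub> prefix_one v) \<oplus>\<^bsub>F\<^esub> (prefix_one u \<otimes>\<^bsub>F\<^esub> v) \<oplus>\<^bsub>F\<^esub> l \<odot>\<^bsub>F\<^esub> (u \<otimes>\<^bsub>F\<^esub> v)))" if "u \<in> carrier F" for u
    by (rule linear_map_comp[OF _ prefix_letter_linear]; intro lins that)
  fix x y assume "x \<in> words A" "y \<in> words A"
  then show "prefix_letter K a (word K x) \<otimes>\<^bsub>F\<^esub> prefix_letter K b (word K y) = prefix_letter K (a \<otimes>\<^bsub>A\<^esub> b)
    ((word K x \<otimes>\<^bsub>F\<^esub> prefix_one (word K y)) \<oplus>\<^bsub>F\<^esub> (prefix_one (word K x) \<otimes>\<^bsub>F\<^esub> word K y) \<oplus>\<^bsub>F\<^esub> l \<odot>\<^bsub>F\<^esub> (word K x \<otimes>\<^bsub>F\<^esub> word K y))"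
    using assms(1,2) by (simp add: prefix_letter_word prefix_one_word F_mult_word words_Cons diamond_Cons_Cons)
qed

text \<open>The Rota-Baxter identity already holds in \<open>F\<close>: it is the defining recursion of \<open>\<diamond>\<close> for two
  words beginning with \<open>1\<close>.\<close>

lemma prefix_one_mult:
  assumes "u \<in> carrier F" "v \<in> carrier F"
  shows "prefix_one u \<otimes>\<^bsub>F\<^esub> prefix_one v =
    prefix_one ((u \<otimes>\<^bsub>F\<^esub> prefix_one v) \<oplus>\<^bsub>F\<^esub> (prefix_one u \<otimes>\<^bsub>F\<^esub> v) \<oplus>\<^bsub>F\<^esub> l \<odot>\<^bsub>F\<^esub> (u \<otimes>\<^bsub>F\<^esub> v))"
  using F_mult_prefix_prefix[OF A.one_closed A.one_closed assms] by (simp add: prefix_one_def)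

lemma F_one_mult:
  assumes "u \<in> carrier F"
  shows "word K [\<one>\<^bsub>A\<^esub>] \<otimes>\<^bsub>F\<^esub> u = u"
proof (rule linear_map_F_eqI[OF module_F F_mult_linear_right linear_map_id _ assms])
  fix w assume w: "w \<in> words A"
  then show "word K [\<one>\<^bsub>A\<^esub>] \<otimes>\<^bsub>F\<^esub> word K w = word K w"
    by (cases w) (auto simp: words_def F_mult_word)
qed (auto simp: words_def intro!: word_closed)

text \<open>Multiplying by a single letter only changes the first letter of a word, so here associativity
  comes directly from that of \<open>A\<close>. By commutativity this settles every triple in which some factor is a
  single letter.\<close>

lemma F_mult_assoc_singleton:
  assumes a: "a \<in> carrier A" and u: "u \<in> carrier F" and v: "v \<in> carrier F"
  shows "word K [a] \<otimes>\<^bsub>F\<^esub> (u \<otimes>\<^bsub>F\<^esub> v) = (word K [a] \<otimes>\<^bsub>F\<^esub> u) \<otimes>\<^bsub>F\<^esub> v"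
proof (rule F_bilinear_eqI[OF module_F _ _ _ _ _ u v])
  have aw: "[a] \<in> words A" using a by (simp add: words_def)
  note lins = F_mult_linear_left F_mult_linear_right word_closed[OF aw] F_mult_closed
  show "linear_map K F F (\<lambda>u. word K [a] \<otimes>\<^bsub>F\<^esub> (u \<otimes>\<^bsub>F\<^esub> v))" if "v \<in> carrier F" for v
    by (rule linear_map_comp[OF F_mult_linear_left[OF that] F_mult_linear_right]) (rule lins)
  show "linear_map K F F (\<lambda>v. word K [a] \<otimes>\<^bsub>F\<^esub> (u \<otimes>\<^bsub>F\<^esub> v))" if "u \<in> carrier F" for u
    by (rule linear_map_comp[OF F_mult_linear_right[OF that] F_mult_linear_right]) (rule lins)
  show "linear_map K F F (\<lambda>u. (word K [a] \<otimes>\<^bsub>F\<^esub> u) \<otimes>\<^bsub>F\<^esub> v)" if "v \<in> carrier F" for v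
    by (rule linear_map_comp[OF F_mult_linear_right F_mult_linear_left[OF that]]) (rule lins)
  show "linear_map K F F (\<lambda>v. (word K [a] \<otimes>\<^bsub>F\<^esub> u) \<otimes>\<^bsub>F\<^esub> v)" if "u \<in> carrier F" for u
    by (intro lins that)
  fix x y assume x: "x \<in> words A" and y: "y \<in> words A"
  from x show "word K [a] \<otimes>\<^bsub>F\<^esub> (word K x \<otimes>\<^bsub>F\<^esub> word K y) = (word K [a] \<otimes>\<^bsub>F\<^esub> word K x) \<otimes>\<^bsub>F\<^esub> word K y"
  proof (cases rule: words_cases)
    case 1: (1 b)
    from y show ?thesis
      using 1 a by (cases y) (auto simp: words_def F_mult_singleton_word A.m_assoc)
  next
    case 2: (2 b x')
    from y show ?thesis
    proof (cases rule: words_cases)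
      case (1 c)
      have "word K (d # x') \<otimes>\<^bsub>F\<^esub> word K [c] = word K ((d \<otimes>\<^bsub>A\<^esub> c) # x')" if "d \<in> carrier A" for d
        using that 1 2 F_mult_singleton_word[of c d x'] A.m_comm[of c d]
          F_mult_comm[OF word_closed word_closed, of "d # x'" "[c]"]
        by (auto simp: words_def)
      then show ?thesis
        using 1 2 a by (simp add: words_Cons F_mult_singleton_word A.m_assoc)
    next
      case (2 c y')
      let ?w = "(word K x' \<otimes>\<^bsub>F\<^esub> prefix_one (word K y')) \<oplus>\<^bsub>F\<^esub> (prefix_one (word K x') \<otimes>\<^bsub>F\<^esub> word K y')
         \<oplus>\<^bsub>F\<^esub> l \<odot>\<^bsub>F\<^esub> (word K x' \<otimes>\<^bsub>F\<^esub> word K y')"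
      have "?w \<in> carrier F"
        using 2 \<open>x' \<in> words A\<close> by (simp add: F_mult_closed word_closed weight_closed)
      then show ?thesis
        using 2 \<open>x = _\<close> \<open>b \<in> _\<close> \<open>x' \<in> words A\<close> a
        by (simp add: prefix_letter_word[of _ x', symmetric] prefix_letter_word[of _ y', symmetric]
          F_mult_singleton_prefix F_mult_prefix_prefix word_closed A.m_assoc)
    qed
  qed
qed

text \<open>Let \<open>M(u,v) = u P(v) + P(u) v + l u v\<close>, so that \<open>a P(u) \<diamond> b P(v) = ab P(M(u,v))\<close>. Associativity
  for words of length at least two amounts to \<open>M(M(u,v),w) = M(u,M(v,w))\<close>. As \<open>P(M(u,v)) = P(u) P(v)\<close>,
  both sides expand into the triple products of \<open>u\<close> or \<open>P(u)\<close>, \<open>v\<close> or \<open>P(v)\<close>, \<open>w\<close> or \<open>P(w)\<close>, with at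
  most two factors of the form \<open>P(_)\<close>: seven products, all of smaller total length.\<close>

lemma F_mult_assoc_words:
  assumes "x \<in> words A" "y \<in> words A" "z \<in> words A"
  shows "(word K x \<otimes>\<^bsub>F\<^esub> word K y) \<otimes>\<^bsub>F\<^esub> word K z = word K x \<otimes>\<^bsub>F\<^esub> (word K y \<otimes>\<^bsub>F\<^esub> word K z)"
  using assms
proof (induction "length x + length y + length z" arbitrary: x y z rule: less_induct)
  case less
  note x = less.prems(1) and y = less.prems(2) and z = less.prems(3)
  note c = word_closed[OF x] word_closed[OF y] word_closed[OF z] F_mult_closed
  show ?case
  proof (cases "\<exists>a\<in>carrier A. x = [a] \<or> y = [a] \<or> z = [a]")
    case True
    then obtain a where a: "a \<in> carrier A" "x = [a] \<or> y = [a] \<or> z = [a]" by auto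
    note S = F_mult_assoc_singleton[OF a(1)]
    from a(2) show ?thesis
    proof (elim disjE)
      assume "x = [a]"
      then show ?thesis using S c by simp
    next
      assume [simp]: "y = [a]"
      have "(word K x \<otimes>\<^bsub>F\<^esub> word K [a]) \<otimes>\<^bsub>F\<^esub> word K z = word K [a] \<otimes>\<^bsub>F\<^esub> (word K x \<otimes>\<^bsub>F\<^esub> word K z)"
        using S c F_mult_comm[of "word K x" "word K [a]"] by simp
      also have "\<dots> = word K [a] \<otimes>\<^bsub>F\<^esub> (word K z \<otimes>\<^bsub>F\<^esub> word K x)"
        using c F_mult_comm[of "word K x" "word K z"] by simp
      also have "\<dots> = word K x \<otimes>\<^bsub>F\<^esub> (word K [a] \<otimes>\<^bsub>F\<^esub> word K z)"
        using S c F_mult_comm[of "word K x" "word K [a] \<otimes>\<^bsub>F\<^esub> word K z"] by simp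
      finally show ?thesis by simp
    next
      assume [simp]: "z = [a]"
      have "(word K x \<otimes>\<^bsub>F\<^esub> word K y) \<otimes>\<^bsub>F\<^esub> word K [a] = word K [a] \<otimes>\<^bsub>F\<^esub> (word K y \<otimes>\<^bsub>F\<^esub> word K x)"
        using c F_mult_comm[of "word K x \<otimes>\<^bsub>F\<^esub> word K y" "word K [a]"] F_mult_comm[of "word K x" "word K y"] by simp
      also have "\<dots> = (word K [a] \<otimes>\<^bsub>F\<^esub> word K y) \<otimes>\<^bsub>F\<^esub> word K x"
        using S c by simp
      also have "\<dots> = word K x \<otimes>\<^bsub>F\<^esub> (word K y \<otimes>\<^bsub>F\<^esub> word K [a])"
        using c F_mult_comm[of "word K y" "word K [a]"] F_mult_comm[of "word K x" "word K [a] \<otimes>\<^bsub>F\<^esub> word K y"] by simp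
      finally show ?thesis by simp
    qed
  next
    case False
    from x False obtain a x' where x': "x = a # x'" "a \<in> carrier A" "x' \<in> words A" by (cases rule: words_cases) auto
    from y False obtain b y' where y': "y = b # y'" "b \<in> carrier A" "y' \<in> words A" by (cases rule: words_cases) auto
    from z False obtain d z' where z': "z = d # z'" "d \<in> carrier A" "z' \<in> words A" by (cases rule: words_cases) auto
    define u v w where "u = word K x'" and "v = word K y'" and "w = word K z'"
    have [simp]: "u \<in> carrier F" "v \<in> carrier F" "w \<in> carrier F"
      unfolding u_def v_def w_def using x' y' z' by (auto intro: word_closed)
    have one: "\<one>\<^bsub>A\<^esub> # x' \<in> words A" "\<one>\<^bsub>A\<^esub> # y' \<in> words A" "\<one>\<^bsub>A\<^esub> # z' \<in> words A"
      using x' y' z' by (auto simp: words_Cons)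
    let ?P = prefix_one
    have IH: "(u \<otimes>\<^bsub>F\<^esub> ?P v) \<otimes>\<^bsub>F\<^esub> ?P w = u \<otimes>\<^bsub>F\<^esub> (?P v \<otimes>\<^bsub>F\<^esub> ?P w)"
      "(?P u \<otimes>\<^bsub>F\<^esub> v) \<otimes>\<^bsub>F\<^esub> ?P w = ?P u \<otimes>\<^bsub>F\<^esub> (v \<otimes>\<^bsub>F\<^esub> ?P w)"
      "(u \<otimes>\<^bsub>F\<^esub> v) \<otimes>\<^bsub>F\<^esub> ?P w = u \<otimes>\<^bsub>F\<^esub> (v \<otimes>\<^bsub>F\<^esub> ?P w)"
      "(?P u \<otimes>\<^bsub>F\<^esub> ?P v) \<otimes>\<^bsub>F\<^esub> w = ?P u \<otimes>\<^bsub>F\<^esub> (?P v \<otimes>\<^bsub>F\<^esub> w)"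
      "(u \<otimes>\<^bsub>F\<^esub> ?P v) \<otimes>\<^bsub>F\<^esub> w = u \<otimes>\<^bsub>F\<^esub> (?P v \<otimes>\<^bsub>F\<^esub> w)"
      "(?P u \<otimes>\<^bsub>F\<^esub> v) \<otimes>\<^bsub>F\<^esub> w = ?P u \<otimes>\<^bsub>F\<^esub> (v \<otimes>\<^bsub>F\<^esub> w)"
      "(u \<otimes>\<^bsub>F\<^esub> v) \<otimes>\<^bsub>F\<^esub> w = u \<otimes>\<^bsub>F\<^esub> (v \<otimes>\<^bsub>F\<^esub> w)"
      unfolding u_def v_def w_def prefix_one_word
      by (rule less.hyps; use x' y' z' one in simp)+
    let ?M = "\<lambda>u v. (u \<otimes>\<^bsub>F\<^esub> ?P v) \<oplus>\<^bsub>F\<^esub> (?P u \<otimes>\<^bsub>F\<^esub> v) \<oplus>\<^bsub>F\<^esub> l \<odot>\<^bsub>F\<^esub> (u \<otimes>\<^bsub>F\<^esub> v)"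
    note distr = linear_mapD(2)[OF F_mult_linear_left] linear_mapD(2)[OF F_mult_linear_right]
      linear_mapD(3)[OF F_mult_linear_left] linear_mapD(3)[OF F_mult_linear_right]
    have Mc [simp]: "?M p q \<in> carrier F" if "p \<in> carrier F" "q \<in> carrier F" for p q
      using that by (simp add: F_mult_closed weight_closed)
    \<comment> \<open>the outer \<open>?P (?M u v)\<close> has to be turned back into a product before the hypotheses apply\<close>
    have "?M (?M u v) w = (?M u v \<otimes>\<^bsub>F\<^esub> ?P w) \<oplus>\<^bsub>F\<^esub> ((?P u \<otimes>\<^bsub>F\<^esub> ?P v) \<otimes>\<^bsub>F\<^esub> w) \<oplus>\<^bsub>F\<^esub> l \<odot>\<^bsub>F\<^esub> (?M u v \<otimes>\<^bsub>F\<^esub> w)"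
      by (simp add: prefix_one_mult)
    also have "\<dots> = (u \<otimes>\<^bsub>F\<^esub> (?P v \<otimes>\<^bsub>F\<^esub> ?P w)) \<oplus>\<^bsub>F\<^esub> (?P u \<otimes>\<^bsub>F\<^esub> ?M v w) \<oplus>\<^bsub>F\<^esub> l \<odot>\<^bsub>F\<^esub> (u \<otimes>\<^bsub>F\<^esub> ?M v w)"
      by (simp add: distr IH F_mult_closed weight_closed F.smult_r_distr F.M.a_ac)
    also have "\<dots> = ?M u (?M v w)"
      by (simp add: prefix_one_mult)
    finally have "?M (?M u v) w = ?M u (?M v w)" .
    then show ?thesis
      unfolding x'(1) y'(1) z'(1) prefix_letter_word[of _ x', symmetric]
        prefix_letter_word[of _ y', symmetric] prefix_letter_word[of _ z', symmetric] u_def[symmetric] v_def[symmetric] w_def[symmetric]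
      using x' y' z' by (simp add: F_mult_prefix_prefix A.m_assoc)
  qed
qed

lemma F_mult_assoc:
  assumes "u \<in> carrier F" "v \<in> carrier F" "w \<in> carrier F"
  shows "(u \<otimes>\<^bsub>F\<^esub> v) \<otimes>\<^bsub>F\<^esub> w = u \<otimes>\<^bsub>F\<^esub> (v \<otimes>\<^bsub>F\<^esub> w)"
proof (rule linear_map_F_eqI[OF module_F _ _ _ assms(3)])
  show "linear_map K F F (\<lambda>w. (u \<otimes>\<^bsub>F\<^esub> v) \<otimes>\<^bsub>F\<^esub> w)"
    by (intro F_mult_linear_right F_mult_closed assms)
  show "linear_map K F F (\<lambda>w. u \<otimes>\<^bsub>F\<^esub> (v \<otimes>\<^bsub>F\<^esub> w))"
    by (rule linear_map_comp[OF F_mult_linear_right F_mult_linear_right]) (rule assms)+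
  fix z assume z: "z \<in> words A"
  note z' = word_closed[OF z]
  show "(u \<otimes>\<^bsub>F\<^esub> v) \<otimes>\<^bsub>F\<^esub> word K z = u \<otimes>\<^bsub>F\<^esub> (v \<otimes>\<^bsub>F\<^esub> word K z)"
  proof (rule F_bilinear_eqI[OF module_F _ _ _ _ _ assms(1,2)])
    show "linear_map K F F (\<lambda>u. (u \<otimes>\<^bsub>F\<^esub> v) \<otimes>\<^bsub>F\<^esub> word K z)" if "v \<in> carrier F" for v
      by (rule linear_map_comp[OF F_mult_linear_left F_mult_linear_left]) (rule that z')+
    show "linear_map K F F (\<lambda>v. (u \<otimes>\<^bsub>F\<^esub> v) \<otimes>\<^bsub>F\<^esub> word K z)" if "u \<in> carrier F" for u
      by (rule linear_map_comp[OF F_mult_linear_right F_mult_linear_left]) (rule that z')+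
    show "linear_map K F F (\<lambda>u. u \<otimes>\<^bsub>F\<^esub> (v \<otimes>\<^bsub>F\<^esub> word K z))" if "v \<in> carrier F" for v
      by (intro F_mult_linear_left F_mult_closed that z')
    show "linear_map K F F (\<lambda>v. u \<otimes>\<^bsub>F\<^esub> (v \<otimes>\<^bsub>F\<^esub> word K z))" if "u \<in> carrier F" for u
      by (rule linear_map_comp[OF F_mult_linear_left F_mult_linear_right]) (rule that z')+
  qed (use z in \<open>simp add: F_mult_assoc_words\<close>)
qed

lemma algebra_F: "algebra K F"
proof (rule algebraI)
  show "cring F"
  proof (rule cringI)
    show "comm_monoid F"
    proof (rule comm_monoidI)
      show "\<one>\<^bsub>F\<^esub> \<in> carrier F" by (auto simp: F_record_simps(2) words_def intro!: word_closed)
    qed (simp_all add: F_mult_closed F_mult_assoc F_one_mult F_record_simps(2), rule F_mult_comm)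
  qed (auto simp: linear_mapD[OF F_mult_linear_left] intro: F.M.abelian_group_axioms)
qed (auto simp: linear_mapD[OF F_mult_linear_left] A.R_cring F.smult_l_distr F.smult_r_distr F.smult_assoc1)

sublocale F: algebra K F by (rule algebra_F)

end

section \<open>Tensors, multilinear maps and the quotient algebra\<close>

text \<open>A map on words is multilinear if it is so on the words of each length; \<open>us\<close> and \<open>vs\<close> are the
  letters before and after the slot that varies.\<close>

definition multilinear where
  "multilinear K A M g \<longleftrightarrow> g \<in> words A \<rightarrow> carrier M \<and>
     (\<forall>us vs a b. set us \<subseteq> carrier A \<longrightarrow> set vs \<subseteq> carrier A \<longrightarrow> a \<in> carrier A \<longrightarrow> b \<in> carrier A \<longrightarrow>
        g (us @ (a \<oplus>\<^bsub>A\<^esub> b) # vs) = g (us @ a # vs) \<oplus>\<^bsub>M\<^esub> g (us @ b # vs)) \<and>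
     (\<forall>us vs c a. set us \<subseteq> carrier A \<longrightarrow> set vs \<subseteq> carrier A \<longrightarrow> c \<in> carrier K \<longrightarrow> a \<in> carrier A \<longrightarrow>
        g (us @ (c \<odot>\<^bsub>A\<^esub> a) # vs) = c \<odot>\<^bsub>M\<^esub> g (us @ a # vs))"

lemma multilinearI:
  assumes "\<And>w. w \<in> words A \<Longrightarrow> g w \<in> carrier M"
    and "\<And>us vs a b. set us \<subseteq> carrier A \<Longrightarrow> set vs \<subseteq> carrier A \<Longrightarrow> a \<in> carrier A \<Longrightarrow> b \<in> carrier A \<Longrightarrow>
        g (us @ (a \<oplus>\<^bsub>A\<^esub> b) # vs) = g (us @ a # vs) \<oplus>\<^bsub>M\<^esub> g (us @ b # vs)"
    and "\<And>us vs c a. set us \<subseteq> carrier A \<Longrightarrow> set vs \<subseteq> carrier A \<Longrightarrow> c \<in> carrier K \<Longrightarrow> a \<in> carrier A \<Longrightarrow>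
        g (us @ (c \<odot>\<^bsub>A\<^esub> a) # vs) = c \<odot>\<^bsub>M\<^esub> g (us @ a # vs)"
  shows "multilinear K A M g"
  using assms by (simp add: multilinear_def)

lemma multilinearD:
  assumes "multilinear K A M g"
  shows "w \<in> words A \<Longrightarrow> g w \<in> carrier M"
    and "set us \<subseteq> carrier A \<Longrightarrow> set vs \<subseteq> carrier A \<Longrightarrow> a \<in> carrier A \<Longrightarrow> b \<in> carrier A \<Longrightarrow>
        g (us @ (a \<oplus>\<^bsub>A\<^esub> b) # vs) = g (us @ a # vs) \<oplus>\<^bsub>M\<^esub> g (us @ b # vs)"
    and "set us \<subseteq> carrier A \<Longrightarrow> set vs \<subseteq> carrier A \<Longrightarrow> c \<in> carrier K \<Longrightarrow> a \<in> carrier A \<Longrightarrow>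
        g (us @ (c \<odot>\<^bsub>A\<^esub> a) # vs) = c \<odot>\<^bsub>M\<^esub> g (us @ a # vs)"
  using assms by (auto simp: multilinear_def)

context weighted_algebra
begin

lemma zero_submodule:
  assumes "module K M"
  shows "submodule {\<zero>\<^bsub>M\<^esub>} K M"
proof -
  interpret M: module K M by fact
  show ?thesis by (rule M.submoduleI) auto
qed

abbreviation N where "N \<equiv> tensor_null K l A"
abbreviation S where "S \<equiv> Sha K l A"
abbreviation cls where "cls u \<equiv> N +>\<^bsub>F\<^esub> u"

lemma slot_words:
  "set us \<subseteq> carrier A \<Longrightarrow> set vs \<subseteq> carrier A \<Longrightarrow> a \<in> carrier A \<Longrightarrow> us @ a # vs \<in> words A"
  by (auto simp: words_def)

lemma multilinear_rels_closed: "multilinear_rels K l A \<subseteq> carrier F"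
  by (auto simp: multilinear_rels_def intro!: F.M.minus_closed F.M.a_closed word_closed slot_words)

lemma tensor_null_submodule: "submodule N K F"
proof -
  let ?C = "{N. submodule N K F \<and> multilinear_rels K l A \<subseteq> N}"
  have ne: "carrier F \<in> ?C" using F.carrier_is_submodule multilinear_rels_closed by simp
  show ?thesis
  proof (rule F.submoduleI)
    show "N \<subseteq> carrier F" using ne by (auto simp: tensor_null_def)
    show "\<zero>\<^bsub>F\<^esub> \<in> N"
      by (auto simp: tensor_null_def dest: submodule.axioms(1) intro: subgroup.one_closed[of _ "add_monoid F", simplified])
  qed (auto simp: tensor_null_def F.submoduleE)
qed

lemma tensor_null_least:
  assumes "submodule T K F" "multilinear_rels K l A \<subseteq> T"
  shows "N \<subseteq> T"
  using assms by (auto simp: tensor_null_def)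

lemma multilinear_rels_tensor_null: "multilinear_rels K l A \<subseteq> N"
  by (auto simp: tensor_null_def)

lemma tensor_null_abelian_subgroup: "abelian_subgroup N F"
  using tensor_null_submodule F.M.abelian_group_axioms
  by (intro abelian_subgroupI3 additive_subgroup.intro) (auto dest: submodule.axioms(1))

sublocale N: abelian_subgroup N F by (rule tensor_null_abelian_subgroup)

lemma cls_eq_iff:
  assumes "u \<in> carrier F" "v \<in> carrier F"
  shows "cls u = cls v \<longleftrightarrow> u \<ominus>\<^bsub>F\<^esub> v \<in> N"
  using assms N.a_rcos_module_minus[OF F.ring_axioms assms(2,1)] N.a_rcos_self[of u]
    N.a_repr_independence'[of u v] by (metis)

lemma Sha_record:
  "carrier S = a_rcosets\<^bsub>F\<^esub> N" "X \<otimes>\<^bsub>S\<^esub> Y = rcoset_mult F N X Y" "\<one>\<^bsub>S\<^esub> = cls \<one>\<^bsub>F\<^esub>" "\<zero>\<^bsub>S\<^esub> = N"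
  "X \<oplus>\<^bsub>S\<^esub> Y = X <+>\<^bsub>F\<^esub> Y" "c \<odot>\<^bsub>S\<^esub> X = (\<Union>u\<in>X. cls (c \<odot>\<^bsub>F\<^esub> u))"
  by (simp_all only: Sha_def Let_def FactRing_def ring_record_simps module.simps partial_object.simps)

lemma Sha_carrier: "carrier S = cls ` carrier F"
  by (auto simp: Sha_record A_RCOSETS_def' a_r_coset_def')

lemma cls_closed [simp]: "u \<in> carrier F \<Longrightarrow> cls u \<in> carrier S"
  by (simp add: Sha_carrier)

lemma Sha_add: "u \<in> carrier F \<Longrightarrow> v \<in> carrier F \<Longrightarrow> cls u \<oplus>\<^bsub>S\<^esub> cls v = cls (u \<oplus>\<^bsub>F\<^esub> v)"
  by (simp only: Sha_record N.a_rcos_sum)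

lemma Sha_zero: "\<zero>\<^bsub>S\<^esub> = cls \<zero>\<^bsub>F\<^esub>"
  using F.M.a_coset_add_zero N.a_subset by (simp only: Sha_record)

lemma Sha_smult:
  assumes c: "c \<in> carrier K" and u: "u \<in> carrier F"
  shows "c \<odot>\<^bsub>S\<^esub> cls u = cls (c \<odot>\<^bsub>F\<^esub> u)"
proof -
  have "cls (c \<odot>\<^bsub>F\<^esub> v) = cls (c \<odot>\<^bsub>F\<^esub> u)" if v: "v \<in> cls u" for v
  proof -
    have vF: "v \<in> carrier F" using v u N.a_elemrcos_carrier by blast
    have "v \<ominus>\<^bsub>F\<^esub> u \<in> N" using v N.a_rcos_module_minus[OF F.ring_axioms u vF] by simp
    then have "c \<odot>\<^bsub>F\<^esub> (v \<ominus>\<^bsub>F\<^esub> u) \<in> N" using F.submoduleE(4)[OF tensor_null_submodule] c by simp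
    moreover have "c \<odot>\<^bsub>F\<^esub> (v \<ominus>\<^bsub>F\<^esub> u) = c \<odot>\<^bsub>F\<^esub> v \<ominus>\<^bsub>F\<^esub> c \<odot>\<^bsub>F\<^esub> u"
      using c u vF by (simp add: a_minus_def F.smult_r_distr F.smult_r_minus)
    ultimately show ?thesis using cls_eq_iff c u vF by simp
  qed
  moreover have "u \<in> cls u" using u by (rule N.a_rcos_self)
  ultimately show ?thesis unfolding Sha_record by blast
qed

text \<open>The module structure does not involve the product. It comes before the proof that the product is
  well defined because it allows multilinearity of the product to be stated as an equation in
  \<open>Sha(A)\<close>.\<close>

lemma module_Sha: "module K S"
proof (rule moduleI)
  show "abelian_group S"
  proof (rule abelian_groupI)
    fix X assume "X \<in> carrier S"
    then obtain u where u: "u \<in> carrier F" "X = cls u" by (auto simp: Sha_carrier)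
    show "\<exists>Y\<in>carrier S. Y \<oplus>\<^bsub>S\<^esub> X = \<zero>\<^bsub>S\<^esub>"
      using u by (intro bexI[of _ "cls (\<ominus>\<^bsub>F\<^esub> u)"]) (auto simp: Sha_add Sha_zero F.M.l_neg)
  qed (auto simp: Sha_carrier Sha_add Sha_zero F.M.a_ac)
qed (auto simp: Sha_carrier Sha_add Sha_smult A.R_cring F.smult_l_distr F.smult_r_distr F.smult_assoc1)

sublocale S: module K S by (rule module_Sha)

lemma cls_linear: "linear_map K F S (\<lambda>u. cls u)"
  by (rule linear_mapI) (auto simp: Sha_add Sha_smult)

lemma cls_eq_zero_iff: "u \<in> carrier F \<Longrightarrow> cls u = \<zero>\<^bsub>S\<^esub> \<longleftrightarrow> u \<in> N"
  by (simp add: Sha_zero cls_eq_iff a_minus_def)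

lemma tensor_eq: "tensor K l A w = cls (word K w)"
  by (simp add: tensor_def)

lemma tensor_closed: "w \<in> words A \<Longrightarrow> tensor K l A w \<in> carrier S"
  by (simp add: tensor_eq word_closed)

lemma tensor_multilinear: "multilinear K A S (tensor K l A)"
proof (rule multilinearI)
  fix us vs a assume us: "set us \<subseteq> carrier A" "set vs \<subseteq> carrier A" "a \<in> carrier A"
  {
    fix b assume b: "b \<in> carrier A"
    note w = slot_words[OF us(1,2), THEN word_closed]
    have "word K (us @ [a \<oplus>\<^bsub>A\<^esub> b] @ vs) \<ominus>\<^bsub>F\<^esub> (word K (us @ [a] @ vs) \<oplus>\<^bsub>F\<^esub> word K (us @ [b] @ vs))
      \<in> multilinear_rels K l A"
      unfolding multilinear_rels_def using us b by blast
    then have "word K (us @ (a \<oplus>\<^bsub>A\<^esub> b) # vs) \<ominus>\<^bsub>F\<^esub> (word K (us @ a # vs) \<oplus>\<^bsub>F\<^esub> word K (us @ b # vs)) \<in> N"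
      using multilinear_rels_tensor_null by auto
    then show "tensor K l A (us @ (a \<oplus>\<^bsub>A\<^esub> b) # vs) = tensor K l A (us @ a # vs) \<oplus>\<^bsub>S\<^esub> tensor K l A (us @ b # vs)"
      using us b w by (simp add: tensor_eq Sha_add cls_eq_iff)
  next
    fix c assume c: "c \<in> carrier K"
    note w = slot_words[OF us(1,2), THEN word_closed]
    have "word K (us @ [c \<odot>\<^bsub>A\<^esub> a] @ vs) \<ominus>\<^bsub>F\<^esub> (c \<odot>\<^bsub>F\<^esub> word K (us @ [a] @ vs)) \<in> multilinear_rels K l A"
      unfolding multilinear_rels_def using us c by blast
    then have "word K (us @ (c \<odot>\<^bsub>A\<^esub> a) # vs) \<ominus>\<^bsub>F\<^esub> (c \<odot>\<^bsub>F\<^esub> word K (us @ a # vs)) \<in> N"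
      using multilinear_rels_tensor_null by auto
    then show "tensor K l A (us @ (c \<odot>\<^bsub>A\<^esub> a) # vs) = c \<odot>\<^bsub>S\<^esub> tensor K l A (us @ a # vs)"
      using us c w by (simp add: tensor_eq Sha_smult cls_eq_iff)
  }
qed (rule tensor_closed)

text \<open>The kernel of the linear extension of a multilinear map is a submodule containing the tensor
  relations, so it contains the least such submodule.\<close>

lemma linear_extension_tensor_null:
  assumes "module K M" "multilinear K A M g" "u \<in> N"
  shows "linear_extension K M g u = \<zero>\<^bsub>M\<^esub>"
proof -
  interpret M: module K M by fact
  have g: "g \<in> words A \<rightarrow> carrier M" using multilinearD(1)[OF assms(2)] by auto
  let ?L = "linear_extension K M g"
  let ?T = "{u \<in> carrier F. ?L u \<in> {\<zero>\<^bsub>M\<^esub>}}"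
  note lin = linear_extension_linear[OF assms(1) g]
  note L = linear_mapD[OF lin]
  note Lw = linear_extension_word[OF assms(1) g]
  have "submodule ?T K F"
    by (rule linear_map_preimage_submodule[OF module_F assms(1) lin zero_submodule[OF assms(1)]])
  moreover have "multilinear_rels K l A \<subseteq> ?T"
  proof
    fix r assume r: "r \<in> multilinear_rels K l A"
    then have rF: "r \<in> carrier F" using multilinear_rels_closed by auto
    from r consider us vs a b where "set us \<subseteq> carrier A" "set vs \<subseteq> carrier A" "a \<in> carrier A" "b \<in> carrier A"
        "r = word K (us @ (a \<oplus>\<^bsub>A\<^esub> b) # vs) \<ominus>\<^bsub>F\<^esub> (word K (us @ a # vs) \<oplus>\<^bsub>F\<^esub> word K (us @ b # vs))"
      | us vs c a where "set us \<subseteq> carrier A" "set vs \<subseteq> carrier A" "c \<in> carrier K" "a \<in> carrier A"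
        "r = word K (us @ (c \<odot>\<^bsub>A\<^esub> a) # vs) \<ominus>\<^bsub>F\<^esub> (c \<odot>\<^bsub>F\<^esub> word K (us @ a # vs))"
      unfolding multilinear_rels_def by auto
    then have "?L r = \<zero>\<^bsub>M\<^esub>"
    proof cases
      case 1
      then have "?L r = g (us @ (a \<oplus>\<^bsub>A\<^esub> b) # vs) \<ominus>\<^bsub>M\<^esub> (g (us @ a # vs) \<oplus>\<^bsub>M\<^esub> g (us @ b # vs))"
        by (simp add: linear_map_minus[OF module_F assms(1) lin] L slot_words word_closed Lw)
      then show ?thesis
        using 1 multilinearD(1)[OF assms(2) slot_words] by (simp add: multilinearD(2)[OF assms(2)] M.M.r_neg a_minus_def)
    next
      case 2
      then have "?L r = g (us @ (c \<odot>\<^bsub>A\<^esub> a) # vs) \<ominus>\<^bsub>M\<^esub> (c \<odot>\<^bsub>M\<^esub> g (us @ a # vs))"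
        by (simp add: linear_map_minus[OF module_F assms(1) lin] L slot_words word_closed Lw)
      then show ?thesis
        using 2 multilinearD(1)[OF assms(2) slot_words] by (simp add: multilinearD(3)[OF assms(2)] M.M.r_neg a_minus_def)
    qed
    then show "r \<in> ?T" using rF by simp
  qed
  ultimately have "N \<subseteq> ?T" by (rule tensor_null_least)
  then show ?thesis using assms(3) by auto
qed

lemma tensor_lift_cls:
  assumes "module K M" "multilinear K A M g" "u \<in> carrier F"
  shows "tensor_lift K M g (cls u) = linear_extension K M g u"
proof -
  interpret M: module K M by fact
  have g: "g \<in> words A \<rightarrow> carrier M" using multilinearD(1)[OF assms(2)] by auto
  note lin = linear_extension_linear[OF assms(1) g]
  have "linear_extension K M g v = linear_extension K M g u" if v: "v \<in> cls u" for v
  proof -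
    have vF: "v \<in> carrier F" using v assms(3) N.a_elemrcos_carrier by blast
    have "v \<ominus>\<^bsub>F\<^esub> u \<in> N" using v N.a_rcos_module_minus[OF F.ring_axioms assms(3) vF] by simp
    then have "linear_extension K M g (v \<ominus>\<^bsub>F\<^esub> u) = \<zero>\<^bsub>M\<^esub>"
      by (rule linear_extension_tensor_null[OF assms(1,2)])
    moreover have "v = (v \<ominus>\<^bsub>F\<^esub> u) \<oplus>\<^bsub>F\<^esub> u"
      using vF assms(3) by (simp add: a_minus_def F.M.a_assoc F.M.l_neg)
    then have "linear_extension K M g v = linear_extension K M g (v \<ominus>\<^bsub>F\<^esub> u) \<oplus>\<^bsub>M\<^esub> linear_extension K M g u"
      using linear_mapD(2)[OF lin F.M.minus_closed[OF vF assms(3)] assms(3)] by simp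
    ultimately show ?thesis using linear_mapD(1)[OF lin assms(3)] by simp
  qed
  moreover have "u \<in> cls u" using assms(3) by (rule N.a_rcos_self)
  ultimately have "linear_extension K M g ` cls u = {linear_extension K M g u}" by blast
  then show ?thesis by (simp add: tensor_lift_def linear_extension_def[abs_def])
qed

lemma tensor_lift_linear:
  assumes "module K M" "multilinear K A M g"
  shows "linear_map K S M (tensor_lift K M g)"
proof -
  have g: "g \<in> words A \<rightarrow> carrier M" using multilinearD(1)[OF assms(2)] by auto
  note lin = linear_mapD[OF linear_extension_linear[OF assms(1) g]]
  show ?thesis
    by (rule linear_mapI)
       (auto simp: Sha_carrier tensor_lift_cls[OF assms] Sha_add Sha_smult lin)
qed

lemma tensor_lift_tensor:
  assumes "module K M" "multilinear K A M g" "w \<in> words A"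
  shows "tensor_lift K M g (tensor K l A w) = g w"
proof -
  have g: "g \<in> words A \<rightarrow> carrier M" using multilinearD(1)[OF assms(2)] by auto
  show ?thesis
    using assms g by (simp add: tensor_eq tensor_lift_cls word_closed linear_extension_word)
qed

lemma Sha_linear_eqI:
  assumes "module K M" "linear_map K S M f" "linear_map K S M g"
    "\<And>w. w \<in> words A \<Longrightarrow> f (tensor K l A w) = g (tensor K l A w)" "X \<in> carrier S"
  shows "f X = g X"
proof -
  obtain u where u: "u \<in> carrier F" "X = cls u" using assms(5) by (auto simp: Sha_carrier)
  have "f (cls u) = g (cls u)"
    by (rule linear_map_F_eqI[OF assms(1) linear_map_comp[OF cls_linear assms(2)]
          linear_map_comp[OF cls_linear assms(3)] _ u(1)])
       (use assms(4) in \<open>simp add: tensor_eq\<close>)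
  then show ?thesis using u by simp
qed

text \<open>Prefixing a letter is itself a multilinear operation, so it descends to the quotient and is
  linear in the letter. The Rota-Baxter operator is the case of the letter \<open>1\<close>.\<close>

definition Sha_prefix where
  "Sha_prefix a = tensor_lift K S (\<lambda>w. tensor K l A (a # w))"

lemma tensor_Cons_multilinear:
  assumes "a \<in> carrier A"
  shows "multilinear K A S (\<lambda>w. tensor K l A (a # w))"
  by (rule multilinearI)
     (use assms multilinearD[OF tensor_multilinear] multilinearD(2,3)[OF tensor_multilinear, of "a # _"]
      in \<open>auto simp: words_Cons\<close>)

lemma Sha_prefix_linear: "a \<in> carrier A \<Longrightarrow> linear_map K S S (Sha_prefix a)"
  unfolding Sha_prefix_def by (intro tensor_lift_linear module_Sha tensor_Cons_multilinear)

lemma Sha_prefix_tensor: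
  "a \<in> carrier A \<Longrightarrow> w \<in> words A \<Longrightarrow> Sha_prefix a (tensor K l A w) = tensor K l A (a # w)"
  unfolding Sha_prefix_def by (intro tensor_lift_tensor module_Sha tensor_Cons_multilinear)

lemma Sha_prefix_cls:
  assumes "a \<in> carrier A" "u \<in> carrier F"
  shows "Sha_prefix a (cls u) = cls (prefix_letter K a u)"
  by (rule linear_map_F_eqI[OF module_Sha linear_map_comp[OF cls_linear Sha_prefix_linear[OF assms(1)]]
        linear_map_comp[OF prefix_letter_linear[OF assms(1)] cls_linear] _ assms(2)])
     (use assms(1) in \<open>simp add: tensor_eq[symmetric] Sha_prefix_tensor prefix_letter_word\<close>)

lemma Sha_prefix_add:
  assumes "a \<in> carrier A" "b \<in> carrier A" "X \<in> carrier S"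
  shows "Sha_prefix (a \<oplus>\<^bsub>A\<^esub> b) X = Sha_prefix a X \<oplus>\<^bsub>S\<^esub> Sha_prefix b X"
  by (rule Sha_linear_eqI[OF module_Sha Sha_prefix_linear
        linear_map_add[OF module_Sha Sha_prefix_linear Sha_prefix_linear] _ assms(3)])
     (use assms multilinearD(2)[OF tensor_multilinear, of "[]"]
      in \<open>auto simp: Sha_prefix_tensor words_def\<close>)

lemma Sha_prefix_smult:
  assumes "c \<in> carrier K" "a \<in> carrier A" "X \<in> carrier S"
  shows "Sha_prefix (c \<odot>\<^bsub>A\<^esub> a) X = c \<odot>\<^bsub>S\<^esub> Sha_prefix a X"
  by (rule Sha_linear_eqI[OF module_Sha Sha_prefix_linear
        linear_map_smult[OF module_Sha Sha_prefix_linear] _ assms(3)])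
     (use assms multilinearD(3)[OF tensor_multilinear, of "[]"]
      in \<open>auto simp: Sha_prefix_tensor words_def\<close>)

lemma cls_diamond_Cons_Cons:
  assumes "x \<in> words A" "y \<in> words A" "a \<in> carrier A" "b \<in> carrier A"
  shows "cls (diamond K l A (a # x) (b # y)) = Sha_prefix (a \<otimes>\<^bsub>A\<^esub> b)
     (cls (diamond K l A x (\<one>\<^bsub>A\<^esub> # y)) \<oplus>\<^bsub>S\<^esub> cls (diamond K l A (\<one>\<^bsub>A\<^esub> # x) y) \<oplus>\<^bsub>S\<^esub> l \<odot>\<^bsub>S\<^esub> cls (diamond K l A x y))"
proof -
  have "diamond K l A x (\<one>\<^bsub>A\<^esub> # y) \<in> carrier F" "diamond K l A (\<one>\<^bsub>A\<^esub> # x) y \<in> carrier F"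
    "diamond K l A x y \<in> carrier F"
    using assms by (auto intro!: diamond_closed simp: words_Cons)
  then show ?thesis
    using assms weight_closed by (simp add: diamond_Cons_Cons Sha_prefix_cls Sha_add Sha_smult)
qed

lemma cls_diamond_singleton:
  assumes "x \<in> words A"
  shows "cls (diamond K l A (a # x) [b]) = cls (word K ((a \<otimes>\<^bsub>A\<^esub> b) # x))"
  using assms by (cases x) (simp_all add: words_def)

text \<open>If the varying slot is the first letter, the recursion puts the product of first letters in
  front of a tensor that does not depend on this slot, and \<^term>\<open>Sha_prefix\<close> is linear in its letter.
  A later slot stays inside the three recursive products, which are multilinear by induction.\<close>

lemma diamond_multilinear:
  assumes "x \<in> words A"
  shows "multilinear K A S (\<lambda>y. cls (diamond K l A x y))"
proof -
  let ?G = "\<lambda>x y. cls (diamond K l A x y)"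
  let ?T = "\<lambda>x us vs. (\<forall>a\<in>carrier A. \<forall>b\<in>carrier A.
        ?G x (us @ (a \<oplus>\<^bsub>A\<^esub> b) # vs) = ?G x (us @ a # vs) \<oplus>\<^bsub>S\<^esub> ?G x (us @ b # vs)) \<and>
      (\<forall>c\<in>carrier K. \<forall>a\<in>carrier A. ?G x (us @ (c \<odot>\<^bsub>A\<^esub> a) # vs) = c \<odot>\<^bsub>S\<^esub> ?G x (us @ a # vs))"
  have Gc: "?G x y \<in> carrier S" if "x \<in> words A" "y \<in> words A" for x y
    using that by (simp add: diamond_closed)
  have "?T x us vs" if "x \<in> words A" "set us \<subseteq> carrier A" "set vs \<subseteq> carrier A" for x us vs
    using that
  proof (induction "length x + length us" arbitrary: x us rule: less_induct)
    case less
    note us = less.prems(2) and vs = less.prems(3)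
    note tm = multilinearD(2,3)[OF tensor_multilinear]
    have smult_right: "d \<otimes>\<^bsub>A\<^esub> (c \<odot>\<^bsub>A\<^esub> a) = c \<odot>\<^bsub>A\<^esub> (d \<otimes>\<^bsub>A\<^esub> a)"
      if "c \<in> carrier K" "d \<in> carrier A" "a \<in> carrier A" for c d a
      by (rule linear_mapD(3)[OF linear_map_mult_left[OF algebra_A _ linear_map_id]]) (use that in auto)
    from less.prems(1) show ?case
    proof (cases rule: words_cases)
      case x: (1 d)
      show ?thesis
      proof (cases us)
        case Nil
        then show ?thesis
          using x vs less.prems(1) tm[of "[]" vs] by (simp add: tensor_eq A.r_distr smult_right)
      next
        case (Cons e us')
        then show ?thesis
          using x us vs tm[of "(d \<otimes>\<^bsub>A\<^esub> e) # us'" vs] by (simp add: tensor_eq)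
      qed
    next
      case x: (2 d x')
      have one: "\<one>\<^bsub>A\<^esub> # x' \<in> words A" using x by (simp add: words_Cons)
      show ?thesis
      proof (cases us)
        case us: Nil
        show ?thesis
        proof (cases "vs = []")
          case True
          then show ?thesis
            using x us tm[of "[]" x'] by (simp add: cls_diamond_singleton[OF x(3)] tensor_eq A.r_distr smult_right words_def)
        next
          case False
          then have vs': "vs \<in> words A" "\<one>\<^bsub>A\<^esub> # vs \<in> words A" using vs by (auto simp: words_def)
          \<comment> \<open>the tensor following the first letter, independent of the varying slot\<close>
          let ?X = "?G x' (\<one>\<^bsub>A\<^esub> # vs) \<oplus>\<^bsub>S\<^esub> ?G (\<one>\<^bsub>A\<^esub> # x') vs \<oplus>\<^bsub>S\<^esub> l \<odot>\<^bsub>S\<^esub> ?G x' vs"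
          have "?X \<in> carrier S" using x one vs' weight_closed by (simp add: Gc del: cls_closed)
          then show ?thesis
            using x us vs' by (simp add: cls_diamond_Cons_Cons A.r_distr smult_right Sha_prefix_add Sha_prefix_smult)
        qed
      next
        case us': (Cons e us')
        have e: "e \<in> carrier A" "set us' \<subseteq> carrier A" "set (\<one>\<^bsub>A\<^esub> # us') \<subseteq> carrier A" using us us' by auto
        have IH: "?T x' (\<one>\<^bsub>A\<^esub> # us') vs" "?T (\<one>\<^bsub>A\<^esub> # x') us' vs" "?T x' us' vs"
          by (rule less.hyps; use x us' e one vs in simp)+
        have w: "us' @ a # vs \<in> words A" "\<one>\<^bsub>A\<^esub> # us' @ a # vs \<in> words A" if "a \<in> carrier A" for a
          using that e vs by (auto simp: words_def)
        note P = linear_mapD[OF Sha_prefix_linear]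
        show ?thesis
          using IH x e w one
          by (simp add: us' cls_diamond_Cons_Cons P Gc weight_closed S.smult_r_distr S.M.a_ac
                S.smult_assoc1[symmetric] A.R.m_comm del: cls_closed)
      qed
    qed
  qed
  then show ?thesis using assms Gc by (intro multilinearI) auto
qed

lemma tensor_null_mult:
  assumes "u \<in> carrier F" "v \<in> N"
  shows "u \<otimes>\<^bsub>F\<^esub> v \<in> N"
proof -
  have v: "v \<in> carrier F" using assms(2) N.a_subset by auto
  have zero: "linear_map K F S (\<lambda>u. \<zero>\<^bsub>S\<^esub>)" by (rule linear_mapI) auto
  have "cls (u \<otimes>\<^bsub>F\<^esub> v) = \<zero>\<^bsub>S\<^esub>"
  proof (rule linear_map_F_eqI[OF module_Sha linear_map_comp[OF F_mult_linear_left[OF v] cls_linear] zero _ assms(1)])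
    fix x assume x: "x \<in> words A"
    note m = diamond_multilinear[OF x]
    have g: "(\<lambda>y. cls (diamond K l A x y)) \<in> words A \<rightarrow> carrier S"
      using multilinearD(1)[OF m] by auto
    have "cls (word K x \<otimes>\<^bsub>F\<^esub> v) = linear_extension K S (\<lambda>y. cls (diamond K l A x y)) v"
      by (rule linear_map_F_eqI[OF module_Sha linear_map_comp[OF F_mult_linear_right cls_linear]
            linear_extension_linear[OF module_Sha g] _ v])
         (use x g in \<open>simp_all add: word_closed F_mult_word linear_extension_word[OF module_Sha]\<close>)
    then show "cls (word K x \<otimes>\<^bsub>F\<^esub> v) = \<zero>\<^bsub>S\<^esub>"
      using linear_extension_tensor_null[OF module_Sha m assms(2)] by simp
  qed
  then show ?thesis using assms(1) v by (simp add: cls_eq_zero_iff)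
qed

text \<open>Since left multiplication by a word is multilinear modulo the relations, it preserves them; so
  does multiplication by any element of \<open>F\<close>.\<close>

lemma tensor_null_ideal: "ideal N F"
proof (rule idealI)
  show "subgroup N (add_monoid F)" by (rule N.a_subgroup)
  show "u \<otimes>\<^bsub>F\<^esub> v \<in> N" if "v \<in> N" "u \<in> carrier F" for u v using that by (rule tensor_null_mult[rotated])
  then show "v \<otimes>\<^bsub>F\<^esub> u \<in> N" if "v \<in> N" "u \<in> carrier F" for u v
    using that F_mult_comm[of v u] N.a_subset by auto
qed (rule F.ring_axioms)

lemma Sha_mult: "u \<in> carrier F \<Longrightarrow> v \<in> carrier F \<Longrightarrow> cls u \<otimes>\<^bsub>S\<^esub> cls v = cls (u \<otimes>\<^bsub>F\<^esub> v)"
  using ideal.rcoset_mult_add[OF tensor_null_ideal] by (simp only: Sha_record)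

lemma Sha_one: "\<one>\<^bsub>S\<^esub> = cls \<one>\<^bsub>F\<^esub>"
  by (simp only: Sha_record)

lemma algebra_Sha: "algebra K S"
proof (rule algebraI)
  show "cring S"
  proof (rule cringI)
    show "comm_monoid S"
      by (rule comm_monoidI) (auto simp: Sha_carrier Sha_mult Sha_one F.m_ac)
    show "(X \<oplus>\<^bsub>S\<^esub> Y) \<otimes>\<^bsub>S\<^esub> Z = X \<otimes>\<^bsub>S\<^esub> Z \<oplus>\<^bsub>S\<^esub> Y \<otimes>\<^bsub>S\<^esub> Z"
      if "X \<in> carrier S" "Y \<in> carrier S" "Z \<in> carrier S" for X Y Z
      using that by (auto simp: Sha_carrier Sha_mult Sha_add F.l_distr)
  qed (rule S.M.abelian_group_axioms)
  show "(c \<odot>\<^bsub>S\<^esub> X) \<otimes>\<^bsub>S\<^esub> Y = c \<odot>\<^bsub>S\<^esub> (X \<otimes>\<^bsub>S\<^esub> Y)"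
    if "c \<in> carrier K" "X \<in> carrier S" "Y \<in> carrier S" for c X Y
    using that by (auto simp: Sha_carrier Sha_mult Sha_smult F.smult_assoc2)
qed (auto simp: A.R_cring S.smult_l_distr S.smult_r_distr S.smult_assoc1)

sublocale S: algebra K S by (rule algebra_Sha)

end

section \<open>The universal property of the free Rota-Baxter algebra\<close>

text \<open>The value \<open>f(a\<^sub>0) P(f(a\<^sub>1) P(\<dots> P(f(a\<^sub>n)) \<dots>))\<close> forced on \<open>a\<^sub>0 \<otimes> \<dots> \<otimes> a\<^sub>n\<close> by a Rota-Baxter
  homomorphism extending \<open>f\<close>. The value on the empty word agrees with that of \<^const>\<open>mu_word\<close>, which
  thereby is literally the case where \<open>f\<close> is the identity.\<close>

fun rb_word :: "('k, 'm) module \<Rightarrow> ('m \<Rightarrow> 'm) \<Rightarrow> ('a \<Rightarrow> 'm) \<Rightarrow> 'a list \<Rightarrow> 'm" where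
  "rb_word R P f [] = \<zero>\<^bsub>R\<^esub>"
| "rb_word R P f [a] = f a"
| "rb_word R P f (a # b # w) = f a \<otimes>\<^bsub>R\<^esub> P (rb_word R P f (b # w))"

definition rb_lift :: "'k ring \<Rightarrow> ('k, 'm) module \<Rightarrow> ('m \<Rightarrow> 'm) \<Rightarrow> ('a \<Rightarrow> 'm) \<Rightarrow> ('a list \<Rightarrow> 'k) set \<Rightarrow> 'm" where
  "rb_lift K R P f = tensor_lift K R (rb_word R P f)"

lemma rota_baxterD:
  assumes "rota_baxter K l R P"
  shows "algebra K R"
    and "x \<in> carrier R \<Longrightarrow> P x \<in> carrier R"
    and "linear_map K R R P"
    and "x \<in> carrier R \<Longrightarrow> y \<in> carrier R \<Longrightarrow> P x \<otimes>\<^bsub>R\<^esub> P y =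
          P (x \<otimes>\<^bsub>R\<^esub> P y) \<oplus>\<^bsub>R\<^esub> P (y \<otimes>\<^bsub>R\<^esub> P x) \<oplus>\<^bsub>R\<^esub> l \<odot>\<^bsub>R\<^esub> P (x \<otimes>\<^bsub>R\<^esub> y)"
  using assms by (auto simp: rota_baxter_def linear_map_def)

lemma rota_baxterI:
  assumes "algebra K R" "linear_map K R R P"
    "\<And>x y. x \<in> carrier R \<Longrightarrow> y \<in> carrier R \<Longrightarrow> P x \<otimes>\<^bsub>R\<^esub> P y =
          P (x \<otimes>\<^bsub>R\<^esub> P y) \<oplus>\<^bsub>R\<^esub> P (y \<otimes>\<^bsub>R\<^esub> P x) \<oplus>\<^bsub>R\<^esub> l \<odot>\<^bsub>R\<^esub> P (x \<otimes>\<^bsub>R\<^esub> y)"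
  shows "rota_baxter K l R P"
  using assms by (auto simp: rota_baxter_def linear_map_def)

lemma alg_homD:
  assumes "h \<in> alg_hom K A B"
  shows "algebra K A" "algebra K B" "linear_map K A B h"
    and "x \<in> carrier A \<Longrightarrow> h x \<in> carrier B"
    and "x \<in> carrier A \<Longrightarrow> y \<in> carrier A \<Longrightarrow> h (x \<otimes>\<^bsub>A\<^esub> y) = h x \<otimes>\<^bsub>B\<^esub> h y"
    and "x \<in> carrier A \<Longrightarrow> y \<in> carrier A \<Longrightarrow> h (x \<oplus>\<^bsub>A\<^esub> y) = h x \<oplus>\<^bsub>B\<^esub> h y"
    and "c \<in> carrier K \<Longrightarrow> x \<in> carrier A \<Longrightarrow> h (c \<odot>\<^bsub>A\<^esub> x) = c \<odot>\<^bsub>B\<^esub> h x"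
    and "h \<one>\<^bsub>A\<^esub> = \<one>\<^bsub>B\<^esub>"
  using assms by (auto simp: alg_hom_def linear_map_def ring_hom_def)

lemma alg_homI:
  assumes "algebra K A" "algebra K B" "linear_map K A B h"
    and "\<And>x y. x \<in> carrier A \<Longrightarrow> y \<in> carrier A \<Longrightarrow> h (x \<otimes>\<^bsub>A\<^esub> y) = h x \<otimes>\<^bsub>B\<^esub> h y"
    and "h \<one>\<^bsub>A\<^esub> = \<one>\<^bsub>B\<^esub>"
  shows "h \<in> alg_hom K A B"
  using assms by (auto simp: alg_hom_def linear_map_def ring_hom_def)

lemma alg_hom_comp:
  assumes "f \<in> alg_hom K A B" "g \<in> alg_hom K B C"
  shows "(\<lambda>x. g (f x)) \<in> alg_hom K A C"
  by (rule alg_homI)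
     (use alg_homD[OF assms(1)] alg_homD[OF assms(2)] in
       \<open>auto intro: linear_map_comp\<close>)

lemma rb_homD:
  assumes "f \<in> rb_hom K l R P S Q"
  shows "rota_baxter K l R P" "rota_baxter K l S Q" "f \<in> alg_hom K R S"
    "x \<in> carrier R \<Longrightarrow> f (P x) = Q (f x)"
  using assms by (auto simp: rb_hom_def)

lemma rb_homI:
  assumes "rota_baxter K l R P" "rota_baxter K l S Q" "f \<in> alg_hom K R S"
    "\<And>x. x \<in> carrier R \<Longrightarrow> f (P x) = Q (f x)"
  shows "f \<in> rb_hom K l R P S Q"
  using assms by (auto simp: rb_hom_def)

lemma rb_hom_comp:
  assumes "f \<in> rb_hom K l R P S Q" "g \<in> rb_hom K l S Q T V"
  shows "(\<lambda>x. g (f x)) \<in> rb_hom K l R P T V"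
  by (rule rb_homI)
     (use rb_homD[OF assms(1)] rb_homD[OF assms(2)] alg_homD(4)[OF rb_homD(3)[OF assms(1)]]
       alg_hom_comp in auto)

context weighted_algebra
begin

lemma Sha_P_eq: "Sha_P K l A = Sha_prefix \<one>\<^bsub>A\<^esub>"
  by (simp only: Sha_P_def Sha_prefix_def)

lemma Sha_P_linear: "linear_map K S S (Sha_P K l A)"
  unfolding Sha_P_eq by (rule Sha_prefix_linear) simp

lemma Sha_P_cls: "u \<in> carrier F \<Longrightarrow> Sha_P K l A (cls u) = cls (prefix_one u)"
  by (simp add: Sha_P_eq Sha_prefix_cls prefix_one_def)

lemma rota_baxter_Sha: "rota_baxter K l S (Sha_P K l A)"
proof (rule rota_baxterI[OF algebra_Sha Sha_P_linear])
  fix X Y assume "X \<in> carrier S" "Y \<in> carrier S"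
  then obtain u v where u: "u \<in> carrier F" "X = cls u" and v: "v \<in> carrier F" "Y = cls v"
    by (auto simp: Sha_carrier)
  let ?P = "prefix_one"
  have "?P u \<otimes>\<^bsub>F\<^esub> ?P v = ?P (u \<otimes>\<^bsub>F\<^esub> ?P v) \<oplus>\<^bsub>F\<^esub> ?P (v \<otimes>\<^bsub>F\<^esub> ?P u) \<oplus>\<^bsub>F\<^esub> l \<odot>\<^bsub>F\<^esub> ?P (u \<otimes>\<^bsub>F\<^esub> v)"
    using prefix_one_mult[OF u(1) v(1)] u(1) v(1) weight_closed F.m_comm[of v "?P u"]
    by (simp add: linear_mapD[OF prefix_one_linear])
  then show "Sha_P K l A X \<otimes>\<^bsub>S\<^esub> Sha_P K l A Y =
     Sha_P K l A (X \<otimes>\<^bsub>S\<^esub> Sha_P K l A Y) \<oplus>\<^bsub>S\<^esub> Sha_P K l A (Y \<otimes>\<^bsub>S\<^esub> Sha_P K l A X) \<oplus>\<^bsub>S\<^esub>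
     l \<odot>\<^bsub>S\<^esub> Sha_P K l A (X \<otimes>\<^bsub>S\<^esub> Y)"
    using u v weight_closed by (simp add: Sha_P_cls Sha_mult Sha_add Sha_smult)
qed

lemma tensor_Cons:
  assumes "a \<in> carrier A" "w \<in> words A"
  shows "tensor K l A (a # w) = Sha_eta K l A a \<otimes>\<^bsub>S\<^esub> Sha_P K l A (tensor K l A w)"
  using assms F_mult_singleton_word[of a "\<one>\<^bsub>A\<^esub>" w]
  by (simp add: Sha_eta_def Sha_P_cls prefix_one_word tensor_eq Sha_mult word_closed words_Cons)

lemma Sha_eta_hom: "Sha_eta K l A \<in> alg_hom K A S"
proof (rule alg_homI[OF algebra_A algebra_Sha])
  show "linear_map K A S (Sha_eta K l A)"
    by (rule linear_mapI)
       (use multilinearD(2,3)[OF tensor_multilinear, of "[]" "[]"]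
        in \<open>auto simp: Sha_eta_def words_def intro!: tensor_closed\<close>)
  show "Sha_eta K l A (a \<otimes>\<^bsub>A\<^esub> b) = Sha_eta K l A a \<otimes>\<^bsub>S\<^esub> Sha_eta K l A b"
    if "a \<in> carrier A" "b \<in> carrier A" for a b
    using that by (simp add: Sha_eta_def tensor_eq Sha_mult word_closed words_def F_mult_singleton_word)
  show "Sha_eta K l A \<one>\<^bsub>A\<^esub> = \<one>\<^bsub>S\<^esub>"
    by (simp add: Sha_eta_def tensor_eq Sha_one F_record_simps)
qed

text \<open>Uniqueness in the universal property: \<open>a\<^sub>0 \<otimes> \<dots> \<otimes> a\<^sub>n = \<eta>(a\<^sub>0) P(a\<^sub>1 \<otimes> \<dots> \<otimes> a\<^sub>n)\<close>, so the values on
  \<open>\<eta>(A)\<close> determine the values on all tensors by induction on the length.\<close>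

lemma rb_hom_Sha_eqI:
  assumes f: "f \<in> rb_hom K l S (Sha_P K l A) R P" and g: "g \<in> rb_hom K l S (Sha_P K l A) R P"
    and eta: "\<And>a. a \<in> carrier A \<Longrightarrow> f (Sha_eta K l A a) = g (Sha_eta K l A a)"
    and X: "X \<in> carrier S"
  shows "f X = g X"
proof (rule Sha_linear_eqI[OF _ _ _ _ X])
  note f' = alg_homD[OF rb_homD(3)[OF f]] and g' = alg_homD[OF rb_homD(3)[OF g]]
  show "module K R" using f'(2) by (rule algebra.axioms)
  show "linear_map K S R f" "linear_map K S R g" by fact+
  fix w assume "w \<in> words A"
  then show "f (tensor K l A w) = g (tensor K l A w)"
  proof (induction w)
    case (Cons a w)
    note a = alg_homD(4)[OF Sha_eta_hom, of a]
    show ?case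
    proof (cases "w = []")
      case True
      then show ?thesis using Cons.prems eta[of a] by (simp add: words_def Sha_eta_def)
    next
      case False
      with Cons.prems have w: "a \<in> carrier A" "w \<in> words A" by (auto simp: words_def)
      have "Sha_P K l A (tensor K l A w) \<in> carrier S"
        by (rule linear_mapD(1)[OF Sha_P_linear tensor_closed[OF w(2)]])
      then show ?thesis
        using Cons.IH[OF w(2)] eta[OF w(1)] a w
        by (simp add: tensor_Cons f'(5) g'(5) rb_homD(4)[OF f] rb_homD(4)[OF g] tensor_closed)
    qed
  qed (simp add: words_def)
qed

end

text \<open>The data of the existence part of the universal property: an algebra homomorphism \<open>f\<close> from \<open>A\<close> to
  a Rota-Baxter algebra \<open>(R, P)\<close>.\<close>

locale rb_target = weighted_algebra +
  fixes R P f
  assumes rb: "rota_baxter K l R P" and hom: "f \<in> alg_hom K A R"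
begin

sublocale R: algebra K R by (rule rota_baxterD(1)[OF rb])

abbreviation g where "g \<equiv> rb_word R P f"
abbreviation G where "G \<equiv> linear_extension K R g"

lemma rb_word_Cons: "w \<in> words A \<Longrightarrow> g (a # w) = f a \<otimes>\<^bsub>R\<^esub> P (g w)"
  by (cases w) (auto simp: words_def)

lemma rb_word_closed: "w \<in> words A \<Longrightarrow> g w \<in> carrier R"
proof (induction w)
  case (Cons a w)
  then show ?case
    using alg_homD(4)[OF hom] rota_baxterD(2)[OF rb]
    by (cases "w = []") (auto simp: rb_word_Cons words_Cons)
qed (simp add: words_def)

lemma rb_word_multilinear: "multilinear K A R g"
proof (rule multilinearI)
  fix us vs a assume us: "set us \<subseteq> carrier A" and vs: "set vs \<subseteq> carrier A" and a: "a \<in> carrier A"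
  note f = alg_homD[OF hom] and P = linear_mapD[OF rota_baxterD(3)[OF rb]]
  have vs': "vs = [] \<or> vs \<in> words A" using vs by (auto simp: words_def)
  note slot = slot_words[OF _ vs]
  {
    fix b assume b: "b \<in> carrier A"
    show "g (us @ (a \<oplus>\<^bsub>A\<^esub> b) # vs) = g (us @ a # vs) \<oplus>\<^bsub>R\<^esub> g (us @ b # vs)"
      using us
    proof (induction us)
      case Nil
      then show ?case using vs' a b by (auto simp: rb_word_Cons f R.l_distr rb_word_closed P)
    next
      case (Cons d us)
      then show ?case using a b by (simp add: rb_word_Cons slot f R.r_distr rb_word_closed P)
    qed
  next
    fix c assume c: "c \<in> carrier K"
    have smult_right: "x \<otimes>\<^bsub>R\<^esub> (c \<odot>\<^bsub>R\<^esub> y) = c \<odot>\<^bsub>R\<^esub> (x \<otimes>\<^bsub>R\<^esub> y)"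
      if "x \<in> carrier R" "y \<in> carrier R" for x y
      by (rule linear_mapD(3)[OF linear_map_mult_left[OF R.algebra_axioms _ linear_map_id]]) (use that c in auto)
    show "g (us @ (c \<odot>\<^bsub>A\<^esub> a) # vs) = c \<odot>\<^bsub>R\<^esub> g (us @ a # vs)"
      using us
    proof (induction us)
      case Nil
      then show ?case using vs' a c by (auto simp: rb_word_Cons f R.smult_assoc2 rb_word_closed P)
    next
      case (Cons d us)
      then show ?case using a c by (simp add: rb_word_Cons slot f smult_right rb_word_closed P)
    qed
  }
qed (rule rb_word_closed)

lemma rb_extension_linear: "linear_map K F R G"
  by (rule linear_extension_linear[OF R.module_axioms]) (auto simp: rb_word_closed)

lemma rb_extension_word: "w \<in> words A \<Longrightarrow> G (word K w) = g w"
  by (rule linear_extension_word[OF R.module_axioms]) (auto simp: rb_word_closed)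

lemma rb_extension_prefix_letter:
  assumes "a \<in> carrier A" "u \<in> carrier F"
  shows "G (prefix_letter K a u) = f a \<otimes>\<^bsub>R\<^esub> P (G u)"
  by (rule linear_map_F_eqI[OF R.module_axioms linear_map_comp[OF prefix_letter_linear rb_extension_linear]
        linear_map_mult_left[OF R.algebra_axioms _ linear_map_comp[OF rb_extension_linear rota_baxterD(3)[OF rb]]] _ assms(2)])
     (use assms(1) alg_homD(4)[OF hom] in \<open>simp_all add: prefix_letter_word rb_extension_word rb_word_Cons words_Cons\<close>)

lemma rb_extension_prefix_one:
  assumes "u \<in> carrier F"
  shows "G (prefix_one u) = P (G u)"
  using assms rb_extension_prefix_letter[of "\<one>\<^bsub>A\<^esub>" u] alg_homD(8)[OF hom] linear_mapD(1)[OF rb_extension_linear]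
    rota_baxterD(2)[OF rb]
  by (simp add: prefix_one_def)

text \<open>With \<open>p\<close> and \<open>q\<close> the images of the tails, induction turns the recursion for \<open>\<diamond>\<close> into
  \<open>f(a) f(b) P(p P(q) + P(p) q + l p q)\<close>, and the Rota-Baxter identity of \<open>P\<close> collapses this to
  \<open>f(a) P(p) f(b) P(q)\<close>.\<close>

lemma rb_extension_mult_words:
  "x \<in> words A \<Longrightarrow> y \<in> words A \<Longrightarrow> G (word K x \<otimes>\<^bsub>F\<^esub> word K y) = g x \<otimes>\<^bsub>R\<^esub> g y"
proof (induction "length x + length y" arbitrary: x y rule: less_induct)
  case less
  note f = alg_homD[OF hom] and P = linear_mapD[OF rota_baxterD(3)[OF rb]]
  have single: "G (word K [a] \<otimes>\<^bsub>F\<^esub> word K z) = g [a] \<otimes>\<^bsub>R\<^esub> g z" if "a \<in> carrier A" "z \<in> words A" for a z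
    using that(2)
  proof (cases rule: words_cases)
    case (1 b)
    then show ?thesis using that by (simp add: F_mult_singleton_word rb_extension_word words_def f)
  next
    case (2 b v)
    then show ?thesis
      using that by (simp add: F_mult_singleton_word rb_extension_word words_Cons rb_word_Cons f R.m_assoc rb_word_closed P)
  qed
  show ?case
  proof (cases "\<exists>a\<in>carrier A. x = [a] \<or> y = [a]")
    case True
    then obtain a where a: "a \<in> carrier A" "x = [a] \<or> y = [a]" by auto
    from a(2) show ?thesis
    proof
      assume "x = [a]"
      then show ?thesis using single a less.prems by simp
    next
      assume y: "y = [a]"
      have "word K x \<otimes>\<^bsub>F\<^esub> word K y = word K y \<otimes>\<^bsub>F\<^esub> word K x"
        using less.prems by (intro F_mult_comm word_closed)
      moreover have "g x \<otimes>\<^bsub>R\<^esub> g y = g y \<otimes>\<^bsub>R\<^esub> g x"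
        using less.prems by (intro R.m_comm rb_word_closed)
      ultimately show ?thesis using single[of a x] a less.prems y by simp
    qed
  next
    case False
    from less.prems(1) False obtain a x' where x: "x = a # x'" "a \<in> carrier A" "x' \<in> words A"
      by (cases rule: words_cases) auto
    from less.prems(2) False obtain b y' where y: "y = b # y'" "b \<in> carrier A" "y' \<in> words A"
      by (cases rule: words_cases) auto
    have one: "\<one>\<^bsub>A\<^esub> # x' \<in> words A" "\<one>\<^bsub>A\<^esub> # y' \<in> words A" using x y by (auto simp: words_Cons)
    have IH: "G (word K x' \<otimes>\<^bsub>F\<^esub> word K (\<one>\<^bsub>A\<^esub> # y')) = g x' \<otimes>\<^bsub>R\<^esub> g (\<one>\<^bsub>A\<^esub> # y')"
      "G (word K (\<one>\<^bsub>A\<^esub> # x') \<otimes>\<^bsub>F\<^esub> word K y') = g (\<one>\<^bsub>A\<^esub> # x') \<otimes>\<^bsub>R\<^esub> g y'"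
      "G (word K x' \<otimes>\<^bsub>F\<^esub> word K y') = g x' \<otimes>\<^bsub>R\<^esub> g y'"
      by (rule less.hyps; use x y one in simp)+
    let ?M = "(word K x' \<otimes>\<^bsub>F\<^esub> word K (\<one>\<^bsub>A\<^esub> # y')) \<oplus>\<^bsub>F\<^esub> (word K (\<one>\<^bsub>A\<^esub> # x') \<otimes>\<^bsub>F\<^esub> word K y')
       \<oplus>\<^bsub>F\<^esub> l \<odot>\<^bsub>F\<^esub> (word K x' \<otimes>\<^bsub>F\<^esub> word K y')"
    define p q where "p = g x'" and "q = g y'"
    have [simp]: "p \<in> carrier R" "q \<in> carrier R" using x y by (auto simp: p_def q_def rb_word_closed)
    note fc = f(4)[OF x(2)] f(4)[OF y(2)]
    have M: "?M \<in> carrier F"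
      using x y one weight_closed by (simp add: word_closed)
    have "G ?M = (p \<otimes>\<^bsub>R\<^esub> P q) \<oplus>\<^bsub>R\<^esub> (q \<otimes>\<^bsub>R\<^esub> P p) \<oplus>\<^bsub>R\<^esub> l \<odot>\<^bsub>R\<^esub> (p \<otimes>\<^bsub>R\<^esub> q)"
      using x y one weight_closed R.m_comm[of q "P p"]
      by (simp add: linear_mapD[OF rb_extension_linear] IH word_closed rb_word_Cons f P p_def[symmetric] q_def[symmetric])
    then have "P (G ?M) = P p \<otimes>\<^bsub>R\<^esub> P q"
      using rota_baxterD(4)[OF rb, of p q] weight_closed by (simp add: P)
    moreover have "word K x \<otimes>\<^bsub>F\<^esub> word K y = prefix_letter K (a \<otimes>\<^bsub>A\<^esub> b) ?M"
      using F_mult_prefix_prefix[OF x(2) y(2) word_closed[OF x(3)] word_closed[OF y(3)]] x y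
      by (simp add: prefix_letter_word prefix_one_word)
    ultimately have "G (word K x \<otimes>\<^bsub>F\<^esub> word K y) = (f a \<otimes>\<^bsub>R\<^esub> f b) \<otimes>\<^bsub>R\<^esub> (P p \<otimes>\<^bsub>R\<^esub> P q)"
      using rb_extension_prefix_letter[OF _ M, of "a \<otimes>\<^bsub>A\<^esub> b"] x y by (simp add: f)
    also have "\<dots> = g x \<otimes>\<^bsub>R\<^esub> g y"
      using x y fc by (simp add: rb_word_Cons p_def[symmetric] q_def[symmetric] P R.m_ac)
    finally show ?thesis .
  qed
qed

lemma rb_extension_mult:
  assumes "u \<in> carrier F" "v \<in> carrier F"
  shows "G (u \<otimes>\<^bsub>F\<^esub> v) = G u \<otimes>\<^bsub>R\<^esub> G v"
proof (rule F_bilinear_eqI[OF R.module_axioms _ _ _ _ _ assms])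
  note Gc = linear_mapD(1)[OF rb_extension_linear]
  show right: "linear_map K F R (\<lambda>v. G u \<otimes>\<^bsub>R\<^esub> G v)" if "u \<in> carrier F" for u
    by (rule linear_map_mult_left[OF R.algebra_axioms Gc[OF that] rb_extension_linear])
  show "linear_map K F R (\<lambda>u. G u \<otimes>\<^bsub>R\<^esub> G v)" if "v \<in> carrier F" for v
    using right[OF that] that Gc by (simp add: linear_map_def R.m_comm[of "G v"] Pi_iff)
  show "linear_map K F R (\<lambda>u. G (u \<otimes>\<^bsub>F\<^esub> v))" if "v \<in> carrier F" for v
    by (rule linear_map_comp[OF F_mult_linear_left[OF that] rb_extension_linear])
  show "linear_map K F R (\<lambda>v. G (u \<otimes>\<^bsub>F\<^esub> v))" if "u \<in> carrier F" for u
    by (rule linear_map_comp[OF F_mult_linear_right[OF that] rb_extension_linear])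
qed (simp add: rb_extension_mult_words rb_extension_word)

lemma rb_lift_cls: "u \<in> carrier F \<Longrightarrow> rb_lift K R P f (cls u) = G u"
  unfolding rb_lift_def by (rule tensor_lift_cls[OF R.module_axioms rb_word_multilinear])

lemma rb_lift_tensor: "w \<in> words A \<Longrightarrow> rb_lift K R P f (tensor K l A w) = g w"
  by (simp add: tensor_eq rb_lift_cls word_closed rb_extension_word)

lemma rb_lift_eta: "a \<in> carrier A \<Longrightarrow> rb_lift K R P f (Sha_eta K l A a) = f a"
  by (simp add: Sha_eta_def rb_lift_tensor words_def)

lemma rb_lift_hom: "rb_lift K R P f \<in> rb_hom K l S (Sha_P K l A) R P"
proof (rule rb_homI[OF rota_baxter_Sha rb])
  show "rb_lift K R P f \<in> alg_hom K S R"
  proof (rule alg_homI[OF algebra_Sha R.algebra_axioms])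
    show "linear_map K S R (rb_lift K R P f)"
      unfolding rb_lift_def by (rule tensor_lift_linear[OF R.module_axioms rb_word_multilinear])
    show "rb_lift K R P f (X \<otimes>\<^bsub>S\<^esub> Y) = rb_lift K R P f X \<otimes>\<^bsub>R\<^esub> rb_lift K R P f Y"
      if "X \<in> carrier S" "Y \<in> carrier S" for X Y
      using that by (auto simp: Sha_carrier Sha_mult rb_lift_cls rb_extension_mult)
    show "rb_lift K R P f \<one>\<^bsub>S\<^esub> = \<one>\<^bsub>R\<^esub>"
      using rb_lift_eta[OF A.one_closed] alg_homD(8)[OF Sha_eta_hom] alg_homD(8)[OF hom] by simp
  qed
  show "rb_lift K R P f (Sha_P K l A X) = P (rb_lift K R P f X)" if "X \<in> carrier S" for X
    using that by (auto simp: Sha_carrier Sha_P_cls rb_lift_cls rb_extension_prefix_one)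
qed

end

section \<open>The algebra of sequences with the Hurwitz product\<close>

definition shift :: "(nat \<Rightarrow> 'a) \<Rightarrow> nat \<Rightarrow> 'a" where
  "shift f = (\<lambda>n. f (Suc n))"

context weighted_algebra
begin

abbreviation H where "H \<equiv> Hur K l A"

lemma Hur_carrier_iff: "f \<in> carrier H \<longleftrightarrow> (\<forall>n. f n \<in> carrier A)"
  by (auto simp: Hur_def)

lemma Hur_value [simp]: "f \<in> carrier H \<Longrightarrow> f n \<in> carrier A"
  by (simp add: Hur_carrier_iff)

lemma Hur_record:
  "(f \<oplus>\<^bsub>H\<^esub> g) n = f n \<oplus>\<^bsub>A\<^esub> g n" "(c \<odot>\<^bsub>H\<^esub> f) n = c \<odot>\<^bsub>A\<^esub> f n" "\<zero>\<^bsub>H\<^esub> n = \<zero>\<^bsub>A\<^esub>"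
  "\<one>\<^bsub>H\<^esub> n = (if n = 0 then \<one>\<^bsub>A\<^esub> else \<zero>\<^bsub>A\<^esub>)"
  "(f \<otimes>\<^bsub>H\<^esub> g) n = (\<Oplus>\<^bsub>A\<^esub>k\<in>{0..n}. \<Oplus>\<^bsub>A\<^esub>j\<in>{0..n - k}.
       [((n choose k) * ((n - k) choose j))] \<cdot>\<^bsub>A\<^esub> ((l [^]\<^bsub>K\<^esub> k) \<odot>\<^bsub>A\<^esub> (f (n - j) \<otimes>\<^bsub>A\<^esub> g (k + j))))"
  by (simp_all only: Hur_def ring_record_simps module.simps)

lemma shift_closed [simp]: "f \<in> carrier H \<Longrightarrow> shift f \<in> carrier H"
  by (simp add: Hur_carrier_iff shift_def)

lemma shift_add: "shift (f \<oplus>\<^bsub>H\<^esub> g) = shift f \<oplus>\<^bsub>H\<^esub> shift g"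
  by (simp add: fun_eq_iff shift_def Hur_record)

lemma shift_smult: "shift (c \<odot>\<^bsub>H\<^esub> f) = c \<odot>\<^bsub>H\<^esub> shift f"
  by (simp add: fun_eq_iff shift_def Hur_record)

lemma Hur_term_closed:
  assumes "f \<in> carrier H" "g \<in> carrier H"
  shows "[(c::nat)] \<cdot>\<^bsub>A\<^esub> ((l [^]\<^bsub>K\<^esub> (k::nat)) \<odot>\<^bsub>A\<^esub> (f i \<otimes>\<^bsub>A\<^esub> g j)) \<in> carrier A"
  using assms weight_closed by (intro A.M.add.nat_pow_closed A.smult_closed) auto

lemma Hur_mult_closed [simp]: "f \<in> carrier H \<Longrightarrow> g \<in> carrier H \<Longrightarrow> f \<otimes>\<^bsub>H\<^esub> g \<in> carrier H"
  unfolding Hur_carrier_iff Hur_record(5)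
  using weight_closed by (auto intro!: A.M.finsum_closed A.M.add.nat_pow_closed A.smult_closed)

text \<open>The summation range can be enlarged to any rectangle because the additional binomial coefficients
  vanish. This makes the sums for \<open>n\<close> and \<open>Suc n\<close> comparable.\<close>

lemma Hur_mult_rectangle:
  assumes f: "f \<in> carrier H" and g: "g \<in> carrier H" and N: "n \<le> p" "n \<le> q"
  shows "(f \<otimes>\<^bsub>H\<^esub> g) n = (\<Oplus>\<^bsub>A\<^esub>k\<in>{..p}. \<Oplus>\<^bsub>A\<^esub>j\<in>{..q}.
       [((n choose k) * ((n - k) choose j))] \<cdot>\<^bsub>A\<^esub> ((l [^]\<^bsub>K\<^esub> k) \<odot>\<^bsub>A\<^esub> (f (n - j) \<otimes>\<^bsub>A\<^esub> g (k + j))))"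
  unfolding Hur_record
proof (rule A.M.add.finprod_mono_neutral_cong_left)
  show "(\<Oplus>\<^bsub>A\<^esub>j\<in>{..q}. [((n choose k) * ((n - k) choose j))] \<cdot>\<^bsub>A\<^esub> ((l [^]\<^bsub>K\<^esub> k) \<odot>\<^bsub>A\<^esub> (f (n - j) \<otimes>\<^bsub>A\<^esub> g (k + j)))) = \<zero>\<^bsub>A\<^esub>"
    if "k \<in> {..p} - {0..n}" for k
    using that by (simp add: binomial_eq_0)
  show "(\<Oplus>\<^bsub>A\<^esub>j\<in>{0..n - k}. [((n choose k) * ((n - k) choose j))] \<cdot>\<^bsub>A\<^esub> ((l [^]\<^bsub>K\<^esub> k) \<odot>\<^bsub>A\<^esub> (f (n - j) \<otimes>\<^bsub>A\<^esub> g (k + j))))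
      = (\<Oplus>\<^bsub>A\<^esub>j\<in>{..q}. [((n choose k) * ((n - k) choose j))] \<cdot>\<^bsub>A\<^esub> ((l [^]\<^bsub>K\<^esub> k) \<odot>\<^bsub>A\<^esub> (f (n - j) \<otimes>\<^bsub>A\<^esub> g (k + j))))"
    if "k \<in> {0..n}" for k
    by (rule A.M.add.finprod_mono_neutral_cong_left)
       (use that N f g in \<open>auto simp: binomial_eq_0 intro!: Hur_term_closed\<close>)
qed (use N f g in \<open>auto intro!: A.M.finsum_closed Hur_term_closed\<close>)

text \<open>The recursion of trinomial coefficients: \<open>(n choose k) ((n - k) choose j)\<close> counts the ways to label
  \<open>n\<close> places with \<open>k\<close> labels of one kind and \<open>j\<close> of another, and the last of \<open>Suc n\<close> places carries
  neither label, the second or the first.\<close>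

lemma trinomial_Suc:
  "(Suc n choose k) * ((Suc n - k) choose j) =
    (n choose k) * ((n - k) choose j) + (if j = 0 then 0 else (n choose k) * ((n - k) choose (j - 1)))
    + (if k = 0 then 0 else (n choose (k - 1)) * ((n - (k - 1)) choose j))"
proof -
  have "(n choose k) * ((Suc n - k) choose j) =
     (n choose k) * ((n - k) choose j) + (if j = 0 then 0 else (n choose k) * ((n - k) choose (j - 1)))"
  proof (cases "k \<le> n")
    case True
    then show ?thesis by (cases j) (auto simp: Suc_diff_le algebra_simps)
  qed (simp add: binomial_eq_0)
  then show ?thesis by (cases k) (auto simp: algebra_simps)
qed

text \<open>The shift is a differential of weight \<open>l\<close>. The three terms correspond to the three summands of
  the trinomial recursion.\<close>

lemma Hur_mult_Suc:
  assumes f: "f \<in> carrier H" and g: "g \<in> carrier H"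
  shows "(f \<otimes>\<^bsub>H\<^esub> g) (Suc n) = (shift f \<otimes>\<^bsub>H\<^esub> g) n \<oplus>\<^bsub>A\<^esub> (f \<otimes>\<^bsub>H\<^esub> shift g) n \<oplus>\<^bsub>A\<^esub> l \<odot>\<^bsub>A\<^esub> (shift f \<otimes>\<^bsub>H\<^esub> shift g) n"
proof -
  let ?c = "\<lambda>k j. (n choose k) * ((n - k) choose j)"
  let ?X = "\<lambda>k j. (l [^]\<^bsub>K\<^esub> k) \<odot>\<^bsub>A\<^esub> (f (Suc n - j) \<otimes>\<^bsub>A\<^esub> g (k + j))"
  let ?a = "\<lambda>k j. [(?c k j)] \<cdot>\<^bsub>A\<^esub> ?X k j"
  let ?b = "\<lambda>k j. [(if j = 0 then 0 else ?c k (j - 1))] \<cdot>\<^bsub>A\<^esub> ?X k j"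
  let ?d = "\<lambda>k j. [(if k = 0 then 0 else ?c (k - 1) j)] \<cdot>\<^bsub>A\<^esub> ?X k j"
  let ?I = "{..Suc n}"
  have t [simp]: "[(c::nat)] \<cdot>\<^bsub>A\<^esub> ?X k j \<in> carrier A" for c k j by (rule Hur_term_closed[OF f g])
  have X [simp]: "?X k j \<in> carrier A" for k j using f g weight_closed by auto
  have split: "[((Suc n choose k) * ((Suc n - k) choose j))] \<cdot>\<^bsub>A\<^esub> ?X k j = ?a k j \<oplus>\<^bsub>A\<^esub> ?b k j \<oplus>\<^bsub>A\<^esub> ?d k j" for k j
    unfolding trinomial_Suc by (simp only: A.M.add.nat_pow_mult[symmetric] X)
  have "(f \<otimes>\<^bsub>H\<^esub> g) (Suc n) = (\<Oplus>\<^bsub>A\<^esub>k\<in>?I. \<Oplus>\<^bsub>A\<^esub>j\<in>?I. ?a k j \<oplus>\<^bsub>A\<^esub> ?b k j \<oplus>\<^bsub>A\<^esub> ?d k j)"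
    unfolding Hur_mult_rectangle[OF f g order_refl order_refl] split ..
  also have "\<dots> = (\<Oplus>\<^bsub>A\<^esub>k\<in>?I. \<Oplus>\<^bsub>A\<^esub>j\<in>?I. ?a k j) \<oplus>\<^bsub>A\<^esub> (\<Oplus>\<^bsub>A\<^esub>k\<in>?I. \<Oplus>\<^bsub>A\<^esub>j\<in>?I. ?b k j)
     \<oplus>\<^bsub>A\<^esub> (\<Oplus>\<^bsub>A\<^esub>k\<in>?I. \<Oplus>\<^bsub>A\<^esub>j\<in>?I. ?d k j)"
    by (simp only: A.M.finsum_addf A.M.finsum_closed A.M.a_closed Pi_iff t simp_thms Ball_def)
  also have "(\<Oplus>\<^bsub>A\<^esub>k\<in>?I. \<Oplus>\<^bsub>A\<^esub>j\<in>?I. ?a k j) = (shift f \<otimes>\<^bsub>H\<^esub> g) n"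
  proof -
    have "?a k j = [(?c k j)] \<cdot>\<^bsub>A\<^esub> ((l [^]\<^bsub>K\<^esub> k) \<odot>\<^bsub>A\<^esub> (shift f (n - j) \<otimes>\<^bsub>A\<^esub> g (k + j)))" for k j
    proof (cases "j \<le> n")
      case True
      then show ?thesis by (simp only: shift_def Suc_diff_le)
    qed (simp add: binomial_eq_0)
    then show ?thesis
      by (simp only: Hur_mult_rectangle[OF shift_closed[OF f] g, of n "Suc n" "Suc n"] le_SucI order_refl)
  qed
  also have "(\<Oplus>\<^bsub>A\<^esub>k\<in>?I. \<Oplus>\<^bsub>A\<^esub>j\<in>?I. ?b k j) = (f \<otimes>\<^bsub>H\<^esub> shift g) n"
  proof -
    have "(\<Oplus>\<^bsub>A\<^esub>j\<in>?I. ?b k j) =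
       (\<Oplus>\<^bsub>A\<^esub>j\<in>{..n}. [(?c k j)] \<cdot>\<^bsub>A\<^esub> ((l [^]\<^bsub>K\<^esub> k) \<odot>\<^bsub>A\<^esub> (f (n - j) \<otimes>\<^bsub>A\<^esub> shift g (k + j))))" for k
    proof -
      have "(\<Oplus>\<^bsub>A\<^esub>j\<in>?I. ?b k j) = (\<Oplus>\<^bsub>A\<^esub>j\<in>{..n}. ?b k (Suc j)) \<oplus>\<^bsub>A\<^esub> ?b k 0"
        by (rule A.M.finsum_Suc2) simp
      also have "?b k 0 = \<zero>\<^bsub>A\<^esub>" by simp
      also have "(\<Oplus>\<^bsub>A\<^esub>j\<in>{..n}. ?b k (Suc j)) \<oplus>\<^bsub>A\<^esub> \<zero>\<^bsub>A\<^esub> = (\<Oplus>\<^bsub>A\<^esub>j\<in>{..n}. ?b k (Suc j))"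
        by (rule A.M.r_zero, rule A.M.finsum_closed) (simp only: Pi_iff t Ball_def simp_thms)
      finally show ?thesis by (simp add: shift_def)
    qed
    then show ?thesis
      by (simp only: Hur_mult_rectangle[OF f shift_closed[OF g], of n "Suc n" n] le_SucI order_refl)
  qed
  also have "(\<Oplus>\<^bsub>A\<^esub>k\<in>?I. \<Oplus>\<^bsub>A\<^esub>j\<in>?I. ?d k j) = l \<odot>\<^bsub>A\<^esub> (shift f \<otimes>\<^bsub>H\<^esub> shift g) n"
  proof -
    let ?Y = "\<lambda>k j. [(?c k j)] \<cdot>\<^bsub>A\<^esub> ((l [^]\<^bsub>K\<^esub> k) \<odot>\<^bsub>A\<^esub> (shift f (n - j) \<otimes>\<^bsub>A\<^esub> shift g (k + j)))"
    have Y [simp]: "?Y k j \<in> carrier A" for k j by (rule Hur_term_closed) (use f g in simp_all)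
    have lin: "l \<odot>\<^bsub>A\<^esub> ([(m::nat)] \<cdot>\<^bsub>A\<^esub> x) = [m] \<cdot>\<^bsub>A\<^esub> (l \<odot>\<^bsub>A\<^esub> x)" if "x \<in> carrier A" for m x
      using that weight_closed by (induction m) (auto simp: A.smult_r_distr)
    have step: "?d (Suc k) j = l \<odot>\<^bsub>A\<^esub> ?Y k j" for k j
    proof (cases "j \<le> n")
      case True
      let ?z = "f (Suc (n - j)) \<otimes>\<^bsub>A\<^esub> g (Suc (k + j))"
      have z: "?z \<in> carrier A" using f g by simp
      have "l [^]\<^bsub>K\<^esub> Suc k \<odot>\<^bsub>A\<^esub> ?z = l \<odot>\<^bsub>A\<^esub> (l [^]\<^bsub>K\<^esub> k \<odot>\<^bsub>A\<^esub> ?z)"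
        using z weight_closed A.R.m_comm[of l "l [^]\<^bsub>K\<^esub> k"] by (simp add: A.smult_assoc1[symmetric])
      then show ?thesis
        using True z weight_closed by (simp add: lin shift_def Suc_diff_le)
    next
      case False
      then show ?thesis using weight_closed by (simp add: binomial_eq_0)
    qed
    have "(\<Oplus>\<^bsub>A\<^esub>k\<in>?I. \<Oplus>\<^bsub>A\<^esub>j\<in>?I. ?d k j)
      = (\<Oplus>\<^bsub>A\<^esub>k\<in>{..n}. \<Oplus>\<^bsub>A\<^esub>j\<in>?I. ?d (Suc k) j) \<oplus>\<^bsub>A\<^esub> (\<Oplus>\<^bsub>A\<^esub>j\<in>?I. ?d 0 j)"
      by (rule A.M.finsum_Suc2, rule Pi_I, rule A.M.finsum_closed, rule Pi_I, rule t)
    also have "(\<Oplus>\<^bsub>A\<^esub>j\<in>?I. ?d 0 j) = \<zero>\<^bsub>A\<^esub>" by simp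
    also have "(\<Oplus>\<^bsub>A\<^esub>k\<in>{..n}. \<Oplus>\<^bsub>A\<^esub>j\<in>?I. ?d (Suc k) j) = (\<Oplus>\<^bsub>A\<^esub>k\<in>{..n}. \<Oplus>\<^bsub>A\<^esub>j\<in>?I. l \<odot>\<^bsub>A\<^esub> ?Y k j)"
      unfolding step ..
    also have "\<dots> = (\<Oplus>\<^bsub>A\<^esub>k\<in>{..n}. l \<odot>\<^bsub>A\<^esub> (\<Oplus>\<^bsub>A\<^esub>j\<in>?I. ?Y k j))"
      by (simp only: A.finsum_smult_ldistr weight_closed Pi_iff Y Ball_def simp_thms finite_atMost)
    also have "\<dots> = l \<odot>\<^bsub>A\<^esub> (\<Oplus>\<^bsub>A\<^esub>k\<in>{..n}. \<Oplus>\<^bsub>A\<^esub>j\<in>?I. ?Y k j)"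
      by (rule A.finsum_smult_ldistr[symmetric], rule finite_atMost, rule weight_closed,
          rule Pi_I, rule A.M.finsum_closed, rule Pi_I, rule Y)
    also have "(\<Oplus>\<^bsub>A\<^esub>k\<in>{..n}. \<Oplus>\<^bsub>A\<^esub>j\<in>?I. ?Y k j) = (shift f \<otimes>\<^bsub>H\<^esub> shift g) n"
      using f g by (simp only: Hur_mult_rectangle[of "shift f" "shift g" n n "Suc n"] le_SucI order_refl shift_closed)
    also have "l \<odot>\<^bsub>A\<^esub> (shift f \<otimes>\<^bsub>H\<^esub> shift g) n \<oplus>\<^bsub>A\<^esub> \<zero>\<^bsub>A\<^esub> = l \<odot>\<^bsub>A\<^esub> (shift f \<otimes>\<^bsub>H\<^esub> shift g) n"
      using f g weight_closed by simp
    finally show ?thesis .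
  qed
  finally show ?thesis .
qed

lemma Hur_mult_0: "f \<in> carrier H \<Longrightarrow> g \<in> carrier H \<Longrightarrow> (f \<otimes>\<^bsub>H\<^esub> g) 0 = f 0 \<otimes>\<^bsub>A\<^esub> g 0"
  by (simp add: Hur_record)

lemma Hur_add_closed [simp]: "f \<in> carrier H \<Longrightarrow> g \<in> carrier H \<Longrightarrow> f \<oplus>\<^bsub>H\<^esub> g \<in> carrier H"
  by (simp add: Hur_carrier_iff Hur_record)

lemma Hur_smult_closed [simp]: "c \<in> carrier K \<Longrightarrow> f \<in> carrier H \<Longrightarrow> c \<odot>\<^bsub>H\<^esub> f \<in> carrier H"
  by (simp add: Hur_carrier_iff Hur_record)

lemma shift_mult:
  "f \<in> carrier H \<Longrightarrow> g \<in> carrier H \<Longrightarrow>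
    shift (f \<otimes>\<^bsub>H\<^esub> g) = (shift f \<otimes>\<^bsub>H\<^esub> g) \<oplus>\<^bsub>H\<^esub> (f \<otimes>\<^bsub>H\<^esub> shift g) \<oplus>\<^bsub>H\<^esub> l \<odot>\<^bsub>H\<^esub> (shift f \<otimes>\<^bsub>H\<^esub> shift g)"
  by (simp add: fun_eq_iff shift_def[of "f \<otimes>\<^bsub>H\<^esub> g"] Hur_record(1,2) Hur_mult_Suc)

text \<open>Here and below, an identity between products of sequences holds at \<open>0\<close> by the corresponding
  identity in \<open>A\<close>; at \<open>Suc n\<close> both sides expand by the shift rule into the same instances of the
  identity at \<open>n\<close>, for shifted and unshifted arguments.\<close>

lemma Hur_mult_comm:
  assumes "f \<in> carrier H" "g \<in> carrier H"
  shows "f \<otimes>\<^bsub>H\<^esub> g = g \<otimes>\<^bsub>H\<^esub> f"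
proof
  fix n show "(f \<otimes>\<^bsub>H\<^esub> g) n = (g \<otimes>\<^bsub>H\<^esub> f) n"
    using assms
  proof (induction n arbitrary: f g)
    case 0
    then show ?case by (simp add: Hur_mult_0 A.m_comm)
  next
    case (Suc n)
    have "(shift f \<otimes>\<^bsub>H\<^esub> g) n = (g \<otimes>\<^bsub>H\<^esub> shift f) n" "(f \<otimes>\<^bsub>H\<^esub> shift g) n = (shift g \<otimes>\<^bsub>H\<^esub> f) n"
      "(shift f \<otimes>\<^bsub>H\<^esub> shift g) n = (shift g \<otimes>\<^bsub>H\<^esub> shift f) n"
      using Suc by simp_all
    then show ?case using Suc.prems by (simp add: Hur_mult_Suc A.M.a_comm)
  qed
qed

lemma Hur_l_distr:
  assumes "f \<in> carrier H" "g \<in> carrier H" "h \<in> carrier H"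
  shows "(f \<oplus>\<^bsub>H\<^esub> g) \<otimes>\<^bsub>H\<^esub> h = (f \<otimes>\<^bsub>H\<^esub> h) \<oplus>\<^bsub>H\<^esub> (g \<otimes>\<^bsub>H\<^esub> h)"
proof
  fix n show "((f \<oplus>\<^bsub>H\<^esub> g) \<otimes>\<^bsub>H\<^esub> h) n = ((f \<otimes>\<^bsub>H\<^esub> h) \<oplus>\<^bsub>H\<^esub> (g \<otimes>\<^bsub>H\<^esub> h)) n"
    using assms
  proof (induction n arbitrary: f g h)
    case 0
    then show ?case by (simp add: Hur_mult_0) (simp add: Hur_record(1) A.l_distr Hur_mult_0)
  next
    case (Suc n)
    then show ?case
      using weight_closed
      by (simp add: Hur_mult_Suc shift_add) (simp add: Hur_record(1) Hur_mult_Suc A.smult_r_distr A.M.a_ac)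
  qed
qed

lemma Hur_smult_mult:
  assumes "c \<in> carrier K" "f \<in> carrier H" "g \<in> carrier H"
  shows "(c \<odot>\<^bsub>H\<^esub> f) \<otimes>\<^bsub>H\<^esub> g = c \<odot>\<^bsub>H\<^esub> (f \<otimes>\<^bsub>H\<^esub> g)"
proof
  fix n show "((c \<odot>\<^bsub>H\<^esub> f) \<otimes>\<^bsub>H\<^esub> g) n = (c \<odot>\<^bsub>H\<^esub> (f \<otimes>\<^bsub>H\<^esub> g)) n"
    using assms(2,3)
  proof (induction n arbitrary: f g)
    case 0
    then show ?case using assms(1) by (simp add: Hur_mult_0) (simp add: Hur_record(2) A.smult_assoc2 Hur_mult_0)
  next
    case (Suc n)
    then show ?case
      using weight_closed assms(1)
      by (simp add: Hur_mult_Suc shift_smult)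
        (simp add: Hur_record(2) Hur_mult_Suc A.smult_r_distr A.smult_assoc1[symmetric] A.R.m_comm)
  qed
qed

lemma Hur_mult_assoc:
  assumes "f \<in> carrier H" "g \<in> carrier H" "h \<in> carrier H"
  shows "(f \<otimes>\<^bsub>H\<^esub> g) \<otimes>\<^bsub>H\<^esub> h = f \<otimes>\<^bsub>H\<^esub> (g \<otimes>\<^bsub>H\<^esub> h)"
proof
  have r_distr: "f \<otimes>\<^bsub>H\<^esub> (g \<oplus>\<^bsub>H\<^esub> h) = (f \<otimes>\<^bsub>H\<^esub> g) \<oplus>\<^bsub>H\<^esub> (f \<otimes>\<^bsub>H\<^esub> h)"
    if "f \<in> carrier H" "g \<in> carrier H" "h \<in> carrier H" for f g h
    using that Hur_l_distr[of g h f] by (simp add: Hur_mult_comm[of f])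
  have smult_right: "f \<otimes>\<^bsub>H\<^esub> (l \<odot>\<^bsub>H\<^esub> g) = l \<odot>\<^bsub>H\<^esub> (f \<otimes>\<^bsub>H\<^esub> g)"
    if "f \<in> carrier H" "g \<in> carrier H" for f g
    using that weight_closed Hur_smult_mult[of l g f] by (simp add: Hur_mult_comm[of f])
  fix n show "((f \<otimes>\<^bsub>H\<^esub> g) \<otimes>\<^bsub>H\<^esub> h) n = (f \<otimes>\<^bsub>H\<^esub> (g \<otimes>\<^bsub>H\<^esub> h)) n"
    using assms
  proof (induction n arbitrary: f g h)
    case 0
    then show ?case by (simp add: Hur_mult_0 A.m_assoc)
  next
    case (Suc n)
    then show ?case
      using weight_closed
      by (simp add: Hur_mult_Suc shift_mult Hur_l_distr r_distr Hur_smult_mult smult_right)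
        (simp add: Hur_record(1,2) Hur_mult_Suc A.smult_r_distr A.M.a_ac)
  qed
qed

lemma Hur_one_mult:
  assumes "f \<in> carrier H"
  shows "\<one>\<^bsub>H\<^esub> \<otimes>\<^bsub>H\<^esub> f = f"
proof
  have one: "\<one>\<^bsub>H\<^esub> \<in> carrier H" and zero: "\<zero>\<^bsub>H\<^esub> \<in> carrier H"
    by (auto simp: Hur_carrier_iff Hur_record)
  \<comment> \<open>the shift of the unit is zero, so only the term that keeps the unit survives\<close>
  have "\<zero>\<^bsub>H\<^esub> = \<zero>\<^bsub>K\<^esub> \<odot>\<^bsub>H\<^esub> \<zero>\<^bsub>H\<^esub>" by (simp add: fun_eq_iff Hur_record)
  then have zero_mult: "(\<zero>\<^bsub>H\<^esub> \<otimes>\<^bsub>H\<^esub> g) n = \<zero>\<^bsub>A\<^esub>" if "g \<in> carrier H" for g n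
    using that zero Hur_smult_mult[of "\<zero>\<^bsub>K\<^esub>" "\<zero>\<^bsub>H\<^esub>" g] by (metis A.R.zero_closed A.smult_l_null Hur_mult_closed Hur_record(2) Hur_value)
  have s: "shift \<one>\<^bsub>H\<^esub> = \<zero>\<^bsub>H\<^esub>" by (simp add: fun_eq_iff shift_def Hur_record)
  fix n show "(\<one>\<^bsub>H\<^esub> \<otimes>\<^bsub>H\<^esub> f) n = f n"
    using assms
  proof (induction n arbitrary: f)
    case 0
    then show ?case using one by (simp add: Hur_mult_0) (simp add: Hur_record(4))
  next
    case (Suc n)
    have "(\<one>\<^bsub>H\<^esub> \<otimes>\<^bsub>H\<^esub> shift f) n = shift f n" by (rule Suc.IH) (use Suc.prems in simp)
    then have "(\<one>\<^bsub>H\<^esub> \<otimes>\<^bsub>H\<^esub> shift f) n = f (Suc n)" by (simp only: shift_def)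
    then show ?case using Suc.prems one weight_closed by (simp add: Hur_mult_Suc s zero_mult)
  qed
qed

lemma algebra_Hur: "algebra K H"
proof (rule algebraI)
  show "cring H"
  proof (rule cringI)
    show "abelian_group H"
    proof (rule abelian_groupI)
      fix f assume f: "f \<in> carrier H"
      show "\<exists>g\<in>carrier H. g \<oplus>\<^bsub>H\<^esub> f = \<zero>\<^bsub>H\<^esub>"
        by (rule bexI[of _ "\<lambda>n. \<ominus>\<^bsub>A\<^esub> f n"])
           (use f in \<open>auto simp: fun_eq_iff Hur_record Hur_carrier_iff A.M.l_neg\<close>)
    qed (auto simp: fun_eq_iff Hur_record Hur_carrier_iff A.M.a_ac)
    show "comm_monoid H"
    proof (rule comm_monoidI)
      show "\<one>\<^bsub>H\<^esub> \<in> carrier H" by (auto simp: Hur_carrier_iff Hur_record)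
    qed (simp_all add: Hur_mult_assoc Hur_one_mult, rule Hur_mult_comm)
  qed (rule Hur_l_distr)
qed (auto simp: A.R_cring Hur_smult_mult,
     auto simp: fun_eq_iff Hur_record A.smult_l_distr A.smult_r_distr A.smult_assoc1)

lemma weighted_algebra_Hur: "weighted_algebra K H l"
  by (rule weighted_algebra.intro[OF algebra_Hur weight_closed])

lemma weighted_algebra_Sha: "weighted_algebra K S l"
  by (rule weighted_algebra.intro[OF algebra_Sha weight_closed])

lemma Hur_eps_hom: "Hur_eps \<in> alg_hom K H A"
  by (rule alg_homI[OF algebra_Hur algebra_A])
     (auto simp: Hur_eps_def Hur_mult_0 Hur_record linear_map_def)

text \<open>The \<open>m\<close>-th row of \<open>\<delta>(f)\<close> is the \<open>m\<close>-fold shift of \<open>f\<close>, and \<open>\<delta>\<close> commutes with shifts, so induction on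
  the row reduces the claim to the shift rule.\<close>

lemma Hur_delta_mult:
  assumes "f \<in> carrier H" "g \<in> carrier H"
  shows "Hur_delta (f \<otimes>\<^bsub>H\<^esub> g) = Hur_delta f \<otimes>\<^bsub>Hur K l H\<^esub> Hur_delta g"
proof
  interpret H: weighted_algebra K H l by (rule weighted_algebra_Hur)
  fix m show "Hur_delta (f \<otimes>\<^bsub>H\<^esub> g) m = (Hur_delta f \<otimes>\<^bsub>Hur K l H\<^esub> Hur_delta g) m"
    using assms
  proof (induction m arbitrary: f g)
    case 0
    then have "Hur_delta f \<in> carrier (Hur K l H)" "Hur_delta g \<in> carrier (Hur K l H)"
      by (auto simp: H.Hur_carrier_iff Hur_carrier_iff Hur_delta_def)
    then show ?case by (simp add: H.Hur_mult_0) (simp add: Hur_delta_def)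
  next
    case (Suc m)
    then have d: "Hur_delta f \<in> carrier (Hur K l H)" "Hur_delta g \<in> carrier (Hur K l H)"
      by (auto simp: H.Hur_carrier_iff Hur_carrier_iff Hur_delta_def)
    have s: "shift (Hur_delta h) = Hur_delta (shift h)" for h :: "nat \<Rightarrow> 'b"
      by (simp add: shift_def Hur_delta_def fun_eq_iff)
    have add: "Hur_delta (u \<oplus>\<^bsub>H\<^esub> v) m = Hur_delta u m \<oplus>\<^bsub>H\<^esub> Hur_delta v m"
      "Hur_delta (c \<odot>\<^bsub>H\<^esub> u) m = c \<odot>\<^bsub>H\<^esub> Hur_delta u m" for u v c
      by (simp_all add: Hur_delta_def fun_eq_iff Hur_record)
    have "Hur_delta (f \<otimes>\<^bsub>H\<^esub> g) (Suc m) = Hur_delta (shift (f \<otimes>\<^bsub>H\<^esub> g)) m"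
      by (simp add: shift_def Hur_delta_def)
    also have "\<dots> = (Hur_delta f \<otimes>\<^bsub>Hur K l H\<^esub> Hur_delta g) (Suc m)"
      using Suc d by (simp add: shift_mult add H.Hur_mult_Suc s)
    finally show ?case .
  qed
qed

lemma Hur_delta_hom: "Hur_delta \<in> alg_hom K H (Hur K l H)"
proof -
  interpret H: weighted_algebra K H l by (rule weighted_algebra_Hur)
  show ?thesis
  proof (rule alg_homI[OF algebra_Hur H.algebra_Hur])
    show "Hur_delta (f \<otimes>\<^bsub>H\<^esub> g) = Hur_delta f \<otimes>\<^bsub>Hur K l H\<^esub> Hur_delta g"
      if "f \<in> carrier H" "g \<in> carrier H" for f g
      using that by (rule Hur_delta_mult)
    show "linear_map K H (Hur K l H) Hur_delta"
      by (rule linear_mapI) (auto simp: Hur_carrier_iff H.Hur_carrier_iff Hur_delta_def fun_eq_iff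
          Hur_record(1,2) H.Hur_record(1,2))
    show "Hur_delta \<one>\<^bsub>H\<^esub> = \<one>\<^bsub>Hur K l H\<^esub>"
      by (auto simp: fun_eq_iff Hur_delta_def Hur_record(3,4) H.Hur_record(4))
  qed
qed

lemma shift_tilde: "shift (tilde P f) = f"
  by (simp add: fun_eq_iff shift_def tilde_def)

lemma tilde_0: "tilde P f 0 = P (f 0)"
  by (simp add: tilde_def)

text \<open>The shift is a left inverse of \<open>tilde P\<close>. Under the shift, the Rota-Baxter identity becomes the shift
  rule for the product of \<open>tilde P f\<close> and \<open>tilde P g\<close>; at index \<open>0\<close> it is the identity for \<open>P\<close>.\<close>

lemma rota_baxter_tilde:
  assumes "rota_baxter K l A P"
  shows "rota_baxter K l H (tilde P)"
proof -
  note P = linear_mapD[OF rota_baxterD(3)[OF assms]]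
  have c [simp]: "tilde P f \<in> carrier H" if "f \<in> carrier H" for f
    using that P by (simp add: Hur_carrier_iff tilde_def)
  show ?thesis
  proof (rule rota_baxterI[OF algebra_Hur])
    show "linear_map K H H (tilde P)"
      by (rule linear_mapI) (auto simp: fun_eq_iff tilde_def[of _ "_ \<oplus>\<^bsub>_\<^esub> _"] tilde_def Hur_record(1,2) P c[unfolded tilde_def])
    fix f g assume fg: "f \<in> carrier H" "g \<in> carrier H"
    let ?L = "tilde P f \<otimes>\<^bsub>H\<^esub> tilde P g"
    let ?R = "tilde P (f \<otimes>\<^bsub>H\<^esub> tilde P g) \<oplus>\<^bsub>H\<^esub> tilde P (g \<otimes>\<^bsub>H\<^esub> tilde P f) \<oplus>\<^bsub>H\<^esub> l \<odot>\<^bsub>H\<^esub> tilde P (f \<otimes>\<^bsub>H\<^esub> g)"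
    have "shift ?L = shift ?R"
      using fg Hur_mult_comm[OF fg(2) c[OF fg(1)]] Hur_mult_comm[OF fg(1) c[OF fg(2)]]
      by (auto simp: shift_mult shift_add shift_smult shift_tilde fun_eq_iff Hur_record(1) A.M.a_comm)
    moreover have "?L 0 = ?R 0"
      using fg rota_baxterD(4)[OF assms, of "f 0" "g 0"]
      by (simp add: Hur_record(1,2) tilde_0) (simp add: Hur_mult_0 tilde_0)
    ultimately show "?L = ?R"
      unfolding fun_eq_iff shift_def by (metis not0_implies_Suc)
  qed
qed

end

lemma Hur_map_hom:
  assumes l: "l \<in> carrier K" and h: "h \<in> alg_hom K A B"
  shows "Hur_map h \<in> alg_hom K (Hur K l A) (Hur K l B)"
proof -
  note h' = alg_homD[OF h]
  interpret A: weighted_algebra K A l by (rule weighted_algebra.intro[OF h'(1) l])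
  interpret B: weighted_algebra K B l by (rule weighted_algebra.intro[OF h'(2) l])
  have c [simp]: "Hur_map h f \<in> carrier (Hur K l B)" if "f \<in> carrier (Hur K l A)" for f
    using that h'(4) by (simp add: A.Hur_carrier_iff B.Hur_carrier_iff Hur_map_def)
  have s: "shift (Hur_map h f) = Hur_map h (shift f)" for f
    by (simp add: shift_def Hur_map_def)
  show ?thesis
  proof (rule alg_homI[OF A.algebra_Hur B.algebra_Hur])
    show "linear_map K (Hur K l A) (Hur K l B) (Hur_map h)"
      by (rule linear_mapI)
         (auto simp: fun_eq_iff Hur_map_def A.Hur_record(1,2) B.Hur_record(1,2) h' c[unfolded Hur_map_def])
    show "Hur_map h \<one>\<^bsub>Hur K l A\<^esub> = \<one>\<^bsub>Hur K l B\<^esub>"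
      using linear_map_zero[OF A.A.module B.A.module h'(3)]
      by (auto simp: fun_eq_iff Hur_map_def A.Hur_record(4) B.Hur_record(4) h'(8))
    fix f g assume fg: "f \<in> carrier (Hur K l A)" "g \<in> carrier (Hur K l A)"
    show "Hur_map h (f \<otimes>\<^bsub>Hur K l A\<^esub> g) = Hur_map h f \<otimes>\<^bsub>Hur K l B\<^esub> Hur_map h g"
    proof
      fix n show "Hur_map h (f \<otimes>\<^bsub>Hur K l A\<^esub> g) n = (Hur_map h f \<otimes>\<^bsub>Hur K l B\<^esub> Hur_map h g) n"
        using fg
      proof (induction n arbitrary: f g)
        case 0
        then show ?case by (simp add: B.Hur_mult_0) (simp add: Hur_map_def A.Hur_mult_0 h')
      next
        case (Suc n)
        have "Hur_map h (f \<otimes>\<^bsub>Hur K l A\<^esub> g) (Suc n) = Hur_map h (shift f \<otimes>\<^bsub>Hur K l A\<^esub> g) n \<oplus>\<^bsub>B\<^esub>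
           Hur_map h (f \<otimes>\<^bsub>Hur K l A\<^esub> shift g) n \<oplus>\<^bsub>B\<^esub> l \<odot>\<^bsub>B\<^esub> Hur_map h (shift f \<otimes>\<^bsub>Hur K l A\<^esub> shift g) n"
          using Suc.prems l by (simp add: Hur_map_def A.Hur_mult_Suc h')
        then show ?case using Suc by (simp add: B.Hur_mult_Suc s)
      qed
    qed
  qed
qed

lemma Hur_map_rb_hom:
  assumes l: "l \<in> carrier K" and h: "h \<in> rb_hom K l A P B Q"
  shows "Hur_map h \<in> rb_hom K l (Hur K l A) (tilde P) (Hur K l B) (tilde Q)"
proof -
  note h' = rb_homD[OF h]
  interpret A: weighted_algebra K A l by (rule weighted_algebra.intro[OF alg_homD(1)[OF h'(3)] l])
  interpret B: weighted_algebra K B l by (rule weighted_algebra.intro[OF alg_homD(2)[OF h'(3)] l])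
  show ?thesis
    by (rule rb_homI[OF A.rota_baxter_tilde[OF h'(1)] B.rota_baxter_tilde[OF h'(2)] Hur_map_hom[OF l h'(3)]])
       (auto simp: fun_eq_iff Hur_map_def tilde_def h'(4))
qed

section \<open>The mixed distributive law\<close>

text \<open>Only values on the carrier matter, so homomorphisms can be compared with maps that are given by a
  different formula or restricted to be extensional.\<close>

lemma rb_hom_cong:
  assumes f: "f \<in> rb_hom K l R P S Q" and eq: "\<And>x. x \<in> carrier R \<Longrightarrow> g x = f x"
  shows "g \<in> rb_hom K l R P S Q"
proof -
  note f' = rb_homD[OF f] and fh = alg_homD[OF rb_homD(3)[OF f]]
  interpret R: algebra K R by (rule fh(1))
  show ?thesis
  proof (rule rb_homI[OF f'(1,2)])
    show "g \<in> alg_hom K R S"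
      by (rule alg_homI[OF fh(1,2)])
         (use eq fh(4-8) in \<open>auto simp: linear_map_def\<close>)
    show "g (P x) = Q (g x)" if "x \<in> carrier R" for x
      using that eq f'(4) rota_baxterD(2)[OF f'(1)] by simp
  qed
qed

context weighted_algebra
begin

abbreviation P where "P \<equiv> Sha_P K l A"

lemma mu_word_eq: "mu_word K l A ws = rb_word S P (\<lambda>X. X) ws"
  by (induction ws rule: mu_word.induct[of _ K l A]) simp_all

lemma Sha_mu_hom:
  shows "Sha_mu K l A \<in> rb_hom K l (Sha K l S) (Sha_P K l S) S P"
    and "X \<in> carrier S \<Longrightarrow> Sha_mu K l A (Sha_eta K l S X) = X"
proof -
  interpret L: rb_target K S l S P "\<lambda>X. X"
    by (intro rb_target.intro rb_target_axioms.intro weighted_algebra_Sha rota_baxter_Sha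
        alg_homI algebra_Sha linear_map_id) auto
  have "mu_word K l A = rb_word S P (\<lambda>X. X)" by (rule ext) (rule mu_word_eq)
  then have eq: "Sha_mu K l A = rb_lift K S P (\<lambda>X. X)" by (simp only: Sha_mu_def rb_lift_def)
  show "Sha_mu K l A \<in> rb_hom K l (Sha K l S) (Sha_P K l S) S P"
    unfolding eq by (rule L.rb_lift_hom)
  show "X \<in> carrier S \<Longrightarrow> Sha_mu K l A (Sha_eta K l S X) = X"
    unfolding eq by (rule L.rb_lift_eta)
qed

text \<open>\<open>Sha(h)\<close> is the homomorphism induced by \<open>\<eta> \<circ> h\<close>: both have the value \<open>h(a\<^sub>0) \<otimes> \<dots> \<otimes> h(a\<^sub>n)\<close> on
  tensors.\<close>

lemma Sha_map_hom:
  fixes B :: "('k, 'b) module"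
  assumes h: "h \<in> alg_hom K A B"
  shows "Sha_map K l B h \<in> rb_hom K l S P (Sha K l B) (Sha_P K l B)"
    and "a \<in> carrier A \<Longrightarrow> Sha_map K l B h (Sha_eta K l A a) = Sha_eta K l B (h a)"
proof -
  note h' = alg_homD[OF h]
  interpret B: weighted_algebra K B l by (rule weighted_algebra.intro[OF h'(2) weight_closed])
  let ?f = "\<lambda>a. Sha_eta K l B (h a)"
  interpret L: rb_target K A l "Sha K l B" "Sha_P K l B" ?f
    by (intro rb_target.intro rb_target_axioms.intro weighted_algebra_axioms B.rota_baxter_Sha
        alg_hom_comp[OF h B.Sha_eta_hom])
  have map_words: "map h w \<in> words B" if "w \<in> words A" for w
    using that h'(4) by (auto simp: words_def)
  have map_set: "set (map h us) \<subseteq> carrier B" if "set us \<subseteq> carrier A" for us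
    using that h'(4) by auto
  have m: "multilinear K A (Sha K l B) (\<lambda>w. tensor K l B (map h w))"
  proof (rule multilinearI)
    show "tensor K l B (map h w) \<in> carrier (Sha K l B)" if "w \<in> words A" for w
      using that by (intro B.tensor_closed map_words)
  qed (use multilinearD(2,3)[OF B.tensor_multilinear map_set map_set] in \<open>simp_all add: h'\<close>)
  have "rb_word (Sha K l B) (Sha_P K l B) ?f w = tensor K l B (map h w)" if "w \<in> words A" for w
    using that
  proof (induction w)
    case (Cons a w)
    show ?case
    proof (cases "w = []")
      case True
      then show ?thesis by (simp add: Sha_eta_def)
    next
      case False
      with Cons.prems have "a \<in> carrier A" "w \<in> words A" by (auto simp: words_Cons)
      then show ?thesis
        using Cons.IH map_words h'(4) by (simp add: L.rb_word_Cons B.tensor_Cons)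
    qed
  qed (simp add: words_def)
  then have agree: "Sha_map K l B h X = rb_lift K (Sha K l B) (Sha_P K l B) ?f X" if "X \<in> carrier S" for X
    unfolding Sha_map_def
    by (intro Sha_linear_eqI[OF B.module_Sha tensor_lift_linear[OF B.module_Sha m]
          alg_homD(3)[OF rb_homD(3)[OF L.rb_lift_hom]] _ that])
       (simp add: tensor_lift_tensor[OF B.module_Sha m] L.rb_lift_tensor)
  show "Sha_map K l B h \<in> rb_hom K l S P (Sha K l B) (Sha_P K l B)"
    by (rule rb_hom_cong[OF L.rb_lift_hom agree])
  show "Sha_map K l B h (Sha_eta K l A a) = Sha_eta K l B (h a)" if "a \<in> carrier A"
    using that agree L.rb_lift_eta alg_homD(4)[OF Sha_eta_hom] by simp
qed

lemma Hur_eps_rb_hom: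
  assumes "rota_baxter K l A Q"
  shows "Hur_eps \<in> rb_hom K l H (tilde Q) A Q"
  by (rule rb_homI[OF rota_baxter_tilde[OF assms] assms Hur_eps_hom])
     (simp add: Hur_eps_def tilde_def)

lemma Hur_delta_rb_hom:
  assumes "rota_baxter K l A Q"
  shows "Hur_delta \<in> rb_hom K l H (tilde Q) (Hur K l H) (tilde (tilde Q))"
proof -
  interpret H: weighted_algebra K H l by (rule weighted_algebra_Hur)
  show ?thesis
    by (rule rb_homI[OF rota_baxter_tilde[OF assms] H.rota_baxter_tilde[OF rota_baxter_tilde[OF assms]] Hur_delta_hom])
       (auto simp: Hur_delta_def tilde_def fun_eq_iff)
qed

abbreviation SH where "SH \<equiv> Sha K l H"
abbreviation HS where "HS \<equiv> Hur K l S"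

text \<open>The description of \<^const>\<open>beta\<close> is not vacuous: the induced homomorphism, restricted to the
  carrier, is the one map satisfying it.\<close>

lemma beta_characterization:
  shows "beta K l A \<in> rb_hom K l SH (Sha_P K l H) HS (tilde P)"
    and "f \<in> carrier H \<Longrightarrow> beta K l A (Sha_eta K l H f) = Hur_map (Sha_eta K l A) f"
proof -
  interpret H: weighted_algebra K H l by (rule weighted_algebra_Hur)
  interpret S: weighted_algebra K S l by (rule weighted_algebra_Sha)
  let ?f = "Hur_map (Sha_eta K l A)"
  interpret L: rb_target K H l HS "tilde P" ?f
    by (intro rb_target.intro rb_target_axioms.intro weighted_algebra_Hur
        S.rota_baxter_tilde rota_baxter_Sha Hur_map_hom weight_closed Sha_eta_hom)
  let ?b = "restrict (rb_lift K HS (tilde P) ?f) (carrier SH)"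
  let ?Q = "\<lambda>b. b \<in> rb_hom K l SH (Sha_P K l H) HS (tilde P) \<and> b \<in> extensional (carrier SH) \<and>
     (\<forall>f\<in>carrier H. b (Sha_eta K l H f) = ?f f)"
  have "?b \<in> rb_hom K l SH (Sha_P K l H) HS (tilde P)"
    by (rule rb_hom_cong[OF L.rb_lift_hom]) simp
  then have Q: "?Q ?b"
    using alg_homD(4)[OF H.Sha_eta_hom] L.rb_lift_eta by simp
  have "b = ?b" if b: "?Q b" for b
  proof (rule extensionalityI)
    show "b \<in> extensional (carrier SH)" "?b \<in> extensional (carrier SH)" using b by auto
    show "b X = ?b X" if "X \<in> carrier SH" for X
      by (rule H.rb_hom_Sha_eqI[OF conjunct1[OF b] conjunct1[OF Q] _ that])
         (use b Q in simp)
  qed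
  then have "beta K l A = ?b"
    unfolding beta_def using Q by (intro the_equality) blast+
  then have "?Q (beta K l A)" using Q by simp
  then show "beta K l A \<in> rb_hom K l SH (Sha_P K l H) HS (tilde P)"
    and "f \<in> carrier H \<Longrightarrow> beta K l A (Sha_eta K l H f) = Hur_map (Sha_eta K l A) f" by auto
qed

text \<open>On \<open>\<eta>(f)\<close> both sides are the sequence \<open>\<eta>(h(f(n)))\<close>.\<close>

lemma beta_natural:
  fixes B :: "('k, 'b) module"
  assumes h: "h \<in> alg_hom K A B" and w: "w \<in> carrier SH"
  shows "beta K l B (Sha_map K l (Hur K l B) (Hur_map h) w) = Hur_map (Sha_map K l B h) (beta K l A w)"
proof -
  interpret B: weighted_algebra K B l by (rule weighted_algebra.intro[OF alg_homD(2)[OF h] weight_closed])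
  interpret H: weighted_algebra K H l by (rule weighted_algebra_Hur)
  note Hh = Hur_map_hom[OF weight_closed h]
  show ?thesis
  proof (rule H.rb_hom_Sha_eqI[OF rb_hom_comp[OF H.Sha_map_hom(1)[OF Hh] B.beta_characterization(1)]
        rb_hom_comp[OF beta_characterization(1) Hur_map_rb_hom[OF weight_closed Sha_map_hom(1)[OF h]]] _ w])
    fix f assume f: "f \<in> carrier H"
    then show "beta K l B (Sha_map K l (Hur K l B) (Hur_map h) (Sha_eta K l H f))
      = Hur_map (Sha_map K l B h) (beta K l A (Sha_eta K l H f))"
      using alg_homD(4)[OF Hh f]
      by (simp add: H.Sha_map_hom(2)[OF Hh] beta_characterization(2) B.beta_characterization(2))
         (simp add: Hur_map_def Sha_map_hom(2)[OF h])
  qed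
qed

text \<open>On \<open>\<eta>(f)\<close> both sides are \<open>\<eta>(f(0))\<close>.\<close>

lemma beta_counit:
  assumes w: "w \<in> carrier SH"
  shows "Hur_eps (beta K l A w) = Sha_map K l A Hur_eps w"
proof -
  interpret H: weighted_algebra K H l by (rule weighted_algebra_Hur)
  interpret S: weighted_algebra K S l by (rule weighted_algebra_Sha)
  show ?thesis
  proof (rule H.rb_hom_Sha_eqI[OF rb_hom_comp[OF beta_characterization(1) S.Hur_eps_rb_hom[OF rota_baxter_Sha]]
        H.Sha_map_hom(1)[OF Hur_eps_hom] _ w])
    show "Hur_eps (beta K l A (Sha_eta K l H f)) = Sha_map K l A Hur_eps (Sha_eta K l H f)"
      if "f \<in> carrier H" for f
      using that by (simp add: beta_characterization(2) H.Sha_map_hom(2)[OF Hur_eps_hom])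
        (simp add: Hur_eps_def Hur_map_def)
  qed
qed

text \<open>On \<open>\<eta>(f)\<close> both sides are the double sequence \<open>\<eta>(f(m + n))\<close>.\<close>

lemma beta_comultiplication:
  assumes w: "w \<in> carrier SH"
  shows "Hur_delta (beta K l A w) =
     Hur_map (beta K l A) (beta K l H (Sha_map K l (Hur K l H) Hur_delta w))"
proof -
  interpret H: weighted_algebra K H l by (rule weighted_algebra_Hur)
  interpret S: weighted_algebra K S l by (rule weighted_algebra_Sha)
  show ?thesis
  proof (rule H.rb_hom_Sha_eqI[OF
        rb_hom_comp[OF beta_characterization(1) S.Hur_delta_rb_hom[OF rota_baxter_Sha]]
        rb_hom_comp[OF rb_hom_comp[OF H.Sha_map_hom(1)[OF Hur_delta_hom] H.beta_characterization(1)]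
          Hur_map_rb_hom[OF weight_closed beta_characterization(1)]] _ w])
    fix f assume f: "f \<in> carrier H"
    have d: "Hur_delta f \<in> carrier (Hur K l H)" by (rule alg_homD(4)[OF Hur_delta_hom f])
    then have "Hur_delta f m \<in> carrier H" for m by simp
    then show "Hur_delta (beta K l A (Sha_eta K l H f)) =
      Hur_map (beta K l A) (beta K l H (Sha_map K l (Hur K l H) Hur_delta (Sha_eta K l H f)))"
      using d f
      by (simp add: beta_characterization(2) H.beta_characterization(2) H.Sha_map_hom(2)[OF Hur_delta_hom])
         (simp add: Hur_map_def[of "beta K l A"] Hur_map_def[of "Sha_eta K l H"] beta_characterization(2),
          simp add: Hur_map_def Hur_delta_def)
  qed
qed

text \<open>Here the source is free on \<open>Sha(A\<^sup>\<nat>)\<close>, and on the generator \<open>\<eta>(X)\<close> both sides are \<open>\<beta>(X)\<close>, because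
  \<open>\<mu>\<close> is a left inverse of \<open>\<eta>\<close>.\<close>

lemma beta_multiplication:
  assumes w: "w \<in> carrier (Sha K l SH)"
  shows "beta K l A (Sha_mu K l H w) =
     Hur_map (Sha_mu K l A) (beta K l S (Sha_map K l HS (beta K l A) w))"
proof -
  interpret H: weighted_algebra K H l by (rule weighted_algebra_Hur)
  interpret S: weighted_algebra K S l by (rule weighted_algebra_Sha)
  interpret SH: weighted_algebra K SH l by (rule H.weighted_algebra_Sha)
  note bh = rb_homD(3)[OF beta_characterization(1)]
  show ?thesis
  proof (rule SH.rb_hom_Sha_eqI[OF
        rb_hom_comp[OF H.Sha_mu_hom(1) beta_characterization(1)]
        rb_hom_comp[OF rb_hom_comp[OF SH.Sha_map_hom(1)[OF bh] S.beta_characterization(1)]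
          Hur_map_rb_hom[OF weight_closed Sha_mu_hom(1)]] _ w])
    fix X assume X: "X \<in> carrier SH"
    have bX: "beta K l A X \<in> carrier HS" by (rule alg_homD(4)[OF bh X])
    then have "beta K l A X n \<in> carrier S" for n by simp
    then show "beta K l A (Sha_mu K l H (Sha_eta K l SH X)) =
      Hur_map (Sha_mu K l A) (beta K l S (Sha_map K l HS (beta K l A) (Sha_eta K l SH X)))"
      using X bX
      by (simp add: H.Sha_mu_hom(2) SH.Sha_map_hom(2)[OF bh] S.beta_characterization(2))
         (simp add: Hur_map_def Sha_mu_hom(2))
  qed
qed

end

theorem theorem4p4:
  fixes K :: "'k ring" and l :: 'k
  assumes "cring K" and "l \<in> carrier K"
  shows
    \<comment> \<open>the components are morphisms of algebras\<close>
    "(\<forall>A :: ('k, 'a) module. algebra K A \<longrightarrow>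
        beta K l A \<in> alg_hom K (Sha K l (Hur K l A)) (Hur K l (Sha K l A))) \<and>
    \<comment> \<open>naturality\<close>
     (\<forall>(A :: ('k, 'a) module) (B :: ('k, 'b) module) h. h \<in> alg_hom K A B \<longrightarrow>
        (\<forall>w\<in>carrier (Sha K l (Hur K l A)).
           beta K l B (Sha_map K l (Hur K l B) (Hur_map h) w) =
           Hur_map (Sha_map K l B h) (beta K l A w))) \<and>
    \<comment> \<open>compatibility with the unit\<close>
     (\<forall>A :: ('k, 'a) module. algebra K A \<longrightarrow>
        (\<forall>f\<in>carrier (Hur K l A).
           beta K l A (Sha_eta K l (Hur K l A) f) = Hur_map (Sha_eta K l A) f)) \<and>
    \<comment> \<open>compatibility with the counit\<close>
     (\<forall>A :: ('k, 'a) module. algebra K A \<longrightarrow>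
        (\<forall>w\<in>carrier (Sha K l (Hur K l A)).
           Hur_eps (beta K l A w) = Sha_map K l A Hur_eps w)) \<and>
    \<comment> \<open>compatibility with the comultiplication\<close>
     (\<forall>A :: ('k, 'a) module. algebra K A \<longrightarrow>
        (\<forall>w\<in>carrier (Sha K l (Hur K l A)).
           Hur_delta (beta K l A w) =
           Hur_map (beta K l A)
             (beta K l (Hur K l A) (Sha_map K l (Hur K l (Hur K l A)) Hur_delta w)))) \<and>
    \<comment> \<open>compatibility with the multiplication\<close>
     (\<forall>A :: ('k, 'a) module. algebra K A \<longrightarrow>
        (\<forall>w\<in>carrier (Sha K l (Sha K l (Hur K l A))).
           beta K l A (Sha_mu K l (Hur K l A) w) =
           Hur_map (Sha_mu K l A)
             (beta K l (Sha K l A) (Sha_map K l (Hur K l (Sha K l A)) (beta K l A) w))))"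

proof (intro conjI allI impI ballI)
  fix A :: "('k, 'a) module"
  assume A: "algebra K A"
  interpret A: weighted_algebra K A l by (rule weighted_algebra.intro[OF A assms(2)])
  show "beta K l A \<in> alg_hom K (Sha K l (Hur K l A)) (Hur K l (Sha K l A))"
    by (rule rb_homD(3)[OF A.beta_characterization(1)])
  show "beta K l A (Sha_eta K l (Hur K l A) f) = Hur_map (Sha_eta K l A) f"
    if "f \<in> carrier (Hur K l A)" for f
    by (rule A.beta_characterization(2)[OF that])
  show "Hur_eps (beta K l A w) = Sha_map K l A Hur_eps w"
    if "w \<in> carrier (Sha K l (Hur K l A))" for w
    by (rule A.beta_counit[OF that])
  show "Hur_delta (beta K l A w) =
      Hur_map (beta K l A) (beta K l (Hur K l A) (Sha_map K l (Hur K l (Hur K l A)) Hur_delta w))"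
    if "w \<in> carrier (Sha K l (Hur K l A))" for w
    by (rule A.beta_comultiplication[OF that])
  show "beta K l A (Sha_mu K l (Hur K l A) w) =
      Hur_map (Sha_mu K l A) (beta K l (Sha K l A) (Sha_map K l (Hur K l (Sha K l A)) (beta K l A) w))"
    if "w \<in> carrier (Sha K l (Sha K l (Hur K l A)))" for w
    by (rule A.beta_multiplication[OF that])
next
  fix A :: "('k, 'a) module" and B :: "('k, 'b) module" and h w
  assume h: "h \<in> alg_hom K A B" and w: "w \<in> carrier (Sha K l (Hur K l A))"
  interpret A: weighted_algebra K A l by (rule weighted_algebra.intro[OF alg_homD(1)[OF h] assms(2)])
  show "beta K l B (Sha_map K l (Hur K l B) (Hur_map h) w) = Hur_map (Sha_map K l B h) (beta K l A w)"
    by (rule A.beta_natural[OF h w])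
qed

end
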